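(* Let $e$ be a closed effectful $\mathsf{Sample}$ program of type $\tau$, i.e. $\cdot\,;\cdot\vdash_c e:\tau$ (both contexts empty). Then $\mathrm{eval}_{\mathrm{low}}(e)\simeq \mathrm{eval}_{\mathrm{high}}(e)$, where both sides are elements of $\mathcal P[\![\tau]\!]$, $\mathrm{eval}_{\mathrm{high}}(e)=\mathcal H[\![e]\!](\emptyset,\emptyset)$ is given by the high-level semantics, and $\mathrm{eval}_{\mathrm{low}}(e)=\big((\_,\_,x)\leftarrow \mathcal L[\![e]\!](\mathbf 1)(\emptyset,\emptyset);\ \mathrm{return}\ x\big)$ is given by the low-level semantics started in the one-point finite conditional probability space $\mathbf 1$; here $\emptyset$ denotes the empty substitution, and $\simeq$ is equality as importance samplers.
   Context: **Monad $\mathcal P$.** $\mathcal G$ is the Giry probability monad on measurable spaces. $\mathcal P A=\mathcal G([0,\infty)\times A)$ is the writer monad transformer for the monoid $([0,\infty),\cdot,1)$ of weights applied to $\mathcal G$. $\mathrm{return}\,x$ is the Dirac measure at $(1,x)$; $(x\leftarrow\mu;f(x))$ draws $(a,x)\sim\mu$, then $(b,y)\sim f(x)$, and yields $(ab,y)$. For $\mu\in\mathcal G(A)$, $\overline\mu\in\mathcal P A$ is its lifting with weight $1$ (the bar is often omitted). $\mathrm{score}(w)\in\mathcal P\{\star\}$ is the Dirac measure at $(w,\star)$. "$x:=v$" is a local definition. All functions between measurable spaces used as kernels are measurable. **Equality as importance samplers.** $\mu\simeq\nu$ in $\mathcal PA$ iff for all bounded measurable $k:A\to\mathbb R$, $\mathbb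 E_{(a,x)\sim\mu}[a\,k(x)]=\mathbb E_{(b,y)\sim\nu}[b\,k(y)]$ (meaning: one is integrable iff the other is, and then they are equal). **Primitive distributions.** $\mathrm{flip}(p)$: Bernoulli on $\{\top,\bot\}$ with probability $p$ of $\top$ if $p\in[0,1]$, else the point mass at $\bot$. $\mathrm{unif}(a,b)$: uniform on $[a,b]$ if $a\le b$, else the point mass at $\min(a,b)$. $\mathrm{pois}(\lambda)$: Poisson of rate $\lambda$ if $\lambda>0$, else the point mass at $0$. For such $d$, $d(o)$ is the density/mass at $o$: $\mathrm{flip}(p)(o)$ and $\mathrm{pois}(\lambda)(o)$ are probability masses at $o$; $\mathrm{unif}(a,b)(o)=\frac1{b-a}\mathbf 1[a\le o\le b]$ if $a<b$ and $\mathbf 1[o=\min(a,b)]$ if $a\ge b$. **Types.** $\mathsf{Exact}$ types $A,B::=\mathsf{unit}\mid\mathsf{bool}\mid A\times B$. $\mathsf{Sample}$ types $\sigma,\tau::=\mathtt{unit}\mid\mathtt{bool}\mid\mathtt{real}\mid\sigma\times\tau$. Interpretations as measurable spaces: unit is $\{\star\}$, bool is the discrete space $\{\top,\bot\}$, real is $\mathbb R$ (Borel), products are products. An Exact context $\Delta$ (resp. Sample context $\Gamma$) is a finite map from Exact variables $X$ to Exact types (resp. Sample variables $x$ to Sample types); $[\![\Delta]\!]$, $[\![\Gamma]\!]$ are the products of the interpretations (spaces of substitutions $\delta$, $\gamma$). Convertibility $A\sim\tau$ is the least relation with $\mathsf{unit}\sim\mathtt{unit}$, $\mathsf{bool}\sim\mathtt{bool}$,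 and $A\times B\sim\tau\times\sigma$ whenever $A\sim\tau$, $B\sim\sigma$; if $A\sim\tau$ then $[\![A]\!]=[\![\tau]\!]$, so values are silently coerced. **Pure terms.** Pure Exact terms $\Delta\vdash M:A$: variables, $\mathsf{true},\mathsf{false}$, $M\wedge N$, $\neg M$ (on bool), $()$, pairs, $\mathsf{fst}$, $\mathsf{snd}$, with the usual simple typing and the usual set-theoretic meaning $[\![M]\!]:[\![\Delta]\!]\to[\![A]\!]$. Pure Sample terms $\Gamma\vdash e:\tau$: variables, $\mathtt{true},\mathtt{false}$, real literals $r$, $e_1+e_2$, $-e$, $e_1\cdot e_2$ (real), $e_1\le e_2$ (bool), $()$, pairs, $\mathtt{fst},\mathtt{snd}$, with usual typing and meaning $[\![e]\!]:[\![\Gamma]\!]\to[\![\tau]\!]$. **Effectful terms and typing** (judgments $\Gamma;\Delta\vdash_c M:A$ for Exact, $\Gamma;\Delta\vdash_c e:\tau$ for Sample). Exact: $\mathsf{return}\,M:A$ if $\Delta\vdash M:A$; $\mathsf{let}\,X=M\,\mathsf{in}\,N:B$ if $\Gamma;\Delta\vdash_c M:A$ and $\Gamma;\Delta,X{:}A\vdash_c N:B$; $\mathsf{if}\,e\,\mathsf{then}\,M\,\mathsf{else}\,N:A$ if $\Gamma\vdash e:\mathtt{bool}$ (pure) and $\Gamma;\Delta\vdash_c M,N:A$; $\mathsf{flip}\,e:\mathsf{bool}$ if $\Gamma\vdash e:\mathtt{real}$; $\mathsf{observe}\,M:\mathsf{unit}$ if $\Delta\vdash M:\mathsf{bool}$;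 boundary $(\!|e|\!)_E:A$ if $\Gamma;\Delta\vdash_c e:\tau$ and $A\sim\tau$. Sample: $\mathtt{return}\,e:\tau$ if $\Gamma\vdash e:\tau$; $\mathtt{let}\,x=e_1\,\mathtt{in}\,e_2:\tau$ if $\Gamma;\Delta\vdash_c e_1:\sigma$ and $\Gamma,x{:}\sigma;\Delta\vdash_c e_2:\tau$; $\mathtt{if}\,e_1\,\mathtt{then}\,e_2\,\mathtt{else}\,e_3:\tau$ if $\Gamma\vdash e_1:\mathtt{bool}$ and $\Gamma;\Delta\vdash_c e_2,e_3:\tau$; distributions $d$: $\mathtt{flip}\,e:\mathtt{bool}$, $\mathtt{unif}\,e_1\,e_2:\mathtt{real}$, $\mathtt{pois}\,e:\mathtt{real}$ with pure real parameters in $\Gamma$; $\mathtt{obs}(e_o,d):\mathtt{unit}$, where $e_o$ is pure in $\Gamma$, of type bool if $d$ is a flip and real otherwise; boundary $(\!|M|\!)_S:\tau$ if $\Gamma;\Delta\vdash_c M:A$ and $A\sim\tau$. For a distribution expression $d$, $[\![d]\!](\gamma)$ denotes $\mathrm{flip}([\![e]\!]\gamma)$, $\mathrm{unif}([\![e_1]\!]\gamma,[\![e_2]\!]\gamma)$, or $\mathrm{pois}([\![e]\!]\gamma)$. **High-level semantics** $\mathcal H[\![M]\!]:[\![\Gamma]\!]\times[\![\Delta]\!]\to\mathcal P[\![A]\!]$, $\mathcal H[\![e]\!]:[\![\Gamma]\!]\times[\![\Delta]\!]\to\mathcal P[\![\tau]\!]$, at $(\gamma,\delta)$: - $\mathsf{return}\,M$: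 $\mathrm{return}([\![M]\!]\delta)$; $\mathtt{return}\,e$: $\mathrm{return}([\![e]\!]\gamma)$. - $\mathsf{let}\,X=M\,\mathsf{in}\,N$: $x\leftarrow\mathcal H[\![M]\!](\gamma,\delta);\ \mathcal H[\![N]\!](\gamma,\delta[X\mapsto x])$; $\mathtt{let}\,x=e_1\,\mathtt{in}\,e_2$: $v\leftarrow\mathcal H[\![e_1]\!](\gamma,\delta);\ \mathcal H[\![e_2]\!](\gamma[x\mapsto v],\delta)$. - Conditionals (both languages): the branch selected by the value of the guard at $\gamma$. - $\mathsf{flip}\,e$: $\overline{\mathrm{flip}([\![e]\!]\gamma)}$; $d$: $\overline{[\![d]\!](\gamma)}$. - $\mathsf{observe}\,M$: $\mathrm{score}(\mathbf 1[[\![M]\!]\delta=\top])$; $\mathtt{obs}(e_o,d)$: $\mathrm{score}([\![d]\!](\gamma)([\![e_o]\!]\gamma))$. - Boundaries: $\mathcal H[\![(\!|e|\!)_E]\!]=\mathcal H[\![e]\!]$, $\mathcal H[\![(\!|M|\!)_S]\!]=\mathcal H[\![M]\!]$. **Finite conditional probability spaces (FCPS).** Triples $(\Omega,\mu,E)$ with $\Omega=\{0,\dots,n-1\}$ nonempty, $\mu$ a probability distribution on $\Omega$, $E\subseteq\Omega$; often abbreviated $\Omega$. A map $f:(\Omega,\mu,E)\to(\Omega',\mu',E')$ is a measure-preserving function $\Omega\to\Omega'$ with $E\subseteq f^{-1}(E')$. The tensor $(\Omega,\mu,E)\otimes(\Omega',\mu',E')$ is $\Omega\times\Omega'$ with product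 measure and conditioning set $E\times E'$, transported along the bijection $(\omega,\omega')\mapsto|\Omega'|\omega+\omega'$ to a prefix of $\mathbb N$; $\pi_1,\pi_2$ are its projections. $\mathbf 1=(\{0\},\delta_0,\{0\})$. The set of FCPS's is a measurable space via $(\{0,\dots,n-1\},\mu,E)\mapsto(n,[\mu(0),\dots,\mu(n-1)],E)\in\mathbb N\times\mathrm{list}(\mathbb R)\times\mathcal P_{\mathrm{fin}}(\mathbb N)$; sets of tuples $(\Omega',f,X)$ or $(\Omega',f,v)$ get the induced $\sigma$-algebras (discrete on the finite functions $f$ and $X$). $\mu|_E\in\mathcal P\Omega$ is the lifting of the conditional distribution of $\mu$ given $E$ if $\mu(E)>0$, and otherwise the Dirac measure at $(0,\omega_0)$ (weight $0$) for an arbitrary fixed $\omega_0\in\Omega$. As a number, $\mu|_E(F)=\mu(E\cap F)/\mu(E)$ if $\mu(E)>0$ and $0$ otherwise. **Low-level semantics.** For each FCPS $\Omega$, $\mathcal L[\![M]\!](\Omega):[\![\Gamma]\!]\times(\Omega\to[\![\Delta]\!])\to\mathcal P\big(\coprod_{\Omega'}(\Omega'\xrightarrow{\mathrm{FCPS}}\Omega)\times(\Omega'\to[\![A]\!])\big)$ and $\mathcal L[\![e]\!](\Omega):[\![\Gamma]\!]\times(\Omega\to[\![\Delta]\!])\to\mathcal P\big(\coprod_{\Omega'}(\Omega'\xrightarrow{\mathrm{FCPS}}\Omega)\times[\![\tau]\!]\big)$, where $\Omega'$ ranges over FCPS's; at $(\gamma,D)$: - $\mathsf{return}\,M$: $\mathrm{return}(\Omega,\mathrm{id},[\![M]\!]\circ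 D)$; $\mathtt{return}\,e$: $\mathrm{return}(\Omega,\mathrm{id},[\![e]\!]\gamma)$. - $\mathsf{let}\,X=M\,\mathsf{in}\,N$: $(\Omega_1,f_1,V)\leftarrow\mathcal L[\![M]\!](\Omega)(\gamma,D);\ (\Omega_2,f_2,Y)\leftarrow\mathcal L[\![N]\!](\Omega_1)(\gamma,(D\circ f_1)[X\mapsto V]);\ \mathrm{return}(\Omega_2,f_1\circ f_2,Y)$. - $\mathtt{let}\,x=e_1\,\mathtt{in}\,e_2$: $(\Omega_1,f_1,v)\leftarrow\mathcal L[\![e_1]\!](\Omega)(\gamma,D);\ (\Omega_2,f_2,y)\leftarrow\mathcal L[\![e_2]\!](\Omega_1)(\gamma[x\mapsto v],D\circ f_1);\ \mathrm{return}(\Omega_2,f_1\circ f_2,y)$. - Conditionals: the branch selected by the guard at $\gamma$. - $\mathsf{flip}\,e$: let $p=[\![e]\!]\gamma$ if this is in $[0,1]$, else $p=0$; $\Omega_{\mathrm{flip}}=(\{0,1\},\mu,\{0,1\})$ with $\mu(1)=p$; $\mathrm{return}(\Omega\otimes\Omega_{\mathrm{flip}},\pi_1,V)$ where $V(\omega')=\top$ iff $\pi_2(\omega')=1$ (else $\bot$). - $\mathsf{observe}\,M$, at $(\Omega,\mu,E)$: $F:=([\![M]\!]\circ D)^{-1}(\top);\ \mathrm{score}(\mu|_E(F));\ \mathrm{return}((\Omega,\mu,E\cap F),\mathrm{id},\_\mapsto\star)$. - $(\!|e|\!)_E$: $(\Omega',f,x)\leftarrow\mathcal L[\![e]\!](\Omega)(\gamma,D);\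 \mathrm{return}(\Omega',f,\_\mapsto x)$. - $d$: $x\leftarrow\overline{[\![d]\!](\gamma)};\ \mathrm{return}(\Omega,\mathrm{id},x)$. - $\mathtt{obs}(e_o,d)$: $\mathrm{score}([\![d]\!](\gamma)([\![e_o]\!]\gamma));\ \mathrm{return}(\Omega,\mathrm{id},\star)$. - $(\!|M|\!)_S$: $((\Omega',\mu',E'),f,X)\leftarrow\mathcal L[\![M]\!](\Omega)(\gamma,D);\ x\leftarrow(\omega'\leftarrow\mu'|_{E'};\ \mathrm{return}\,X(\omega'));\ \mathrm{return}((\Omega',\mu',E'\cap X^{-1}(x)),f,x)$. *)

theory Defs
  imports "HOL-Probability.Probability" "HOL-Library.Finite_Map"
begin

section \<open>Types, values and their measurable spaces\<close>

datatype exact_ty = EUnitT | EBoolT | EProdT exact_ty exact_ty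

datatype sample_ty = SUnitT | SBoolT | SRealT | SProdT sample_ty sample_ty

inductive convertible :: "exact_ty \<Rightarrow> sample_ty \<Rightarrow> bool" where
  "convertible EUnitT SUnitT"
| "convertible EBoolT SBoolT"
| "convertible A \<tau> \<Longrightarrow> convertible B \<sigma> \<Longrightarrow> convertible (EProdT A B) (SProdT \<tau> \<sigma>)"

text \<open>Both languages take their values in one universe, and a type is interpreted as a measurable
  space of values in it. The interpretations of convertible types then coincide, so that
  coercions are silent.\<close>

datatype val =
    VUnit
  | VBool (the_bool: bool)
  | VReal (the_real: real)
  | VPair (val_fst: val) (val_snd: val)

primrec exact_space :: "exact_ty \<Rightarrow> val measure" where
  "exact_space EUnitT = count_space {VUnit}"
| "exact_space EBoolT = count_space (range VBool)"
| "exact_space (EProdT A B) =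
     embed_measure (exact_space A \<Otimes>\<^sub>M exact_space B) (\<lambda>(u, v). VPair u v)"

primrec sample_space :: "sample_ty \<Rightarrow> val measure" where
  "sample_space SUnitT = count_space {VUnit}"
| "sample_space SBoolT = count_space (range VBool)"
| "sample_space SRealT = embed_measure borel VReal"
| "sample_space (SProdT \<sigma> \<tau>) =
     embed_measure (sample_space \<sigma> \<Otimes>\<^sub>M sample_space \<tau>) (\<lambda>(u, v). VPair u v)"

section \<open>The monad of weighted probability measures\<close>

definition weight_space :: "real measure" where
  "weight_space = restrict_space borel {0..}"

definition P_space :: "'a measure \<Rightarrow> (real \<times> 'a) measure measure" where
  "P_space A = prob_algebra (weight_space \<Otimes>\<^sub>M A)"

definition P_return :: "'a measure \<Rightarrow> 'a \<Rightarrow> (real \<times> 'a) measure" where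
  "P_return A x = return (weight_space \<Otimes>\<^sub>M A) (1, x)"

text \<open>The measure \<open>f x\<close> also serves as the target space of \<open>distr\<close>, which only uses its
  \<open>\<sigma>\<close>-algebra.\<close>

definition P_bind :: "(real \<times> 'a) measure \<Rightarrow> ('a \<Rightarrow> (real \<times> 'b) measure) \<Rightarrow> (real \<times> 'b) measure" where
  "P_bind \<mu> f = Giry_Monad.bind \<mu> (\<lambda>(a, x). distr (f x) (f x) (\<lambda>(b, y). (a * b, y)))"

definition P_lift :: "'a measure \<Rightarrow> (real \<times> 'a) measure" where
  "P_lift \<mu> = distr \<mu> (weight_space \<Otimes>\<^sub>M \<mu>) (\<lambda>x. (1, x))"

definition score :: "real \<Rightarrow> (real \<times> val) measure" where
  "score w = return (weight_space \<Otimes>\<^sub>M count_space {VUnit}) (w, VUnit)"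

definition importance_eq ::
  "'a measure \<Rightarrow> (real \<times> 'a) measure \<Rightarrow> (real \<times> 'a) measure \<Rightarrow> bool" where
  "importance_eq A \<mu> \<nu> \<longleftrightarrow>
     (\<forall>k \<in> borel_measurable A. (\<exists>B. \<forall>x \<in> space A. \<bar>k x\<bar> \<le> B) \<longrightarrow>
        (integrable \<mu> (\<lambda>(a, x). a * k x) \<longleftrightarrow> integrable \<nu> (\<lambda>(b, y). b * k y)) \<and>
        (integrable \<mu> (\<lambda>(a, x). a * k x) \<longrightarrow>
           (\<integral>(a, x). a * k x \<partial>\<mu>) = (\<integral>(b, y). b * k y \<partial>\<nu>)))"

section \<open>Primitive distributions\<close>

text \<open>The library's \<open>bernoulli_pmf\<close> clamps its parameter to the unit interval, so
  out-of-range parameters need a separate case.\<close>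

definition flip_pmf :: "real \<Rightarrow> bool pmf" where
  "flip_pmf p = (if p \<in> {0..1} then bernoulli_pmf p else return_pmf False)"

text \<open>For \<open>a = b\<close> the uniform distribution on \<open>[a,b]\<close> is the point mass at \<open>a = min a b\<close>; the
  library's \<open>uniform_measure\<close> is null on such an interval.\<close>

definition unif_measure :: "real \<Rightarrow> real \<Rightarrow> real measure" where
  "unif_measure a b = (if a < b then uniform_measure lborel {a..b} else return borel (min a b))"

definition unif_density :: "real \<Rightarrow> real \<Rightarrow> real \<Rightarrow> real" where
  "unif_density a b x = (if a < b then 1 / (b - a) * indicator {a..b} x else indicator {min a b} x)"

definition pois_pmf :: "real \<Rightarrow> real pmf" where
  "pois_pmf r = (if 0 < r then map_pmf real (poisson_pmf r) else return_pmf 0)"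

section \<open>Syntax\<close>

type_synonym var = string

datatype exact_pure =
    EVar var | ETrue | EFalse | EAnd exact_pure exact_pure | ENot exact_pure
  | EUnit | EPair exact_pure exact_pure | EFst exact_pure | ESnd exact_pure

datatype sample_pure =
    SVar var | STrue | SFalse | SLit real | SAdd sample_pure sample_pure | SNeg sample_pure
  | SMul sample_pure sample_pure | SLe sample_pure sample_pure
  | SUnit | SPair sample_pure sample_pure | SFst sample_pure | SSnd sample_pure

datatype dist = Flip sample_pure | Unif sample_pure sample_pure | Pois sample_pure

datatype exact_term =
    EReturn exact_pure
  | ELet var exact_term exact_term
  | EIf sample_pure exact_term exact_term
  | EFlip sample_pure
  | EObserve exact_pure
  | EBoundary sample_term
and sample_term =
    SReturn sample_pure
  | SLet var sample_term sample_term
  | SIf sample_pure sample_term sample_term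
  | SDist dist
  | SObs sample_pure dist
  | SBoundary exact_term

section \<open>Typing\<close>

type_synonym exact_ctx = "(var, exact_ty) fmap"
type_synonym sample_ctx = "(var, sample_ty) fmap"

inductive exact_pure_typed :: "exact_ctx \<Rightarrow> exact_pure \<Rightarrow> exact_ty \<Rightarrow> bool" for \<Delta> where
  "fmlookup \<Delta> X = Some A \<Longrightarrow> exact_pure_typed \<Delta> (EVar X) A"
| "exact_pure_typed \<Delta> ETrue EBoolT"
| "exact_pure_typed \<Delta> EFalse EBoolT"
| "exact_pure_typed \<Delta> M EBoolT \<Longrightarrow> exact_pure_typed \<Delta> N EBoolT \<Longrightarrow>
     exact_pure_typed \<Delta> (EAnd M N) EBoolT"
| "exact_pure_typed \<Delta> M EBoolT \<Longrightarrow> exact_pure_typed \<Delta> (ENot M) EBoolT"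
| "exact_pure_typed \<Delta> EUnit EUnitT"
| "exact_pure_typed \<Delta> M A \<Longrightarrow> exact_pure_typed \<Delta> N B \<Longrightarrow>
     exact_pure_typed \<Delta> (EPair M N) (EProdT A B)"
| "exact_pure_typed \<Delta> M (EProdT A B) \<Longrightarrow> exact_pure_typed \<Delta> (EFst M) A"
| "exact_pure_typed \<Delta> M (EProdT A B) \<Longrightarrow> exact_pure_typed \<Delta> (ESnd M) B"

inductive sample_pure_typed :: "sample_ctx \<Rightarrow> sample_pure \<Rightarrow> sample_ty \<Rightarrow> bool" for \<Gamma> where
  "fmlookup \<Gamma> x = Some \<tau> \<Longrightarrow> sample_pure_typed \<Gamma> (SVar x) \<tau>"
| "sample_pure_typed \<Gamma> STrue SBoolT"
| "sample_pure_typed \<Gamma> SFalse SBoolT"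
| "sample_pure_typed \<Gamma> (SLit r) SRealT"
| "sample_pure_typed \<Gamma> e1 SRealT \<Longrightarrow> sample_pure_typed \<Gamma> e2 SRealT \<Longrightarrow>
     sample_pure_typed \<Gamma> (SAdd e1 e2) SRealT"
| "sample_pure_typed \<Gamma> e SRealT \<Longrightarrow> sample_pure_typed \<Gamma> (SNeg e) SRealT"
| "sample_pure_typed \<Gamma> e1 SRealT \<Longrightarrow> sample_pure_typed \<Gamma> e2 SRealT \<Longrightarrow>
     sample_pure_typed \<Gamma> (SMul e1 e2) SRealT"
| "sample_pure_typed \<Gamma> e1 SRealT \<Longrightarrow> sample_pure_typed \<Gamma> e2 SRealT \<Longrightarrow>
     sample_pure_typed \<Gamma> (SLe e1 e2) SBoolT"
| "sample_pure_typed \<Gamma> SUnit SUnitT"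
| "sample_pure_typed \<Gamma> e1 \<sigma> \<Longrightarrow> sample_pure_typed \<Gamma> e2 \<tau> \<Longrightarrow>
     sample_pure_typed \<Gamma> (SPair e1 e2) (SProdT \<sigma> \<tau>)"
| "sample_pure_typed \<Gamma> e (SProdT \<sigma> \<tau>) \<Longrightarrow> sample_pure_typed \<Gamma> (SFst e) \<sigma>"
| "sample_pure_typed \<Gamma> e (SProdT \<sigma> \<tau>) \<Longrightarrow> sample_pure_typed \<Gamma> (SSnd e) \<tau>"

inductive dist_typed :: "sample_ctx \<Rightarrow> dist \<Rightarrow> sample_ty \<Rightarrow> bool" for \<Gamma> where
  "sample_pure_typed \<Gamma> e SRealT \<Longrightarrow> dist_typed \<Gamma> (Flip e) SBoolT"
| "sample_pure_typed \<Gamma> e1 SRealT \<Longrightarrow> sample_pure_typed \<Gamma> e2 SRealT \<Longrightarrow>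
     dist_typed \<Gamma> (Unif e1 e2) SRealT"
| "sample_pure_typed \<Gamma> e SRealT \<Longrightarrow> dist_typed \<Gamma> (Pois e) SRealT"

inductive exact_typed :: "sample_ctx \<Rightarrow> exact_ctx \<Rightarrow> exact_term \<Rightarrow> exact_ty \<Rightarrow> bool"
  and sample_typed :: "sample_ctx \<Rightarrow> exact_ctx \<Rightarrow> sample_term \<Rightarrow> sample_ty \<Rightarrow> bool" where
  "exact_pure_typed \<Delta> M A \<Longrightarrow> exact_typed \<Gamma> \<Delta> (EReturn M) A"
| "exact_typed \<Gamma> \<Delta> M A \<Longrightarrow> exact_typed \<Gamma> (fmupd X A \<Delta>) N B \<Longrightarrow>
     exact_typed \<Gamma> \<Delta> (ELet X M N) B"
| "sample_pure_typed \<Gamma> e SBoolT \<Longrightarrow> exact_typed \<Gamma> \<Delta> M A \<Longrightarrow> exact_typed \<Gamma> \<Delta> N A \<Longrightarrow>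
     exact_typed \<Gamma> \<Delta> (EIf e M N) A"
| "sample_pure_typed \<Gamma> e SRealT \<Longrightarrow> exact_typed \<Gamma> \<Delta> (EFlip e) EBoolT"
| "exact_pure_typed \<Delta> M EBoolT \<Longrightarrow> exact_typed \<Gamma> \<Delta> (EObserve M) EUnitT"
| "sample_typed \<Gamma> \<Delta> e \<tau> \<Longrightarrow> convertible A \<tau> \<Longrightarrow> exact_typed \<Gamma> \<Delta> (EBoundary e) A"
| "sample_pure_typed \<Gamma> e \<tau> \<Longrightarrow> sample_typed \<Gamma> \<Delta> (SReturn e) \<tau>"
| "sample_typed \<Gamma> \<Delta> e1 \<sigma> \<Longrightarrow> sample_typed (fmupd x \<sigma> \<Gamma>) \<Delta> e2 \<tau> \<Longrightarrow>
     sample_typed \<Gamma> \<Delta> (SLet x e1 e2) \<tau>"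
| "sample_pure_typed \<Gamma> e1 SBoolT \<Longrightarrow> sample_typed \<Gamma> \<Delta> e2 \<tau> \<Longrightarrow> sample_typed \<Gamma> \<Delta> e3 \<tau> \<Longrightarrow>
     sample_typed \<Gamma> \<Delta> (SIf e1 e2 e3) \<tau>"
| "dist_typed \<Gamma> d \<tau> \<Longrightarrow> sample_typed \<Gamma> \<Delta> (SDist d) \<tau>"
| "sample_pure_typed \<Gamma> eo \<tau> \<Longrightarrow> dist_typed \<Gamma> d \<tau> \<Longrightarrow> sample_typed \<Gamma> \<Delta> (SObs eo d) SUnitT"
| "exact_typed \<Gamma> \<Delta> M A \<Longrightarrow> convertible A \<tau> \<Longrightarrow> sample_typed \<Gamma> \<Delta> (SBoundary M) \<tau>"

text \<open>A term has at most one type in given contexts. The semantics of a typing judgment is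
  defined by recursion on its term; the types occurring in its derivation are recovered from
  the contexts and the subterms by the following functions.\<close>

definition exact_pure_ty :: "exact_ctx \<Rightarrow> exact_pure \<Rightarrow> exact_ty" where
  "exact_pure_ty \<Delta> M = (THE A. exact_pure_typed \<Delta> M A)"

definition sample_pure_ty :: "sample_ctx \<Rightarrow> sample_pure \<Rightarrow> sample_ty" where
  "sample_pure_ty \<Gamma> e = (THE \<tau>. sample_pure_typed \<Gamma> e \<tau>)"

definition dist_ty :: "sample_ctx \<Rightarrow> dist \<Rightarrow> sample_ty" where
  "dist_ty \<Gamma> d = (THE \<tau>. dist_typed \<Gamma> d \<tau>)"

definition exact_ty_of :: "sample_ctx \<Rightarrow> exact_ctx \<Rightarrow> exact_term \<Rightarrow> exact_ty" where
  "exact_ty_of \<Gamma> \<Delta> M = (THE A. exact_typed \<Gamma> \<Delta> M A)"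

definition sample_ty_of :: "sample_ctx \<Rightarrow> exact_ctx \<Rightarrow> sample_term \<Rightarrow> sample_ty" where
  "sample_ty_of \<Gamma> \<Delta> e = (THE \<tau>. sample_typed \<Gamma> \<Delta> e \<tau>)"

section \<open>Meaning of pure terms and distributions\<close>

text \<open>A substitution for a context is an extensional function on its domain, so the empty
  substitution is constantly \<open>undefined\<close>. The values at ill-typed terms are irrelevant.\<close>

type_synonym subst = "var \<Rightarrow> val"

definition empty_subst :: subst where
  "empty_subst = (\<lambda>_. undefined)"

primrec exact_pure_sem :: "exact_pure \<Rightarrow> subst \<Rightarrow> val" where
  "exact_pure_sem (EVar X) \<delta> = \<delta> X"
| "exact_pure_sem ETrue \<delta> = VBool True"
| "exact_pure_sem EFalse \<delta> = VBool False"
| "exact_pure_sem (EAnd M N) \<delta> =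
     VBool (the_bool (exact_pure_sem M \<delta>) \<and> the_bool (exact_pure_sem N \<delta>))"
| "exact_pure_sem (ENot M) \<delta> = VBool (\<not> the_bool (exact_pure_sem M \<delta>))"
| "exact_pure_sem EUnit \<delta> = VUnit"
| "exact_pure_sem (EPair M N) \<delta> = VPair (exact_pure_sem M \<delta>) (exact_pure_sem N \<delta>)"
| "exact_pure_sem (EFst M) \<delta> = val_fst (exact_pure_sem M \<delta>)"
| "exact_pure_sem (ESnd M) \<delta> = val_snd (exact_pure_sem M \<delta>)"

primrec sample_pure_sem :: "sample_pure \<Rightarrow> subst \<Rightarrow> val" where
  "sample_pure_sem (SVar x) \<gamma> = \<gamma> x"
| "sample_pure_sem STrue \<gamma> = VBool True"
| "sample_pure_sem SFalse \<gamma> = VBool False"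
| "sample_pure_sem (SLit r) \<gamma> = VReal r"
| "sample_pure_sem (SAdd e1 e2) \<gamma> =
     VReal (the_real (sample_pure_sem e1 \<gamma>) + the_real (sample_pure_sem e2 \<gamma>))"
| "sample_pure_sem (SNeg e) \<gamma> = VReal (- the_real (sample_pure_sem e \<gamma>))"
| "sample_pure_sem (SMul e1 e2) \<gamma> =
     VReal (the_real (sample_pure_sem e1 \<gamma>) * the_real (sample_pure_sem e2 \<gamma>))"
| "sample_pure_sem (SLe e1 e2) \<gamma> =
     VBool (the_real (sample_pure_sem e1 \<gamma>) \<le> the_real (sample_pure_sem e2 \<gamma>))"
| "sample_pure_sem SUnit \<gamma> = VUnit"
| "sample_pure_sem (SPair e1 e2) \<gamma> = VPair (sample_pure_sem e1 \<gamma>) (sample_pure_sem e2 \<gamma>)"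
| "sample_pure_sem (SFst e) \<gamma> = val_fst (sample_pure_sem e \<gamma>)"
| "sample_pure_sem (SSnd e) \<gamma> = val_snd (sample_pure_sem e \<gamma>)"

abbreviation real_sem :: "sample_pure \<Rightarrow> subst \<Rightarrow> real" where
  "real_sem e \<gamma> \<equiv> the_real (sample_pure_sem e \<gamma>)"

primrec dist_sem :: "dist \<Rightarrow> subst \<Rightarrow> val measure" where
  "dist_sem (Flip e) \<gamma> =
     distr (measure_pmf (flip_pmf (real_sem e \<gamma>))) (sample_space SBoolT) VBool"
| "dist_sem (Unif e1 e2) \<gamma> =
     distr (unif_measure (real_sem e1 \<gamma>) (real_sem e2 \<gamma>)) (sample_space SRealT) VReal"
| "dist_sem (Pois e) \<gamma> =
     distr (measure_pmf (pois_pmf (real_sem e \<gamma>))) (sample_space SRealT) VReal"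

primrec dist_density :: "dist \<Rightarrow> subst \<Rightarrow> val \<Rightarrow> real" where
  "dist_density (Flip e) \<gamma> v = pmf (flip_pmf (real_sem e \<gamma>)) (the_bool v)"
| "dist_density (Unif e1 e2) \<gamma> v = unif_density (real_sem e1 \<gamma>) (real_sem e2 \<gamma>) (the_real v)"
| "dist_density (Pois e) \<gamma> v = pmf (pois_pmf (real_sem e \<gamma>)) (the_real v)"

section \<open>High-level semantics\<close>

primrec exact_high ::
    "exact_term \<Rightarrow> sample_ctx \<Rightarrow> exact_ctx \<Rightarrow> subst \<Rightarrow> subst \<Rightarrow> (real \<times> val) measure"
  and sample_high ::
    "sample_term \<Rightarrow> sample_ctx \<Rightarrow> exact_ctx \<Rightarrow> subst \<Rightarrow> subst \<Rightarrow> (real \<times> val) measure" where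
  "exact_high (EReturn M) \<Gamma> \<Delta> \<gamma> \<delta> =
     P_return (exact_space (exact_pure_ty \<Delta> M)) (exact_pure_sem M \<delta>)"
| "exact_high (ELet X M N) \<Gamma> \<Delta> \<gamma> \<delta> =
     P_bind (exact_high M \<Gamma> \<Delta> \<gamma> \<delta>)
       (\<lambda>x. exact_high N \<Gamma> (fmupd X (exact_ty_of \<Gamma> \<Delta> M) \<Delta>) \<gamma> (\<delta>(X := x)))"
| "exact_high (EIf e M N) \<Gamma> \<Delta> \<gamma> \<delta> =
     (if the_bool (sample_pure_sem e \<gamma>) then exact_high M \<Gamma> \<Delta> \<gamma> \<delta> else exact_high N \<Gamma> \<Delta> \<gamma> \<delta>)"
| "exact_high (EFlip e) \<Gamma> \<Delta> \<gamma> \<delta> =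
     P_lift (distr (measure_pmf (flip_pmf (real_sem e \<gamma>))) (exact_space EBoolT) VBool)"
| "exact_high (EObserve M) \<Gamma> \<Delta> \<gamma> \<delta> = score (of_bool (exact_pure_sem M \<delta> = VBool True))"
| "exact_high (EBoundary e) \<Gamma> \<Delta> \<gamma> \<delta> = sample_high e \<Gamma> \<Delta> \<gamma> \<delta>"
| "sample_high (SReturn e) \<Gamma> \<Delta> \<gamma> \<delta> =
     P_return (sample_space (sample_pure_ty \<Gamma> e)) (sample_pure_sem e \<gamma>)"
| "sample_high (SLet x e1 e2) \<Gamma> \<Delta> \<gamma> \<delta> =
     P_bind (sample_high e1 \<Gamma> \<Delta> \<gamma> \<delta>)
       (\<lambda>v. sample_high e2 (fmupd x (sample_ty_of \<Gamma> \<Delta> e1) \<Gamma>) \<Delta> (\<gamma>(x := v)) \<delta>)"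
| "sample_high (SIf e1 e2 e3) \<Gamma> \<Delta> \<gamma> \<delta> =
     (if the_bool (sample_pure_sem e1 \<gamma>) then sample_high e2 \<Gamma> \<Delta> \<gamma> \<delta> else sample_high e3 \<Gamma> \<Delta> \<gamma> \<delta>)"
| "sample_high (SDist d) \<Gamma> \<Delta> \<gamma> \<delta> = P_lift (dist_sem d \<gamma>)"
| "sample_high (SObs eo d) \<Gamma> \<Delta> \<gamma> \<delta> = score (dist_density d \<gamma> (sample_pure_sem eo \<gamma>))"
| "sample_high (SBoundary M) \<Gamma> \<Delta> \<gamma> \<delta> = exact_high M \<Gamma> \<Delta> \<gamma> \<delta>"

definition eval_high :: "sample_term \<Rightarrow> (real \<times> val) measure" where
  "eval_high e = sample_high e fmempty fmempty empty_subst empty_subst"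

section \<open>Finite conditional probability spaces\<close>

text \<open>The probability distribution on \<open>{0,\<dots>,n-1}\<close> is a distribution on \<open>nat\<close> supported there
  (see \<open>is_fcps\<close>).\<close>

datatype fcps = FCPS (fcps_size: nat) (fcps_pmf: "nat pmf") (fcps_event: "nat set")

definition fcps_carrier :: "fcps \<Rightarrow> nat set" where
  "fcps_carrier \<Omega> = {..<fcps_size \<Omega>}"

definition is_fcps :: "fcps \<Rightarrow> bool" where
  "is_fcps \<Omega> \<longleftrightarrow> 0 < fcps_size \<Omega> \<and> set_pmf (fcps_pmf \<Omega>) \<subseteq> fcps_carrier \<Omega> \<and>
     fcps_event \<Omega> \<subseteq> fcps_carrier \<Omega>"

definition fcps_hom :: "fcps \<Rightarrow> fcps \<Rightarrow> (nat \<Rightarrow> nat) set" where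
  "fcps_hom \<Omega> \<Omega>' = {f \<in> fcps_carrier \<Omega> \<rightarrow>\<^sub>E fcps_carrier \<Omega>'.
     map_pmf f (fcps_pmf \<Omega>) = fcps_pmf \<Omega>' \<and> (\<forall>\<omega> \<in> fcps_event \<Omega>. f \<omega> \<in> fcps_event \<Omega>')}"

definition fcps_id :: "fcps \<Rightarrow> nat \<Rightarrow> nat" where
  "fcps_id \<Omega> = (\<lambda>\<omega> \<in> fcps_carrier \<Omega>. \<omega>)"

definition fcps_one :: fcps where
  "fcps_one = FCPS 1 (return_pmf 0) {0}"

definition fcps_pairing :: "fcps \<Rightarrow> nat \<times> nat \<Rightarrow> nat" where
  "fcps_pairing \<Omega>' = (\<lambda>(\<omega>, \<omega>'). fcps_size \<Omega>' * \<omega> + \<omega>')"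

definition fcps_tensor :: "fcps \<Rightarrow> fcps \<Rightarrow> fcps" where
  "fcps_tensor \<Omega> \<Omega>' = FCPS (fcps_size \<Omega> * fcps_size \<Omega>')
     (map_pmf (fcps_pairing \<Omega>') (pair_pmf (fcps_pmf \<Omega>) (fcps_pmf \<Omega>')))
     (fcps_pairing \<Omega>' ` (fcps_event \<Omega> \<times> fcps_event \<Omega>'))"

text \<open>Quotient and remainder invert \<open>fcps_pairing\<close>.\<close>

definition fcps_proj1 :: "fcps \<Rightarrow> fcps \<Rightarrow> nat \<Rightarrow> nat" where
  "fcps_proj1 \<Omega> \<Omega>' = (\<lambda>\<omega> \<in> fcps_carrier (fcps_tensor \<Omega> \<Omega>'). \<omega> div fcps_size \<Omega>')"

definition fcps_proj2 :: "fcps \<Rightarrow> fcps \<Rightarrow> nat \<Rightarrow> nat" where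
  "fcps_proj2 \<Omega> \<Omega>' = (\<lambda>\<omega> \<in> fcps_carrier (fcps_tensor \<Omega> \<Omega>'). \<omega> mod fcps_size \<Omega>')"

definition fcps_flip :: "real \<Rightarrow> fcps" where
  "fcps_flip p = FCPS 2 (map_pmf of_bool (bernoulli_pmf (if p \<in> {0..1} then p else 0))) {0, 1}"

definition real_list_space :: "real list measure" where
  "real_list_space = sigma UNIV
     {{xs. length xs = n \<and> (\<forall>i < n. xs ! i \<in> A i)} | n A. \<forall>i < n. A i \<in> sets borel}"

definition fcps_space :: "fcps measure" where
  "fcps_space = vimage_algebra {\<Omega>. is_fcps \<Omega>}
     (\<lambda>\<Omega>. (fcps_size \<Omega>, map (pmf (fcps_pmf \<Omega>)) [0..<fcps_size \<Omega>], fcps_event \<Omega>))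
     (count_space UNIV \<Otimes>\<^sub>M real_list_space \<Otimes>\<^sub>M count_space {E. finite E})"

definition fcps_prob :: "fcps \<Rightarrow> nat set \<Rightarrow> real" where
  "fcps_prob \<Omega> = measure_pmf.prob (fcps_pmf \<Omega>)"

definition fcps_cond_prob :: "fcps \<Rightarrow> nat set \<Rightarrow> real" where
  "fcps_cond_prob \<Omega> F =
     (if fcps_prob \<Omega> (fcps_event \<Omega>) > 0
      then fcps_prob \<Omega> (fcps_event \<Omega> \<inter> F) / fcps_prob \<Omega> (fcps_event \<Omega>) else 0)"

definition fcps_cond :: "fcps \<Rightarrow> (real \<times> nat) measure" where
  "fcps_cond \<Omega> =
     (if fcps_prob \<Omega> (fcps_event \<Omega>) > 0
      then P_lift (restrict_space (measure_pmf (cond_pmf (fcps_pmf \<Omega>) (fcps_event \<Omega>)))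
                     (fcps_carrier \<Omega>))
      else return (weight_space \<Otimes>\<^sub>M count_space (fcps_carrier \<Omega>))
             (0, SOME \<omega>. \<omega> \<in> fcps_carrier \<Omega>))"

definition fcps_restrict :: "fcps \<Rightarrow> nat set \<Rightarrow> fcps" where
  "fcps_restrict \<Omega> F = FCPS (fcps_size \<Omega>) (fcps_pmf \<Omega>) (fcps_event \<Omega> \<inter> F)"

section \<open>Low-level semantics\<close>

text \<open>The coproducts over all finite conditional probability spaces \<open>\<Omega>'\<close> are sets of triples;
  all functions with domain \<open>\<Omega>'\<close> are extensional.\<close>

definition exact_low_space :: "fcps \<Rightarrow> exact_ty \<Rightarrow> (fcps \<times> (nat \<Rightarrow> nat) \<times> (nat \<Rightarrow> val)) measure" where
  "exact_low_space \<Omega> A =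
     restrict_space (fcps_space \<Otimes>\<^sub>M count_space UNIV \<Otimes>\<^sub>M count_space UNIV)
       {(\<Omega>', f, X). is_fcps \<Omega>' \<and> f \<in> fcps_hom \<Omega>' \<Omega> \<and>
          X \<in> fcps_carrier \<Omega>' \<rightarrow>\<^sub>E space (exact_space A)}"

definition sample_low_space :: "fcps \<Rightarrow> sample_ty \<Rightarrow> (fcps \<times> (nat \<Rightarrow> nat) \<times> val) measure" where
  "sample_low_space \<Omega> \<tau> =
     restrict_space (fcps_space \<Otimes>\<^sub>M count_space UNIV \<Otimes>\<^sub>M sample_space \<tau>)
       {(\<Omega>', f, v). is_fcps \<Omega>' \<and> f \<in> fcps_hom \<Omega>' \<Omega> \<and> v \<in> space (sample_space \<tau>)}"

primrec exact_low ::
    "exact_term \<Rightarrow> sample_ctx \<Rightarrow> exact_ctx \<Rightarrow> fcps \<Rightarrow> subst \<Rightarrow> (nat \<Rightarrow> subst) \<Rightarrow>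
       (real \<times> fcps \<times> (nat \<Rightarrow> nat) \<times> (nat \<Rightarrow> val)) measure"
  and sample_low ::
    "sample_term \<Rightarrow> sample_ctx \<Rightarrow> exact_ctx \<Rightarrow> fcps \<Rightarrow> subst \<Rightarrow> (nat \<Rightarrow> subst) \<Rightarrow>
       (real \<times> fcps \<times> (nat \<Rightarrow> nat) \<times> val) measure" where
  "exact_low (EReturn M) \<Gamma> \<Delta> \<Omega> \<gamma> D =
     P_return (exact_low_space \<Omega> (exact_pure_ty \<Delta> M))
       (\<Omega>, fcps_id \<Omega>, \<lambda>\<omega> \<in> fcps_carrier \<Omega>. exact_pure_sem M (D \<omega>))"
| "exact_low (ELet X M N) \<Gamma> \<Delta> \<Omega> \<gamma> D =
     P_bind (exact_low M \<Gamma> \<Delta> \<Omega> \<gamma> D) (\<lambda>(\<Omega>1, f1, V).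
     P_bind (exact_low N \<Gamma> (fmupd X (exact_ty_of \<Gamma> \<Delta> M) \<Delta>) \<Omega>1 \<gamma>
               (\<lambda>\<omega> \<in> fcps_carrier \<Omega>1. (D (f1 \<omega>))(X := V \<omega>))) (\<lambda>(\<Omega>2, f2, Y).
     P_return (exact_low_space \<Omega> (exact_ty_of \<Gamma> \<Delta> (ELet X M N)))
       (\<Omega>2, compose (fcps_carrier \<Omega>2) f1 f2, Y)))"
| "exact_low (EIf e M N) \<Gamma> \<Delta> \<Omega> \<gamma> D =
     (if the_bool (sample_pure_sem e \<gamma>) then exact_low M \<Gamma> \<Delta> \<Omega> \<gamma> D else exact_low N \<Gamma> \<Delta> \<Omega> \<gamma> D)"
| "exact_low (EFlip e) \<Gamma> \<Delta> \<Omega> \<gamma> D =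
     (let \<Omega>f = fcps_flip (real_sem e \<gamma>); \<Omega>' = fcps_tensor \<Omega> \<Omega>f in
      P_return (exact_low_space \<Omega> EBoolT)
        (\<Omega>', fcps_proj1 \<Omega> \<Omega>f, \<lambda>\<omega>' \<in> fcps_carrier \<Omega>'. VBool (fcps_proj2 \<Omega> \<Omega>f \<omega>' = 1)))"
| "exact_low (EObserve M) \<Gamma> \<Delta> \<Omega> \<gamma> D =
     (let F = {\<omega> \<in> fcps_carrier \<Omega>. exact_pure_sem M (D \<omega>) = VBool True} in
      P_bind (score (fcps_cond_prob \<Omega> F)) (\<lambda>_.
      P_return (exact_low_space \<Omega> EUnitT)
        (fcps_restrict \<Omega> F, fcps_id \<Omega>, \<lambda>_ \<in> fcps_carrier \<Omega>. VUnit)))"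
| "exact_low (EBoundary e) \<Gamma> \<Delta> \<Omega> \<gamma> D =
     P_bind (sample_low e \<Gamma> \<Delta> \<Omega> \<gamma> D) (\<lambda>(\<Omega>', f, x).
     P_return (exact_low_space \<Omega> (exact_ty_of \<Gamma> \<Delta> (EBoundary e)))
       (\<Omega>', f, \<lambda>_ \<in> fcps_carrier \<Omega>'. x))"
| "sample_low (SReturn e) \<Gamma> \<Delta> \<Omega> \<gamma> D =
     P_return (sample_low_space \<Omega> (sample_pure_ty \<Gamma> e)) (\<Omega>, fcps_id \<Omega>, sample_pure_sem e \<gamma>)"
| "sample_low (SLet x e1 e2) \<Gamma> \<Delta> \<Omega> \<gamma> D =
     P_bind (sample_low e1 \<Gamma> \<Delta> \<Omega> \<gamma> D) (\<lambda>(\<Omega>1, f1, v).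
     P_bind (sample_low e2 (fmupd x (sample_ty_of \<Gamma> \<Delta> e1) \<Gamma>) \<Delta> \<Omega>1 (\<gamma>(x := v))
               (compose (fcps_carrier \<Omega>1) D f1)) (\<lambda>(\<Omega>2, f2, y).
     P_return (sample_low_space \<Omega> (sample_ty_of \<Gamma> \<Delta> (SLet x e1 e2)))
       (\<Omega>2, compose (fcps_carrier \<Omega>2) f1 f2, y)))"
| "sample_low (SIf e1 e2 e3) \<Gamma> \<Delta> \<Omega> \<gamma> D =
     (if the_bool (sample_pure_sem e1 \<gamma>) then sample_low e2 \<Gamma> \<Delta> \<Omega> \<gamma> D
      else sample_low e3 \<Gamma> \<Delta> \<Omega> \<gamma> D)"
| "sample_low (SDist d) \<Gamma> \<Delta> \<Omega> \<gamma> D =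
     P_bind (P_lift (dist_sem d \<gamma>)) (\<lambda>x.
     P_return (sample_low_space \<Omega> (dist_ty \<Gamma> d)) (\<Omega>, fcps_id \<Omega>, x))"
| "sample_low (SObs eo d) \<Gamma> \<Delta> \<Omega> \<gamma> D =
     P_bind (score (dist_density d \<gamma> (sample_pure_sem eo \<gamma>))) (\<lambda>_.
     P_return (sample_low_space \<Omega> SUnitT) (\<Omega>, fcps_id \<Omega>, VUnit))"
| "sample_low (SBoundary M) \<Gamma> \<Delta> \<Omega> \<gamma> D =
     P_bind (exact_low M \<Gamma> \<Delta> \<Omega> \<gamma> D) (\<lambda>(\<Omega>', f, X).
     P_bind (P_bind (fcps_cond \<Omega>') (\<lambda>\<omega>'. P_return (exact_space (exact_ty_of \<Gamma> \<Delta> M)) (X \<omega>'))) (\<lambda>x.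
     P_return (sample_low_space \<Omega> (sample_ty_of \<Gamma> \<Delta> (SBoundary M)))
       (fcps_restrict \<Omega>' {\<omega>' \<in> fcps_carrier \<Omega>'. X \<omega>' = x}, f, x)))"

definition eval_low :: "sample_term \<Rightarrow> (real \<times> val) measure" where
  "eval_low e =
     P_bind (sample_low e fmempty fmempty fcps_one empty_subst
               (\<lambda>\<omega> \<in> fcps_carrier fcps_one. empty_subst))
       (\<lambda>(_, _, x). P_return (sample_space (sample_ty_of fmempty fmempty e)) x)"

end

theory Submission
  imports Defs
begin

text \<open>
  Integrate a weighted measure against a nonnegative function by multiplying with the weights.
  Conditioning a low-level result \<open>(\<Omega>', f, X)\<close> on its event \<open>E'\<close> and then averaging a test function
  \<open>h\<close> of \<open>(f \<omega>', X \<omega>')\<close> over \<open>\<omega>'\<close> gives a nonnegative function of the result. By induction on the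
  typing derivation, its weighted integral under the low-level semantics started in \<open>(\<Omega>, \<mu>, E)\<close> is
  the average, over \<open>\<omega>\<close> drawn from \<open>\<mu>\<close> conditioned on \<open>E\<close>, of the weighted integral of \<open>h \<omega>\<close> under
  the high-level semantics at \<open>\<omega>\<close>. Observations are the chain rule for conditional probabilities, and
  the boundary from the exact to the sampling language is the law of total probability. A second,
  simultaneous invariant says that a result with a null event has weight zero almost surely when
  the initial event is not null; for the one-point initial space the two together give the theorem.

  The measurable space of low-level results depends on the initial finite space, so the
  measurability of the sequencing operations concerns kernels into a varying trace of one fixed
  space. All data of a finite space except its probabilities range over countable sets.\<close>

subsection \<open>Weighted probability measures\<close>

text \<open>The invariant has to be stronger than the theorem. A statement about values alone would
  not survive sequencing: the continuation of a \<open>let\<close> runs in a new space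
  \<open>\<Omega>1\<close>, at substitutions that still depend on the initial point. Hence the test
  function \<open>h\<close> also receives \<open>f \<omega>'\<close>, the initial point below
  \<omega>', and the integral of the continuation becomes a test function for the first computation.

  The second invariant repairs a mismatch. A result whose event is null has conditional average 0,
  whereas evaluation reads off its value with full weight; the two agree only if such results carry
  no weight. They carry none because every step that shrinks the event either scores its conditional
  probability or draws a value according to it.

  All integrals take values in \<open>ennreal\<close>. Weights need not be integrable, and infinite
  values cause no case distinctions; real-valued test functions return only at the end, through
  positive and negative parts.\<close>

lemma space_weight_space [simp]: "space weight_space = {0..}"
  by (simp add: weight_space_def space_restrict_space)

lemma measurable_weight_real [measurable]: "(\<lambda>a. a) \<in> weight_space \<rightarrow>\<^sub>M borel"
  unfolding weight_space_def by (rule measurable_restrict_space1) simp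

lemma measurable_weight_spaceI:
  assumes "f \<in> borel_measurable N" "\<And>x. x \<in> space N \<Longrightarrow> 0 \<le> f x"
  shows "f \<in> N \<rightarrow>\<^sub>M weight_space"
  unfolding weight_space_def using assms by (intro measurable_restrict_space2) auto

lemma measurable_weight_spaceD: "f \<in> N \<rightarrow>\<^sub>M weight_space \<Longrightarrow> f \<in> borel_measurable N"
  using measurable_compose[OF _ measurable_weight_real] by fastforce

lemma measurable_weight_times:
  assumes f: "f \<in> N \<rightarrow>\<^sub>M weight_space" and g: "g \<in> N \<rightarrow>\<^sub>M weight_space"
  shows "(\<lambda>x. f x * g x) \<in> N \<rightarrow>\<^sub>M weight_space"
proof (rule measurable_weight_spaceI)
  show "(\<lambda>x. f x * g x) \<in> borel_measurable N"
    using f[THEN measurable_weight_spaceD] g[THEN measurable_weight_spaceD] by measurable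
  show "0 \<le> f x * g x" if "x \<in> space N" for x
    using measurable_space[OF f that] measurable_space[OF g that] by simp
qed

lemma space_P_space: "\<mu> \<in> space (P_space A) \<longleftrightarrow> prob_space \<mu> \<and> sets \<mu> = sets (weight_space \<Otimes>\<^sub>M A)"
  by (auto simp: P_space_def space_prob_algebra)

lemma P_space_cong: "sets A = sets B \<Longrightarrow> P_space A = P_space B"
  unfolding P_space_def prob_algebra_def
  by (intro arg_cong2[where f=restrict_space] subprob_algebra_cong sets_pair_measure_cong) auto

lemma P_return_cong: "sets A = sets B \<Longrightarrow> P_return A x = P_return B x"
  unfolding P_return_def by (intro return_cong sets_pair_measure_cong) auto

lemma P_spaceD:
  assumes "\<mu> \<in> space (P_space A)"
  shows "prob_space \<mu>" "sets \<mu> = sets (weight_space \<Otimes>\<^sub>M A)" "space \<mu> = {0..} \<times> space A"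
  using assms sets_eq_imp_space_eq[of \<mu> "weight_space \<Otimes>\<^sub>M A"]
  by (auto simp: space_P_space space_pair_measure)

text \<open>The whole \<sigma>-algebra serves as its own intersection-stable generator, so
  measurability of a kernel comes down to the probabilities of single sets.\<close>

lemma P_space_measurableI:
  assumes "\<And>x. x \<in> space N \<Longrightarrow> \<kappa> x \<in> space (P_space B)"
    and "\<And>X. X \<in> sets (weight_space \<Otimes>\<^sub>M B) \<Longrightarrow> (\<lambda>x. emeasure (\<kappa> x) X) \<in> borel_measurable N"
  shows "\<kappa> \<in> N \<rightarrow>\<^sub>M P_space B"
  unfolding P_space_def
proof (rule measurable_prob_algebra_generated)
  show "sets (weight_space \<Otimes>\<^sub>M B) = sigma_sets (space (weight_space \<Otimes>\<^sub>M B)) (sets (weight_space \<Otimes>\<^sub>M B))"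
    by (rule sets.sigma_sets_eq[symmetric])
qed (use assms in \<open>auto simp: space_P_space Int_stable_def dest: sets.sets_into_space\<close>)

lemma P_space_measurable_nn_integral:
  assumes "\<kappa> \<in> N \<rightarrow>\<^sub>M P_space B" "(\<lambda>(x, y). g x y) \<in> borel_measurable (N \<Otimes>\<^sub>M (weight_space \<Otimes>\<^sub>M B))"
  shows "(\<lambda>x. \<integral>\<^sup>+y. g x y \<partial>\<kappa> x) \<in> borel_measurable N"
  using assms unfolding P_space_def
  by (intro nn_integral_measurable_subprob_algebra2 measurable_prob_algebraD)

subsection \<open>Weighted integrals\<close>

text \<open>The functional E[a g(x)] that defines equality of importance samplers, for nonnegative
  and possibly infinite integrands, so that no integrability has to be tracked.\<close>

definition wint :: "(real \<times> 'a) measure \<Rightarrow> ('a \<Rightarrow> ennreal) \<Rightarrow> ennreal" where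
  "wint \<mu> g = (\<integral>\<^sup>+p. ennreal (fst p) * g (snd p) \<partial>\<mu>)"

lemma weight_times_measurable:
  assumes [measurable]: "g \<in> borel_measurable B"
  shows "(\<lambda>p. ennreal (fst p) * g (snd p)) \<in> borel_measurable (weight_space \<Otimes>\<^sub>M B)"
proof -
  have [measurable]: "fst \<in> borel_measurable (weight_space \<Otimes>\<^sub>M B)"
    by (rule measurable_weight_spaceD) simp
  show ?thesis by (simp add: case_prod_beta)
qed

lemma measurable_wint:
  assumes "\<kappa> \<in> N \<rightarrow>\<^sub>M P_space B" and [measurable]: "(\<lambda>(x, y). g x y) \<in> borel_measurable (N \<Otimes>\<^sub>M B)"
  shows "(\<lambda>x. wint (\<kappa> x) (g x)) \<in> borel_measurable N"
proof -
  have [measurable]: "(\<lambda>x. fst (snd x)) \<in> borel_measurable (N \<Otimes>\<^sub>M (weight_space \<Otimes>\<^sub>M B))"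
    by (rule measurable_weight_spaceD) simp
  have "(\<lambda>(x, p). ennreal (fst p) * g x (snd p)) \<in> borel_measurable (N \<Otimes>\<^sub>M (weight_space \<Otimes>\<^sub>M B))"
    by measurable
  with assms(1) show ?thesis
    unfolding wint_def by (intro P_space_measurable_nn_integral) (auto simp: case_prod_beta)
qed

lemma wint_cong:
  assumes "\<mu> \<in> space (P_space A)" "\<And>x. x \<in> space A \<Longrightarrow> g x = h x"
  shows "wint \<mu> g = wint \<mu> h"
  unfolding wint_def using P_spaceD(3)[OF assms(1)] assms(2)
  by (intro nn_integral_cong) auto

lemma wint_mono:
  assumes "\<mu> \<in> space (P_space A)" "\<And>x. x \<in> space A \<Longrightarrow> g x \<le> h x"
  shows "wint \<mu> g \<le> wint \<mu> h"
  unfolding wint_def using P_spaceD(3)[OF assms(1)] assms(2)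
  by (intro nn_integral_mono) (auto intro: mult_left_mono)

lemma wint_zero [simp]: "wint \<mu> (\<lambda>_. 0) = 0"
  by (simp add: wint_def)

lemma wint_cmult:
  assumes "\<mu> \<in> space (P_space A)" "g \<in> borel_measurable A"
  shows "wint \<mu> (\<lambda>x. c * g x) = c * wint \<mu> g"
proof -
  have "(\<lambda>p. ennreal (fst p) * g (snd p)) \<in> borel_measurable \<mu>"
    using weight_times_measurable[OF assms(2)] measurable_cong_sets[OF P_spaceD(2)[OF assms(1)] refl]
    by auto
  then show ?thesis
    unfolding wint_def by (subst nn_integral_cmult[symmetric]) (auto simp: case_prod_beta ac_simps)
qed

lemma wint_add:
  assumes "\<mu> \<in> space (P_space A)" "g \<in> borel_measurable A" "h \<in> borel_measurable A"
  shows "wint \<mu> (\<lambda>x. g x + h x) = wint \<mu> g + wint \<mu> h"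
proof -
  have "(\<lambda>p. ennreal (fst p) * f (snd p)) \<in> borel_measurable \<mu>" if "f \<in> borel_measurable A" for f
    using weight_times_measurable[OF that] measurable_cong_sets[OF P_spaceD(2)[OF assms(1)] refl] by auto
  from this[OF assms(2)] this[OF assms(3)] show ?thesis
    unfolding wint_def by (simp add: distrib_left nn_integral_add)
qed

lemma wint_sum:
  assumes "\<mu> \<in> space (P_space A)" "\<And>i. i \<in> I \<Longrightarrow> g i \<in> borel_measurable A"
  shows "wint \<mu> (\<lambda>x. \<Sum>i\<in>I. g i x) = (\<Sum>i\<in>I. wint \<mu> (g i))"
proof -
  have "(\<lambda>p. ennreal (fst p) * g i (snd p)) \<in> borel_measurable \<mu>" if "i \<in> I" for i
    using weight_times_measurable[OF assms(2)[OF that]] measurable_cong_sets[OF P_spaceD(2)[OF assms(1)] refl]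
    by auto
  then show ?thesis
    unfolding wint_def by (subst nn_integral_sum[symmetric]) (auto simp: case_prod_beta sum_distrib_left)
qed

lemma P_return_in_space: "x \<in> space A \<Longrightarrow> P_return A x \<in> space (P_space A)"
  by (auto simp: P_return_def space_P_space space_pair_measure intro!: prob_space_return)

lemma wint_P_return:
  assumes "x \<in> space A" "g \<in> borel_measurable A"
  shows "wint (P_return A x) g = g x"
  unfolding wint_def P_return_def
  using assms weight_times_measurable[OF assms(2)]
  by (subst nn_integral_return) (auto simp: space_pair_measure)

lemma P_return_measurable:
  assumes "t \<in> N \<rightarrow>\<^sub>M A"
  shows "(\<lambda>x. P_return A (t x)) \<in> N \<rightarrow>\<^sub>M P_space A"
proof -
  have "(\<lambda>x. (1, t x)) \<in> N \<rightarrow>\<^sub>M weight_space \<Otimes>\<^sub>M A"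
    using assms by (intro measurable_Pair measurable_const) auto
  then show ?thesis
    unfolding P_return_def P_space_def by (rule measurable_compose[OF _ measurable_return_prob_space])
qed

text \<open>\<open>P_lift\<close> takes its target space from the measure itself. A kernel needs one
  target for all parameters, and only the \<sigma>-algebra matters.\<close>

lemma P_lift_pair_cong: "sets \<mu> = sets A \<Longrightarrow> P_lift \<mu> = distr \<mu> (weight_space \<Otimes>\<^sub>M A) (\<lambda>x. (1, x))"
  unfolding P_lift_def by (intro distr_cong sets_pair_measure_cong) auto

lemma P_lift_measurable:
  assumes \<kappa>: "\<kappa> \<in> N \<rightarrow>\<^sub>M prob_algebra A"
  shows "(\<lambda>x. P_lift (\<kappa> x)) \<in> N \<rightarrow>\<^sub>M P_space A"
proof -
  have *: "(\<lambda>x. (1, x)) \<in> A \<rightarrow>\<^sub>M weight_space \<Otimes>\<^sub>M A"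
    by (intro measurable_Pair measurable_const) auto
  have "P_lift (\<kappa> x) = distr (\<kappa> x) (weight_space \<Otimes>\<^sub>M A) (\<lambda>x. (1, x))" if "x \<in> space N" for x
    using measurable_space[OF \<kappa> that] by (intro P_lift_pair_cong) (simp add: space_prob_algebra)
  then show ?thesis
    unfolding P_space_def
    using measurable_compose[OF \<kappa> measurable_distr_prob_space[OF *]]
    by (simp cong: measurable_cong)
qed

lemma wint_P_lift:
  assumes \<mu>: "sets \<mu> = sets A" and g: "g \<in> borel_measurable A"
  shows "wint (P_lift \<mu>) g = (\<integral>\<^sup>+x. g x \<partial>\<mu>)"
proof -
  have *: "Pair 1 \<in> \<mu> \<rightarrow>\<^sub>M weight_space \<Otimes>\<^sub>M A"
    by (intro measurable_Pair measurable_const) (auto simp: measurable_ident_sets[OF \<mu>])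
  show ?thesis
    unfolding wint_def P_lift_pair_cong[OF \<mu>]
    using weight_times_measurable[OF g] by (subst nn_integral_distr[OF *]) auto
qed

lemma score_measurable:
  assumes "f \<in> borel_measurable N" "\<And>x. x \<in> space N \<Longrightarrow> 0 \<le> f x"
  shows "(\<lambda>x. score (f x)) \<in> N \<rightarrow>\<^sub>M P_space (count_space {VUnit})"
proof -
  have "(\<lambda>x. (f x, VUnit)) \<in> N \<rightarrow>\<^sub>M weight_space \<Otimes>\<^sub>M count_space {VUnit}"
    using assms by (intro measurable_Pair measurable_const measurable_weight_spaceI) auto
  then show ?thesis
    unfolding score_def P_space_def by (rule measurable_compose[OF _ measurable_return_prob_space])
qed

lemma wint_score: "0 \<le> w \<Longrightarrow> wint (score w) g = ennreal w * g VUnit"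
  unfolding wint_def score_def
  using weight_times_measurable[of g "count_space {VUnit}"]
  by (subst nn_integral_return) (auto simp: space_pair_measure)

subsection \<open>Sequencing\<close>

lemma P_bind_eq:
  "P_bind \<mu> f = \<mu> \<bind> (\<lambda>(a, x). distr (f x) (f x) (\<lambda>q. (a * fst q, snd q)))"
  by (simp add: P_bind_def split_def)

lemma P_bind_kernel:
  assumes f: "f \<in> A \<rightarrow>\<^sub>M P_space B"
  shows "(\<lambda>(a, x). distr (f x) (f x) (\<lambda>q. (a * fst q, snd q))) \<in> weight_space \<Otimes>\<^sub>M A \<rightarrow>\<^sub>M prob_algebra (weight_space \<Otimes>\<^sub>M B)"
proof -
  have 1: "(\<lambda>p. f (snd p)) \<in> weight_space \<Otimes>\<^sub>M A \<rightarrow>\<^sub>M prob_algebra (weight_space \<Otimes>\<^sub>M B)"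
    using f unfolding P_space_def by measurable
  note [measurable] = measurable_weight_times
  have 2: "(\<lambda>(p, q). (fst p * fst q, snd q)) \<in> (weight_space \<Otimes>\<^sub>M A) \<Otimes>\<^sub>M (weight_space \<Otimes>\<^sub>M B) \<rightarrow>\<^sub>M weight_space \<Otimes>\<^sub>M B"
    by (simp add: case_prod_beta)
  \<comment> \<open>The target space of \<open>distr\<close> varies with the point but always has
    the \<sigma>-algebra of the fixed product, which can therefore replace it.\<close>
  have "distr (f (snd p)) (f (snd p)) (\<lambda>q. (fst p * fst q, snd q))
      = distr (f (snd p)) (weight_space \<Otimes>\<^sub>M B) (\<lambda>q. (fst p * fst q, snd q))" if "p \<in> space (weight_space \<Otimes>\<^sub>M A)" for p
    using measurable_space[OF f, of "snd p"] that
    by (intro distr_cong) (auto simp: space_P_space space_pair_measure)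
  then show ?thesis
    using measurable_distr_prob_space2[OF 1 2] by (simp add: case_prod_beta cong: measurable_cong)
qed

lemma P_bind_in_space:
  assumes \<mu>: "\<mu> \<in> space (P_space A)" and f: "f \<in> A \<rightarrow>\<^sub>M P_space B"
  shows "P_bind \<mu> f \<in> space (P_space B)"
  using prob_space_bind'[OF \<mu>[unfolded P_space_def] P_bind_kernel[OF f]]
    sets_bind'[OF \<mu>[unfolded P_space_def] P_bind_kernel[OF f]]
  by (simp add: space_P_space P_bind_eq)

lemma nn_integral_P_bind:
  assumes \<mu>: "\<mu> \<in> space (P_space A)" and f: "f \<in> A \<rightarrow>\<^sub>M P_space B"
    and g: "g \<in> borel_measurable (weight_space \<Otimes>\<^sub>M B)"
  shows "(\<integral>\<^sup>+p. g p \<partial>P_bind \<mu> f) = (\<integral>\<^sup>+p. (\<integral>\<^sup>+q. g (fst p * fst q, snd q) \<partial>f (snd p)) \<partial>\<mu>)"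
proof -
  have K: "(\<lambda>(a, x). distr (f x) (f x) (\<lambda>q. (a * fst q, snd q))) \<in> \<mu> \<rightarrow>\<^sub>M subprob_algebra (weight_space \<Otimes>\<^sub>M B)"
    using P_bind_kernel[OF f] P_spaceD(2)[OF \<mu>]
    by (auto simp: measurable_prob_algebraD cong: measurable_cong_sets)
  have *: "(\<integral>\<^sup>+p. g p \<partial>distr (f x) (f x) (\<lambda>q. (a * fst q, snd q))) = (\<integral>\<^sup>+q. g (a * fst q, snd q) \<partial>f x)"
    if "0 \<le> a" "x \<in> space A" for a x
  proof -
    have s: "sets (f x) = sets (weight_space \<Otimes>\<^sub>M B)"
      using measurable_space[OF f that(2)] by (simp add: space_P_space)
    have "(\<lambda>_. a) \<in> weight_space \<Otimes>\<^sub>M B \<rightarrow>\<^sub>M weight_space" using that by simp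
    note [measurable] = this measurable_weight_times
    have "(\<lambda>q. (a * fst q, snd q)) \<in> weight_space \<Otimes>\<^sub>M B \<rightarrow>\<^sub>M weight_space \<Otimes>\<^sub>M B"
      by measurable
    then show ?thesis
      using g by (subst nn_integral_distr)
        (auto simp: s case_prod_beta cong: measurable_cong_sets)
  qed
  show ?thesis
    unfolding P_bind_eq nn_integral_bind[OF g K]
    using P_spaceD(3)[OF \<mu>] by (intro nn_integral_cong) (auto simp: *)
qed

text \<open>Weights multiply along \<open>P_bind\<close>, so the outer weight factors out of the
  inner integral and weighted integrals iterate like ordinary ones. The soundness of sequencing
  rests on this equation.\<close>

lemma wint_P_bind:
  assumes \<mu>: "\<mu> \<in> space (P_space A)" and f: "f \<in> A \<rightarrow>\<^sub>M P_space B" and g: "g \<in> borel_measurable B"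
  shows "wint (P_bind \<mu> f) g = wint \<mu> (\<lambda>x. wint (f x) g)"
proof -
  have "(\<integral>\<^sup>+q. ennreal (a * fst q) * g (snd q) \<partial>f x) = ennreal a * (\<integral>\<^sup>+q. ennreal (fst q) * g (snd q) \<partial>f x)"
    if "0 \<le> a" "x \<in> space A" for a x
  proof -
    have fx: "f x \<in> space (P_space B)" using measurable_space[OF f that(2)] .
    have m: "(\<lambda>q. ennreal (fst q) * g (snd q)) \<in> borel_measurable (f x)"
      using weight_times_measurable[OF g] measurable_cong_sets[OF P_spaceD(2)[OF fx] refl]
      by (auto simp: case_prod_beta)
    show ?thesis
      unfolding nn_integral_cmult[OF m, symmetric] using P_spaceD(3)[OF fx] that
      by (intro nn_integral_cong) (auto simp: ennreal_mult' mult.assoc)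
  qed
  then show ?thesis
    unfolding wint_def nn_integral_P_bind[OF \<mu> f weight_times_measurable[OF g]]
    using P_spaceD(3)[OF \<mu>] by (intro nn_integral_cong) (auto simp: case_prod_beta)
qed

subsection \<open>Kernels with varying target space\<close>

text \<open>Measurability in \<open>x\<close> makes sense only in a space that does not depend on
  \<open>x\<close>, so it is stated for the image under the inclusion into \<open>B\<close>.
  Membership in the trace is kept as a separate clause because continuations are measurable only on
  the trace.\<close>

definition dkernel :: "'p measure \<Rightarrow> ('p \<Rightarrow> 'a set) \<Rightarrow> 'a measure \<Rightarrow> ('p \<Rightarrow> (real \<times> 'a) measure) \<Rightarrow> bool" where
  "dkernel N S B \<kappa> \<longleftrightarrow>
     (\<forall>x \<in> space N. \<kappa> x \<in> space (P_space (restrict_space B (S x)))) \<and>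
     (\<lambda>x. distr (\<kappa> x) (weight_space \<Otimes>\<^sub>M B) (\<lambda>p. p)) \<in> N \<rightarrow>\<^sub>M P_space B"

lemma dkernel_in_space: "dkernel N S B \<kappa> \<Longrightarrow> x \<in> space N \<Longrightarrow> \<kappa> x \<in> space (P_space (restrict_space B (S x)))"
  by (simp add: dkernel_def)

lemma measurable_pair_restrict_ident:
  "(\<lambda>p. p) \<in> weight_space \<Otimes>\<^sub>M restrict_space B S \<rightarrow>\<^sub>M weight_space \<Otimes>\<^sub>M B"
proof -
  have "(\<lambda>p. (fst p, snd p)) \<in> weight_space \<Otimes>\<^sub>M restrict_space B S \<rightarrow>\<^sub>M weight_space \<Otimes>\<^sub>M B"
    by (intro measurable_Pair measurable_fst measurable_compose[OF measurable_snd] measurable_restrict_space1) simp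
  then show ?thesis by simp
qed

lemma measurable_extend_ident:
  assumes "\<mu> \<in> space (P_space (restrict_space B S))"
  shows "(\<lambda>p. p) \<in> \<mu> \<rightarrow>\<^sub>M weight_space \<Otimes>\<^sub>M B"
  using measurable_pair_restrict_ident measurable_cong_sets[OF P_spaceD(2)[OF assms] refl] by blast

lemma nn_integral_extend:
  assumes "\<mu> \<in> space (P_space (restrict_space B S))" "g \<in> borel_measurable (weight_space \<Otimes>\<^sub>M B)"
  shows "(\<integral>\<^sup>+p. g p \<partial>distr \<mu> (weight_space \<Otimes>\<^sub>M B) (\<lambda>p. p)) = (\<integral>\<^sup>+p. g p \<partial>\<mu>)"
  using assms by (subst nn_integral_distr[OF measurable_extend_ident]) auto

lemma extend_in_space:
  assumes "\<mu> \<in> space (P_space (restrict_space B S))"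
  shows "distr \<mu> (weight_space \<Otimes>\<^sub>M B) (\<lambda>p. p) \<in> space (P_space B)"
  using P_spaceD(1)[OF assms] measurable_extend_ident[OF assms]
  by (auto simp: space_P_space intro!: prob_space.prob_space_distr)

text \<open>Integrals of indicators replace \<open>emeasure (\<kappa> x) X\<close>: a measurable set
  of the ambient space need not belong to the \<sigma>-algebra of the trace, and a measure is 0 by
  default outside its \<sigma>-algebra.\<close>

lemma dkernelI:
  assumes "\<And>x. x \<in> space N \<Longrightarrow> \<kappa> x \<in> space (P_space (restrict_space B (S x)))"
    and "\<And>X. X \<in> sets (weight_space \<Otimes>\<^sub>M B) \<Longrightarrow> (\<lambda>x. \<integral>\<^sup>+p. indicator X p \<partial>\<kappa> x) \<in> borel_measurable N"
  shows "dkernel N S B \<kappa>"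
  unfolding dkernel_def
proof (intro conjI ballI P_space_measurableI)
  fix X assume X: "X \<in> sets (weight_space \<Otimes>\<^sub>M B)"
  have "emeasure (distr (\<kappa> x) (weight_space \<Otimes>\<^sub>M B) (\<lambda>p. p)) X = (\<integral>\<^sup>+p. indicator X p \<partial>\<kappa> x)" if "x \<in> space N" for x
    using nn_integral_extend[OF assms(1)[OF that], of "indicator X"] X by simp
  then show "(\<lambda>x. emeasure (distr (\<kappa> x) (weight_space \<Otimes>\<^sub>M B) (\<lambda>p. p)) X) \<in> borel_measurable N"
    using assms(2)[OF X] by (simp cong: measurable_cong)
qed (use assms(1) extend_in_space in blast)+

lemma dkernel_nn_integral:
  assumes \<kappa>: "dkernel N S B \<kappa>"
    and g: "(\<lambda>(x, y). g x y) \<in> borel_measurable (N \<Otimes>\<^sub>M (weight_space \<Otimes>\<^sub>M B))"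
  shows "(\<lambda>x. \<integral>\<^sup>+y. g x y \<partial>\<kappa> x) \<in> borel_measurable N"
proof -
  have "(\<integral>\<^sup>+y. g x y \<partial>distr (\<kappa> x) (weight_space \<Otimes>\<^sub>M B) (\<lambda>p. p)) = (\<integral>\<^sup>+y. g x y \<partial>\<kappa> x)" if "x \<in> space N" for x
    using measurable_compose[OF measurable_Pair1'[OF that] g]
    by (intro nn_integral_extend[OF dkernel_in_space[OF \<kappa> that]]) simp
  moreover have "(\<lambda>x. distr (\<kappa> x) (weight_space \<Otimes>\<^sub>M B) (\<lambda>p. p)) \<in> N \<rightarrow>\<^sub>M P_space B"
    using \<kappa> by (simp add: dkernel_def)
  from P_space_measurable_nn_integral[OF this g]
  have "(\<lambda>x. \<integral>\<^sup>+y. g x y \<partial>distr (\<kappa> x) (weight_space \<Otimes>\<^sub>M B) (\<lambda>p. p)) \<in> borel_measurable N" .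
  ultimately show ?thesis
    by (simp cong: measurable_cong)
qed

text \<open>With a constant fibre the trace is itself a fixed space. Its product with the weights is
  generated by rectangles, and each of these is the trace of an ambient rectangle, for which
  measurability is already known.\<close>

lemma dkernel_fixed:
  assumes \<kappa>: "dkernel N (\<lambda>_. T) B \<kappa>"
  shows "\<kappa> \<in> N \<rightarrow>\<^sub>M P_space (restrict_space B T)"
  unfolding P_space_def
proof (rule measurable_prob_algebra_generated[OF sets_pair_measure Int_stable_pair_measure_generator pair_measure_closed])
  fix x assume "x \<in> space N"
  then show "prob_space (\<kappa> x)" "sets (\<kappa> x) = sets (weight_space \<Otimes>\<^sub>M restrict_space B T)"
    using dkernel_in_space[OF \<kappa>] by (auto simp: space_P_space)
next
  fix X assume "X \<in> {a \<times> b | a b. a \<in> sets weight_space \<and> b \<in> sets (restrict_space B T)}"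
  then obtain a b where X: "X = a \<times> (T \<inter> b)" and a: "a \<in> sets weight_space" and b: "b \<in> sets B"
    by (auto simp: sets_restrict_space)
  have ab: "a \<times> b \<in> sets (weight_space \<Otimes>\<^sub>M B)" using a b by simp
  have "(\<integral>\<^sup>+p. indicator (a \<times> b) p \<partial>\<kappa> x) = emeasure (\<kappa> x) X" if "x \<in> space N" for x
  proof -
    note x = dkernel_in_space[OF \<kappa> that]
    have "X \<in> sets (\<kappa> x)"
      unfolding X P_spaceD(2)[OF x] using a b by (auto simp: sets_restrict_space)
    moreover have "(\<integral>\<^sup>+p. indicator (a \<times> b) p \<partial>\<kappa> x) = (\<integral>\<^sup>+p. indicator X p \<partial>\<kappa> x)"
      using P_spaceD(3)[OF x] by (intro nn_integral_cong) (auto simp: X space_restrict_space split: split_indicator)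
    ultimately show ?thesis by simp
  qed
  moreover have "(\<lambda>x. \<integral>\<^sup>+p. indicator (a \<times> b) p \<partial>\<kappa> x) \<in> borel_measurable N"
    using ab by (intro dkernel_nn_integral[OF \<kappa>]) simp
  ultimately show "(\<lambda>x. emeasure (\<kappa> x) X) \<in> borel_measurable N"
    by (simp cong: measurable_cong)
qed

lemma restrict_space_UNIV_sets: "sets (restrict_space B UNIV) = sets B"
  by (auto simp: sets_restrict_space)

lemma dkernel_UNIV: "dkernel N (\<lambda>_. UNIV) B \<kappa> \<longleftrightarrow> \<kappa> \<in> N \<rightarrow>\<^sub>M P_space B"
proof
  assume "dkernel N (\<lambda>_. UNIV) B \<kappa>"
  from dkernel_fixed[OF this] show "\<kappa> \<in> N \<rightarrow>\<^sub>M P_space B"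
    by (simp add: P_space_cong[OF restrict_space_UNIV_sets])
next
  assume \<kappa>: "\<kappa> \<in> N \<rightarrow>\<^sub>M P_space B"
  show "dkernel N (\<lambda>_. UNIV) B \<kappa>"
  proof (rule dkernelI)
    show "\<kappa> x \<in> space (P_space (restrict_space B UNIV))" if "x \<in> space N" for x
      using measurable_space[OF \<kappa> that] by (simp add: P_space_cong[OF restrict_space_UNIV_sets])
    show "(\<lambda>x. \<integral>\<^sup>+p. indicator X p \<partial>\<kappa> x) \<in> borel_measurable N" if "X \<in> sets (weight_space \<Otimes>\<^sub>M B)" for X
      using that by (intro P_space_measurable_nn_integral[OF \<kappa>]) simp
  qed
qed

lemma dkernel_compose:
  assumes \<kappa>: "dkernel N S B \<kappa>" and t: "t \<in> N' \<rightarrow>\<^sub>M N"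
  shows "dkernel N' (\<lambda>x. S (t x)) B (\<lambda>x. \<kappa> (t x))"
  using \<kappa> measurable_space[OF t] measurable_compose[OF t] unfolding dkernel_def by blast

lemma dkernel_return:
  assumes t: "t \<in> N \<rightarrow>\<^sub>M B" and S: "\<And>x. x \<in> space N \<Longrightarrow> t x \<in> S x"
  shows "dkernel N S B (\<lambda>x. P_return (restrict_space B (S x)) (t x))"
proof (rule dkernelI)
  fix x assume "x \<in> space N"
  then show "P_return (restrict_space B (S x)) (t x) \<in> space (P_space (restrict_space B (S x)))"
    using measurable_space[OF t] S by (intro P_return_in_space) (simp add: space_restrict_space)
next
  fix X assume X: "X \<in> sets (weight_space \<Otimes>\<^sub>M B)"
  have "(\<integral>\<^sup>+p. indicator X p \<partial>P_return (restrict_space B (S x)) (t x)) = indicator X (1, t x)"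
    if "x \<in> space N" for x
    unfolding P_return_def using measurable_space[OF t that] S[OF that]
      measurable_compose[OF measurable_pair_restrict_ident borel_measurable_indicator[OF X]]
    by (subst nn_integral_return) (auto simp: space_pair_measure space_restrict_space)
  moreover have "(\<lambda>x. (1, t x)) \<in> N \<rightarrow>\<^sub>M weight_space \<Otimes>\<^sub>M B"
    using t by (intro measurable_Pair measurable_const) auto
  then have "(\<lambda>x. indicator X (1, t x) :: ennreal) \<in> borel_measurable N"
    using X by measurable
  ultimately show "(\<lambda>x. \<integral>\<^sup>+p. indicator X p \<partial>P_return (restrict_space B (S x)) (t x)) \<in> borel_measurable N"
    by (simp cong: measurable_cong)
qed

lemma dkernel_if:
  assumes "Measurable.pred N P"
    and \<kappa>: "dkernel N S B \<kappa>" and \<kappa>': "dkernel N S B \<kappa>'"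
  shows "dkernel N S B (\<lambda>x. if P x then \<kappa> x else \<kappa>' x)"
proof (rule dkernelI)
  fix X assume "X \<in> sets (weight_space \<Otimes>\<^sub>M B)"
  then have [measurable]: "(\<lambda>x. \<integral>\<^sup>+p. indicator X p \<partial>\<kappa> x) \<in> borel_measurable N"
    "(\<lambda>x. \<integral>\<^sup>+p. indicator X p \<partial>\<kappa>' x) \<in> borel_measurable N"
    by (auto intro!: dkernel_nn_integral[OF \<kappa>] dkernel_nn_integral[OF \<kappa>'])
  have "(\<lambda>x. \<integral>\<^sup>+p. indicator X p \<partial>(if P x then \<kappa> x else \<kappa>' x)) =
      (\<lambda>x. if P x then \<integral>\<^sup>+p. indicator X p \<partial>\<kappa> x else \<integral>\<^sup>+p. indicator X p \<partial>\<kappa>' x)"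
    by auto
  then show "(\<lambda>x. \<integral>\<^sup>+p. indicator X p \<partial>(if P x then \<kappa> x else \<kappa>' x)) \<in> borel_measurable N"
    using assms(1) by simp
qed (use dkernel_in_space[OF \<kappa>] dkernel_in_space[OF \<kappa>'] in auto)

text \<open>Freezing \<open>x\<close> embeds the fibre over \<open>x\<close> into the graph of
  \<open>S\<close>, and the target \<open>T x\<close> is then constant; so a kernel on the graph
  restricts to an ordinary kernel on each fibre.\<close>

lemma dkernel_bind_slice:
  assumes \<eta>: "dkernel (restrict_space (N \<Otimes>\<^sub>M B) {z. snd z \<in> S (fst z)}) (\<lambda>z. T (fst z)) C (\<lambda>z. \<eta> (fst z) (snd z))"
    and x: "x \<in> space N"
  shows "\<eta> x \<in> restrict_space B (S x) \<rightarrow>\<^sub>M P_space (restrict_space C (T x))"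
proof -
  have "(\<lambda>y. (x, y)) \<in> restrict_space B (S x) \<rightarrow>\<^sub>M restrict_space (N \<Otimes>\<^sub>M B) {z. snd z \<in> S (fst z)}"
    using x by (intro measurable_restrict_space2 measurable_restrict_space1 measurable_Pair1')
      (auto simp: space_restrict_space)
  from dkernel_compose[OF \<eta> this] show ?thesis
    by (intro dkernel_fixed) simp
qed

text \<open>The continuation is controlled only on the graph of \<open>S\<close>. Because the graph
  is measurable, integrands can be extended by 0 to the full product, where integration against
  \<open>\<kappa>\<close> is measurable.\<close>

lemma dkernel_bind:
  assumes \<kappa>: "dkernel N S B \<kappa>"
    and S: "Measurable.pred (N \<Otimes>\<^sub>M B) (\<lambda>z. snd z \<in> S (fst z))"
    and \<eta>: "dkernel (restrict_space (N \<Otimes>\<^sub>M B) {z. snd z \<in> S (fst z)}) (\<lambda>z. T (fst z)) C (\<lambda>z. \<eta> (fst z) (snd z))"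
  shows "dkernel N T C (\<lambda>x. P_bind (\<kappa> x) (\<eta> x))"
proof (rule dkernelI)
  fix x assume x: "x \<in> space N"
  show "P_bind (\<kappa> x) (\<eta> x) \<in> space (P_space (restrict_space C (T x)))"
    by (rule P_bind_in_space[OF dkernel_in_space[OF \<kappa> x] dkernel_bind_slice[OF \<eta> x]])
next
  fix X assume X: "X \<in> sets (weight_space \<Otimes>\<^sub>M C)"
  let ?R = "restrict_space (N \<Otimes>\<^sub>M B) {z. snd z \<in> S (fst z)}"
  let ?M = "N \<Otimes>\<^sub>M (weight_space \<Otimes>\<^sub>M B)"
  define G where "G x p = (\<integral>\<^sup>+q. indicator X (fst p * fst q, snd q) \<partial>\<eta> x (snd p))" for x and p :: "real \<times> 'b"
  \<comment> \<open>\<open>\<kappa> x\<close> lives on \<open>S x\<close>, so putting 0 elsewhere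
    does not change the integral.\<close>
  have eq: "(\<integral>\<^sup>+p. indicator X p \<partial>P_bind (\<kappa> x) (\<eta> x)) = (\<integral>\<^sup>+p. (if snd p \<in> S x then G x p else 0) \<partial>\<kappa> x)"
    if x: "x \<in> space N" for x
  proof -
    have "indicator X \<in> borel_measurable (weight_space \<Otimes>\<^sub>M restrict_space C (T x))"
      using measurable_compose[OF measurable_pair_restrict_ident borel_measurable_indicator[OF X]] .
    from nn_integral_P_bind[OF dkernel_in_space[OF \<kappa> x] dkernel_bind_slice[OF \<eta> x] this]
    show ?thesis
      using P_spaceD(3)[OF dkernel_in_space[OF \<kappa> x]]
      by (auto simp: G_def space_restrict_space intro!: nn_integral_cong)
  qed
  have P: "Measurable.pred ?M (\<lambda>z. snd (snd z) \<in> S (fst z))"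
    using measurable_compose[OF _ S, of "\<lambda>z. (fst z, snd (snd z))" ?M] by simp
  have "(\<lambda>z. G (fst z) (snd z)) \<in> borel_measurable (restrict_space ?M {z. snd (snd z) \<in> S (fst z)})"
  proof -
    let ?M' = "restrict_space ?M {z. snd (snd z) \<in> S (fst z)}"
    have "(\<lambda>z. (fst z, snd (snd z))) \<in> ?M' \<rightarrow>\<^sub>M ?R"
      by (intro measurable_restrict_space2 measurable_restrict_space1) (auto simp: space_restrict_space)
    from dkernel_compose[OF \<eta> this]
    have k: "dkernel ?M' (\<lambda>z. T (fst z)) C (\<lambda>z. \<eta> (fst z) (snd (snd z)))"
      by simp
    have 1: "(\<lambda>v. fst (snd (fst v))) \<in> ?M' \<Otimes>\<^sub>M (weight_space \<Otimes>\<^sub>M C) \<rightarrow>\<^sub>M weight_space"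
      by (rule measurable_compose[OF measurable_fst], rule measurable_restrict_space1) simp
    have "(\<lambda>v. (fst (snd (fst v)) * fst (snd v), snd (snd v))) \<in> ?M' \<Otimes>\<^sub>M (weight_space \<Otimes>\<^sub>M C) \<rightarrow>\<^sub>M weight_space \<Otimes>\<^sub>M C"
      by (intro measurable_Pair measurable_weight_times 1) simp_all
    from measurable_compose[OF this borel_measurable_indicator[OF X]]
    show ?thesis
      unfolding G_def by (intro dkernel_nn_integral[OF k]) (simp add: split_def)
  qed
  then have "(\<lambda>z. if snd (snd z) \<in> S (fst z) then G (fst z) (snd z) else 0) \<in> borel_measurable ?M"
    using P by (subst measurable_If_restrict_space_iff) (auto simp: pred_def)
  then have "(\<lambda>x. \<integral>\<^sup>+p. (if snd p \<in> S x then G x p else 0) \<partial>\<kappa> x) \<in> borel_measurable N"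
    by (intro dkernel_nn_integral[OF \<kappa>]) (simp add: case_prod_beta)
  then show "(\<lambda>x. \<integral>\<^sup>+p. indicator X p \<partial>P_bind (\<kappa> x) (\<eta> x)) \<in> borel_measurable N"
    by (simp add: eq cong: measurable_cong)
qed

lemma wint_dkernel_bind:
  assumes \<kappa>: "dkernel N S B \<kappa>"
    and \<eta>: "dkernel (restrict_space (N \<Otimes>\<^sub>M B) {z. snd z \<in> S (fst z)}) (\<lambda>z. T (fst z)) C (\<lambda>z. \<eta> (fst z) (snd z))"
    and x: "x \<in> space N" and g: "g \<in> borel_measurable C"
  shows "wint (P_bind (\<kappa> x) (\<eta> x)) g = wint (\<kappa> x) (\<lambda>y. wint (\<eta> x y) g)"
  by (rule wint_P_bind[OF dkernel_in_space[OF \<kappa> x] dkernel_bind_slice[OF \<eta> x] measurable_restrict_space1[OF g]])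

lemma P_bind_measurable:
  assumes \<kappa>: "\<kappa> \<in> N \<rightarrow>\<^sub>M P_space A" and \<eta>: "(\<lambda>z. \<eta> (fst z) (snd z)) \<in> N \<Otimes>\<^sub>M A \<rightarrow>\<^sub>M P_space B"
  shows "(\<lambda>x. P_bind (\<kappa> x) (\<eta> x)) \<in> N \<rightarrow>\<^sub>M P_space B"
  unfolding dkernel_UNIV[symmetric]
proof (rule dkernel_bind[where S="\<lambda>_. UNIV"])
  show "dkernel (restrict_space (N \<Otimes>\<^sub>M A) {z. snd z \<in> UNIV}) (\<lambda>z. UNIV) B (\<lambda>z. \<eta> (fst z) (snd z))"
    using \<eta> by (simp add: dkernel_UNIV measurable_restrict_space1)
qed (use \<kappa> in \<open>simp_all add: dkernel_UNIV\<close>)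

subsection \<open>Uniqueness of types\<close>

inductive_cases exact_pure_typedE:
  "exact_pure_typed \<Delta> (EVar X) A" "exact_pure_typed \<Delta> ETrue A" "exact_pure_typed \<Delta> EFalse A"
  "exact_pure_typed \<Delta> (EAnd M N) A" "exact_pure_typed \<Delta> (ENot M) A" "exact_pure_typed \<Delta> EUnit A"
  "exact_pure_typed \<Delta> (EPair M N) A" "exact_pure_typed \<Delta> (EFst M) A" "exact_pure_typed \<Delta> (ESnd M) A"

inductive_cases sample_pure_typedE:
  "sample_pure_typed \<Gamma> (SVar x) \<tau>" "sample_pure_typed \<Gamma> STrue \<tau>" "sample_pure_typed \<Gamma> SFalse \<tau>"
  "sample_pure_typed \<Gamma> (SLit r) \<tau>" "sample_pure_typed \<Gamma> (SAdd e1 e2) \<tau>" "sample_pure_typed \<Gamma> (SNeg e) \<tau>"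
  "sample_pure_typed \<Gamma> (SMul e1 e2) \<tau>" "sample_pure_typed \<Gamma> (SLe e1 e2) \<tau>" "sample_pure_typed \<Gamma> SUnit \<tau>"
  "sample_pure_typed \<Gamma> (SPair e1 e2) \<tau>" "sample_pure_typed \<Gamma> (SFst e) \<tau>" "sample_pure_typed \<Gamma> (SSnd e) \<tau>"

inductive_cases dist_typedE:
  "dist_typed \<Gamma> (Flip e) \<tau>" "dist_typed \<Gamma> (Unif e1 e2) \<tau>" "dist_typed \<Gamma> (Pois e) \<tau>"

inductive_cases exact_typedE:
  "exact_typed \<Gamma> \<Delta> (EReturn M) A" "exact_typed \<Gamma> \<Delta> (ELet X M N) A" "exact_typed \<Gamma> \<Delta> (EIf e M N) A"
  "exact_typed \<Gamma> \<Delta> (EFlip e) A" "exact_typed \<Gamma> \<Delta> (EObserve M) A" "exact_typed \<Gamma> \<Delta> (EBoundary e) A"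

inductive_cases sample_typedE:
  "sample_typed \<Gamma> \<Delta> (SReturn e) \<tau>" "sample_typed \<Gamma> \<Delta> (SLet x e1 e2) \<tau>" "sample_typed \<Gamma> \<Delta> (SIf e1 e2 e3) \<tau>"
  "sample_typed \<Gamma> \<Delta> (SDist d) \<tau>" "sample_typed \<Gamma> \<Delta> (SObs eo d) \<tau>" "sample_typed \<Gamma> \<Delta> (SBoundary M) \<tau>"

inductive_cases convertibleE:
  "convertible EUnitT \<tau>" "convertible EBoolT \<tau>" "convertible (EProdT A B) \<tau>"
  "convertible A SUnitT" "convertible A SBoolT" "convertible A (SProdT \<tau> \<sigma>)"

text \<open>Convertibility is a partial one-to-one correspondence. In both directions this makes the
  type of a boundary term unique.\<close>

lemma convertible_unique_right: "convertible A \<tau> \<Longrightarrow> convertible A \<sigma> \<Longrightarrow> \<tau> = \<sigma>"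
  by (induction arbitrary: \<sigma> rule: convertible.induct) (metis convertibleE(1,2,3))+

lemma convertible_unique_left: "convertible A \<tau> \<Longrightarrow> convertible B \<tau> \<Longrightarrow> A = B"
  by (induction arbitrary: B rule: convertible.induct) (metis convertibleE(4,5,6))+

lemma exact_pure_typed_unique: "exact_pure_typed \<Delta> M A \<Longrightarrow> exact_pure_typed \<Delta> M B \<Longrightarrow> A = B"
proof (induction arbitrary: B rule: exact_pure_typed.induct)
  case 1 then show ?case by (metis exact_pure_typedE(1) option.inject)
next
  case 2 then show ?case by (metis exact_pure_typedE(2))
next
  case 3 then show ?case by (metis exact_pure_typedE(3))
next
  case 4 then show ?case by (metis exact_pure_typedE(4))
next
  case 5 then show ?case by (metis exact_pure_typedE(5))
next
  case 6 then show ?case by (metis exact_pure_typedE(6))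
next
  case 7 then show ?case by (metis exact_pure_typedE(7))
next
  case 8 then show ?case by (metis exact_pure_typedE(8) exact_ty.inject)
next
  case 9 then show ?case by (metis exact_pure_typedE(9) exact_ty.inject)
qed

lemma sample_pure_typed_unique: "sample_pure_typed \<Gamma> e \<tau> \<Longrightarrow> sample_pure_typed \<Gamma> e \<sigma> \<Longrightarrow> \<tau> = \<sigma>"
proof (induction arbitrary: \<sigma> rule: sample_pure_typed.induct)
  case 1 then show ?case by (metis sample_pure_typedE(1) option.inject)
next
  case 2 then show ?case by (metis sample_pure_typedE(2))
next
  case 3 then show ?case by (metis sample_pure_typedE(3))
next
  case 4 then show ?case by (metis sample_pure_typedE(4))
next
  case 5 then show ?case by (metis sample_pure_typedE(5))
next
  case 6 then show ?case by (metis sample_pure_typedE(6))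
next
  case 7 then show ?case by (metis sample_pure_typedE(7))
next
  case 8 then show ?case by (metis sample_pure_typedE(8))
next
  case 9 then show ?case by (metis sample_pure_typedE(9))
next
  case 10 then show ?case by (metis sample_pure_typedE(10))
next
  case 11 then show ?case by (metis sample_pure_typedE(11) sample_ty.inject)
next
  case 12 then show ?case by (metis sample_pure_typedE(12) sample_ty.inject)
qed

lemma dist_typed_unique: "dist_typed \<Gamma> d \<tau> \<Longrightarrow> dist_typed \<Gamma> d \<sigma> \<Longrightarrow> \<tau> = \<sigma>"
  by (induction arbitrary: \<sigma> rule: dist_typed.induct) (auto elim: dist_typedE)

lemma typed_unique:
  "exact_typed \<Gamma> \<Delta> M A \<Longrightarrow> (\<And>B. exact_typed \<Gamma> \<Delta> M B \<Longrightarrow> A = B)"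
  "sample_typed \<Gamma> \<Delta> e \<tau> \<Longrightarrow> (\<And>\<sigma>. sample_typed \<Gamma> \<Delta> e \<sigma> \<Longrightarrow> \<tau> = \<sigma>)"
proof (induction rule: exact_typed_sample_typed.inducts)
  case 1 then show ?case by (metis exact_typedE(1) exact_pure_typed_unique)
next
  case 2 then show ?case by (metis exact_typedE(2))
next
  case 3 then show ?case by (metis exact_typedE(3))
next
  case 4 then show ?case by (metis exact_typedE(4))
next
  case 5 then show ?case by (metis exact_typedE(5))
next
  case 6 then show ?case by (metis exact_typedE(6) convertible_unique_left)
next
  case 7 then show ?case by (metis sample_typedE(1) sample_pure_typed_unique)
next
  case 8 then show ?case by (metis sample_typedE(2))
next
  case 9 then show ?case by (metis sample_typedE(3))
next
  case 10 then show ?case by (metis sample_typedE(4) dist_typed_unique)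
next
  case 11 then show ?case by (metis sample_typedE(5))
next
  case 12 then show ?case by (metis sample_typedE(6) convertible_unique_right)
qed

lemma exact_pure_ty_eq [simp]: "exact_pure_typed \<Delta> M A \<Longrightarrow> exact_pure_ty \<Delta> M = A"
  unfolding exact_pure_ty_def by (blast intro: exact_pure_typed_unique)

lemma sample_pure_ty_eq [simp]: "sample_pure_typed \<Gamma> e \<tau> \<Longrightarrow> sample_pure_ty \<Gamma> e = \<tau>"
  unfolding sample_pure_ty_def by (blast intro: sample_pure_typed_unique)

lemma dist_ty_eq [simp]: "dist_typed \<Gamma> d \<tau> \<Longrightarrow> dist_ty \<Gamma> d = \<tau>"
  unfolding dist_ty_def by (blast intro: dist_typed_unique)

lemma exact_ty_of_eq [simp]: "exact_typed \<Gamma> \<Delta> M A \<Longrightarrow> exact_ty_of \<Gamma> \<Delta> M = A"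
  unfolding exact_ty_of_def by (blast intro: typed_unique)

lemma sample_ty_of_eq [simp]: "sample_typed \<Gamma> \<Delta> e \<tau> \<Longrightarrow> sample_ty_of \<Gamma> \<Delta> e = \<tau>"
  unfolding sample_ty_of_def by (blast intro: typed_unique)

subsection \<open>Interpretations of types and pure terms\<close>

lemma convertible_space: "convertible A \<tau> \<Longrightarrow> exact_space A = sample_space \<tau>"
  by (induction rule: convertible.induct) simp_all

text \<open>Products of finite discrete spaces are finite and discrete, and \<open>VPair\<close> is
  injective. Since exact types contain no reals, random variables of exact type on all finite spaces
  together form a countable set.\<close>

lemma exact_space_discrete:
  "finite (space (exact_space A)) \<and> sets (exact_space A) = sets (count_space (space (exact_space A)))"
proof (induction A)
  case (EProdT A B)
  let ?f = "\<lambda>(u, v). VPair u v"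
  have *: "sets (exact_space A \<Otimes>\<^sub>M exact_space B) = Pow (space (exact_space A) \<times> space (exact_space B))"
    using EProdT.IH by (intro sets_pair_countable) (auto intro: countable_finite)
  have "inj ?f" by (auto intro: injI)
  then have "sets (exact_space (EProdT A B)) = Pow (?f ` (space (exact_space A) \<times> space (exact_space B)))"
    by (simp add: sets_embed_measure_alt * image_Pow_surj[OF refl])
  then show ?case
    using EProdT.IH by (simp add: space_embed_measure space_pair_measure)
qed (simp_all add: space_embed_measure)

lemma finite_exact_space: "finite (space (exact_space A))"
  and sets_exact_space: "sets (exact_space A) = sets (count_space (space (exact_space A)))"
  using exact_space_discrete by blast+

lemma measurable_exact_space1: "f \<in> exact_space A \<rightarrow>\<^sub>M M \<longleftrightarrow> f \<in> space (exact_space A) \<rightarrow> space M"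
  by (subst measurable_cong_sets[OF sets_exact_space refl]) simp

lemma measurable_exact_space2:
  "f \<in> M \<rightarrow>\<^sub>M exact_space A \<longleftrightarrow> f \<in> M \<rightarrow>\<^sub>M count_space (space (exact_space A))"
  by (subst measurable_cong_sets[OF refl sets_exact_space]) (rule refl)

lemma measurable_the_bool: "the_bool \<in> sample_space SBoolT \<rightarrow>\<^sub>M count_space UNIV"
  by simp

lemma measurable_VReal: "VReal \<in> borel \<rightarrow>\<^sub>M sample_space SRealT"
  by (simp add: measurable_embed_measure2 inj_def)

lemma measurable_the_real: "the_real \<in> sample_space SRealT \<rightarrow>\<^sub>M borel"
  by (simp add: measurable_embed_measure1)

lemma measurable_VPair:
  "f \<in> N \<rightarrow>\<^sub>M sample_space \<sigma> \<Longrightarrow> g \<in> N \<rightarrow>\<^sub>M sample_space \<tau> \<Longrightarrow>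
    (\<lambda>x. VPair (f x) (g x)) \<in> N \<rightarrow>\<^sub>M sample_space (SProdT \<sigma> \<tau>)"
  using measurable_compose[OF measurable_Pair measurable_embed_measure2[of "\<lambda>(u, v). VPair u v"]]
  by (auto simp: inj_def)

lemma measurable_val_fst: "val_fst \<in> sample_space (SProdT \<sigma> \<tau>) \<rightarrow>\<^sub>M sample_space \<sigma>"
  by (simp add: measurable_embed_measure1 case_prod_beta)

lemma measurable_val_snd: "val_snd \<in> sample_space (SProdT \<sigma> \<tau>) \<rightarrow>\<^sub>M sample_space \<tau>"
  by (simp add: measurable_embed_measure1 case_prod_beta)

definition ctx_space :: "sample_ctx \<Rightarrow> subst measure" where
  "ctx_space \<Gamma> = PiM (fmdom' \<Gamma>) (\<lambda>x. sample_space (the (fmlookup \<Gamma> x)))"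

text \<open>A bare set, in contrast to \<open>ctx_space\<close>: there are finitely many exact
  substitutions, so they can be fixed one at a time and need no \<sigma>-algebra.\<close>

definition substs :: "exact_ctx \<Rightarrow> subst set" where
  "substs \<Delta> = (\<Pi>\<^sub>E X \<in> fmdom' \<Delta>. space (exact_space (the (fmlookup \<Delta> X))))"

lemma empty_subst_in: "empty_subst \<in> space (ctx_space fmempty)" "empty_subst \<in> substs fmempty"
  by (simp_all add: empty_subst_def ctx_space_def substs_def space_PiM)

lemma finite_substs: "finite (substs \<Delta>)"
  unfolding substs_def by (intro finite_PiE finite_exact_space) simp

lemma substs_upd: "\<delta> \<in> substs \<Delta> \<Longrightarrow> x \<in> space (exact_space A) \<Longrightarrow> \<delta>(X := x) \<in> substs (fmupd X A \<Delta>)"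
  by (auto simp: substs_def PiE_iff extensional_def fmdom'_notI)

lemma measurable_ctx_upd:
  assumes g: "g \<in> N \<rightarrow>\<^sub>M ctx_space \<Gamma>" and v: "v \<in> N \<rightarrow>\<^sub>M sample_space \<sigma>"
  shows "(\<lambda>n. (g n)(x := v n)) \<in> N \<rightarrow>\<^sub>M ctx_space (fmupd x \<sigma> \<Gamma>)"
  unfolding ctx_space_def
proof (rule measurable_PiM_single')
  fix i assume i: "i \<in> fmdom' (fmupd x \<sigma> \<Gamma>)"
  show "(\<lambda>n. ((g n)(x := v n)) i) \<in> N \<rightarrow>\<^sub>M sample_space (the (fmlookup (fmupd x \<sigma> \<Gamma>) i))"
  proof (cases "i = x")
    case False
    with i have "i \<in> fmdom' \<Gamma>" by auto
    from measurable_component_singleton'[OF g[unfolded ctx_space_def] measurable_ident_sets[OF refl] this]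
    show ?thesis using False by simp
  qed (use v in simp)
next
  show "(\<lambda>n. (g n)(x := v n)) \<in> space N \<rightarrow>
      (\<Pi>\<^sub>E i\<in>fmdom' (fmupd x \<sigma> \<Gamma>). space (sample_space (the (fmlookup (fmupd x \<sigma> \<Gamma>) i))))"
    using measurable_space[OF g] measurable_space[OF v]
    by (fastforce simp: ctx_space_def space_PiM PiE_iff extensional_def)
qed

lemma exact_pure_sem_in:
  "exact_pure_typed \<Delta> M A \<Longrightarrow> \<delta> \<in> substs \<Delta> \<Longrightarrow> exact_pure_sem M \<delta> \<in> space (exact_space A)"
proof (induction rule: exact_pure_typed.induct)
  case (1 X A)
  show ?case
    using PiE_mem[OF 1(2)[unfolded substs_def] fmdom'I[OF 1(1)]] 1(1) by simp
qed (auto simp: space_embed_measure space_pair_measure)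

lemma sample_pure_sem_measurable:
  "sample_pure_typed \<Gamma> e \<tau> \<Longrightarrow> sample_pure_sem e \<in> ctx_space \<Gamma> \<rightarrow>\<^sub>M sample_space \<tau>"
proof (induction rule: sample_pure_typed.induct)
  case (1 x \<tau>)
  have "(\<lambda>\<gamma>. \<gamma> x) \<in> ctx_space \<Gamma> \<rightarrow>\<^sub>M sample_space (the (fmlookup \<Gamma> x))"
    unfolding ctx_space_def by (rule measurable_component_singleton[OF fmdom'I[OF 1]])
  with 1 have "(\<lambda>\<gamma>. \<gamma> x) \<in> ctx_space \<Gamma> \<rightarrow>\<^sub>M sample_space \<tau>" by simp
  \<comment> \<open>The composite equals the meaning of the term only pointwise, as the recursion
    equations apply to full applications; \<open>back_subst\<close> exchanges the two functions.
    Most of the other cases use the same device.\<close>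
  then show ?case by (rule back_subst[where P="\<lambda>f. f \<in> _"]) (simp add: fun_eq_iff)
next
  case 2
  show ?case by (rule back_subst[where P="\<lambda>f. f \<in> _", OF measurable_const[of "VBool True"]]) auto
next
  case 3
  show ?case by (rule back_subst[where P="\<lambda>f. f \<in> _", OF measurable_const[of "VBool False"]]) auto
next
  case (4 r)
  show ?case
    by (rule back_subst[where P="\<lambda>f. f \<in> _", OF measurable_const[of "VReal r"]]) (auto simp: space_embed_measure)
next
  case (5 e1 e2)
  note [measurable] = measurable_compose[OF 5(3) measurable_the_real] measurable_compose[OF 5(4) measurable_the_real]
  have "(\<lambda>\<gamma>. real_sem e1 \<gamma> + real_sem e2 \<gamma>) \<in> borel_measurable (ctx_space \<Gamma>)" by measurable
  from measurable_compose[OF this measurable_VReal]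
  show ?case by (rule back_subst[where P="\<lambda>f. f \<in> _"]) (simp add: fun_eq_iff)
next
  case (6 e)
  note [measurable] = measurable_compose[OF 6(2) measurable_the_real]
  have "(\<lambda>\<gamma>. - real_sem e \<gamma>) \<in> borel_measurable (ctx_space \<Gamma>)" by measurable
  from measurable_compose[OF this measurable_VReal]
  show ?case by (rule back_subst[where P="\<lambda>f. f \<in> _"]) (simp add: fun_eq_iff)
next
  case (7 e1 e2)
  note [measurable] = measurable_compose[OF 7(3) measurable_the_real] measurable_compose[OF 7(4) measurable_the_real]
  have "(\<lambda>\<gamma>. real_sem e1 \<gamma> * real_sem e2 \<gamma>) \<in> borel_measurable (ctx_space \<Gamma>)" by measurable
  from measurable_compose[OF this measurable_VReal]
  show ?case by (rule back_subst[where P="\<lambda>f. f \<in> _"]) (simp add: fun_eq_iff)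
next
  case (8 e1 e2)
  from borel_measurable_le[OF measurable_compose[OF 8(3) measurable_the_real] measurable_compose[OF 8(4) measurable_the_real]]
  have "(\<lambda>\<gamma>. real_sem e1 \<gamma> \<le> real_sem e2 \<gamma>) \<in> ctx_space \<Gamma> \<rightarrow>\<^sub>M count_space UNIV"
    by (simp add: pred_def)
  from measurable_compose[OF this, of VBool "sample_space SBoolT"]
  show ?case by simp
next
  case (10 e1 \<sigma> e2 \<tau>)
  from measurable_VPair[OF 10(3,4)]
  show ?case by (rule back_subst[where P="\<lambda>f. f \<in> _"]) (simp add: fun_eq_iff)
next
  case (11 e \<sigma> \<tau>)
  from measurable_compose[OF 11(2) measurable_val_fst]
  show ?case by (rule back_subst[where P="\<lambda>f. f \<in> _"]) (simp add: fun_eq_iff)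
next
  case (12 e \<sigma> \<tau>)
  from measurable_compose[OF 12(2) measurable_val_snd]
  show ?case by (rule back_subst[where P="\<lambda>f. f \<in> _"]) (simp add: fun_eq_iff)
next
  case 9
  show ?case by (rule back_subst[where P="\<lambda>f. f \<in> _", OF measurable_const[of VUnit]]) auto
qed

lemma guard_measurable:
  "sample_pure_typed \<Gamma> e SBoolT \<Longrightarrow> Measurable.pred (ctx_space \<Gamma>) (\<lambda>\<gamma>. the_bool (sample_pure_sem e \<gamma>))"
  by (rule measurable_compose[OF sample_pure_sem_measurable measurable_the_bool])

lemma real_sem_measurable:
  "sample_pure_typed \<Gamma> e SRealT \<Longrightarrow> (\<lambda>\<gamma>. real_sem e \<gamma>) \<in> borel_measurable (ctx_space \<Gamma>)"
  by (rule measurable_compose[OF sample_pure_sem_measurable measurable_the_real])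

subsection \<open>Primitive distributions\<close>

text \<open>The probability of a set is an integral of point masses over the countable type. With a
  countable discrete factor, joint measurability reduces to measurability in the parameter at each
  point.\<close>

lemma pmf_kernel_measurable:
  fixes q :: "'n \<Rightarrow> 'b::countable pmf"
  assumes [measurable]: "\<And>b. (\<lambda>x. pmf (q x) b) \<in> borel_measurable N"
  shows "(\<lambda>x. measure_pmf (q x)) \<in> N \<rightarrow>\<^sub>M prob_algebra (count_space UNIV)"
proof (rule measurable_prob_algebra_generated[where G="UNIV" and \<Omega>=UNIV])
  fix A :: "'b set"
  interpret sigma_finite_measure "count_space (UNIV :: 'b set)"
    by (rule sigma_finite_measure_count_space_countable) simp
  have "(\<lambda>z. ennreal (pmf (q (fst z)) (snd z)) * indicator A (snd z)) \<in> borel_measurable (N \<Otimes>\<^sub>M count_space UNIV)"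
    by (rule measurable_compose_countable[where g=snd and f="\<lambda>b z. ennreal (pmf (q (fst z)) b) * indicator A b"]) auto
  then have "(\<lambda>x. \<integral>\<^sup>+b. ennreal (pmf (q x) b) * indicator A b \<partial>count_space UNIV) \<in> borel_measurable N"
    by (intro borel_measurable_nn_integral) (simp add: case_prod_beta)
  moreover have "emeasure (measure_pmf (q x)) A = (\<integral>\<^sup>+b. ennreal (pmf (q x) b) * indicator A b \<partial>count_space UNIV)" for x
    by (simp add: nn_integral_measure_pmf flip: nn_integral_indicator)
  ultimately show "(\<lambda>x. emeasure (measure_pmf (q x)) A) \<in> borel_measurable N"
    by simp
qed (auto simp: Int_stable_def sigma_sets.Basic measure_pmf.prob_space_axioms)

lemma flip_pmf_measurable:
  assumes [measurable]: "p \<in> borel_measurable N"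
  shows "(\<lambda>x. pmf (flip_pmf (p x)) b) \<in> borel_measurable N"
proof -
  have "pmf (flip_pmf r) b = (if 0 \<le> r \<and> r \<le> 1 then (if b then r else 1 - r) else of_bool (\<not> b))" for r
    by (auto simp: flip_pmf_def)
  then show ?thesis by simp
qed

text \<open>The Poisson law before its embedding into the reals: on a countable type, a family of
  distributions is measurable as soon as its point masses are.\<close>

definition pois_nat_pmf :: "real \<Rightarrow> nat pmf" where
  "pois_nat_pmf r = (if 0 < r then poisson_pmf r else return_pmf 0)"

lemma pois_pmf_eq: "pois_pmf r = map_pmf real (pois_nat_pmf r)"
  by (simp add: pois_pmf_def pois_nat_pmf_def)

lemma pois_nat_pmf_measurable:
  assumes [measurable]: "r \<in> borel_measurable N"
  shows "(\<lambda>x. pmf (pois_nat_pmf (r x)) n) \<in> borel_measurable N"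
proof -
  have "pmf (pois_nat_pmf r) n = (if 0 < r then r ^ n / fact n * exp (- r) else of_bool (n = 0))" for r
    by (simp add: pois_nat_pmf_def pmf_return indicator_def)
  then show ?thesis by simp
qed

lemma unif_measure_measurable:
  assumes [measurable]: "a \<in> borel_measurable N" "b \<in> borel_measurable N"
  shows "(\<lambda>x. unif_measure (a x) (b x)) \<in> N \<rightarrow>\<^sub>M prob_algebra borel"
proof (rule measurable_prob_algebra_generated[OF sets.sigma_sets_eq[symmetric] sets.Int_stable sets.space_closed])
  show "prob_space (unif_measure (a x) (b x))" for x
    by (auto simp: unif_measure_def intro!: prob_space_uniform_measure prob_space_return)
  show "sets (unif_measure (a x) (b x)) = sets borel" for x
    by (simp add: unif_measure_def)
  fix A :: "real set" assume [measurable]: "A \<in> sets borel"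
  \<comment> \<open>Writing the interval as two inequalities under the integral makes the integrand
    jointly measurable in the endpoints and the integration variable.\<close>
  have 1: "emeasure (uniform_measure lborel {c..d}) A =
      (\<integral>\<^sup>+t. (if c \<le> t \<and> t \<le> d then indicator A t else 0) \<partial>lborel) / ennreal (d - c)" if "c < d" for c d
  proof -
    have "(\<integral>\<^sup>+t. (if c \<le> t \<and> t \<le> d then indicator A t else 0) \<partial>lborel) = (\<integral>\<^sup>+t. indicator ({c..d} \<inter> A) t \<partial>lborel)"
      by (intro nn_integral_cong) (auto split: split_indicator)
    with that show ?thesis by simp
  qed
  have "(\<lambda>x. \<integral>\<^sup>+t. (if a x \<le> t \<and> t \<le> b x then indicator A t else 0) \<partial>lborel) \<in> borel_measurable N"
    by measurable
  moreover have "emeasure (unif_measure (a x) (b x)) A = (if a x < b x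
      then (\<integral>\<^sup>+t. (if a x \<le> t \<and> t \<le> b x then indicator A t else 0) \<partial>lborel) / ennreal (b x - a x)
      else indicator A (min (a x) (b x)))" for x
    using 1 by (simp add: unif_measure_def)
  ultimately show "(\<lambda>x. emeasure (unif_measure (a x) (b x)) A) \<in> borel_measurable N"
    by simp
qed

lemma flip_measurable:
  assumes "sample_pure_typed \<Gamma> e SRealT"
  shows "(\<lambda>\<gamma>. distr (measure_pmf (flip_pmf (real_sem e \<gamma>))) (count_space (range VBool)) VBool)
    \<in> ctx_space \<Gamma> \<rightarrow>\<^sub>M prob_algebra (count_space (range VBool))"
  by (rule measurable_compose[OF pmf_kernel_measurable[OF flip_pmf_measurable[OF real_sem_measurable[OF assms]]]
        measurable_distr_prob_space]) auto

lemma dist_sem_measurable: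
  "dist_typed \<Gamma> d \<tau> \<Longrightarrow> dist_sem d \<in> ctx_space \<Gamma> \<rightarrow>\<^sub>M prob_algebra (sample_space \<tau>)"
proof (induction rule: dist_typed.induct)
  case (1 e)
  from flip_measurable[OF 1, folded sample_space.simps]
  show ?case by (rule back_subst[where P="\<lambda>f. f \<in> _"]) (simp add: fun_eq_iff)
next
  case (2 e1 e2)
  from measurable_compose[OF unif_measure_measurable[OF 2[THEN real_sem_measurable]]
      measurable_distr_prob_space[OF measurable_VReal]]
  show ?case by (rule back_subst[where P="\<lambda>f. f \<in> _"]) (simp add: fun_eq_iff)
next
  case (3 e)
  have "(\<lambda>n. VReal (real n)) \<in> count_space UNIV \<rightarrow>\<^sub>M sample_space SRealT"
    by (simp add: space_embed_measure)
  from measurable_compose[OF pmf_kernel_measurable[OF pois_nat_pmf_measurable[OF real_sem_measurable[OF 3]]]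
      measurable_distr_prob_space[OF this]]
  show ?case
    by (rule back_subst[where P="\<lambda>f. f \<in> _"])
      (simp add: fun_eq_iff pois_pmf_eq map_pmf_rep_eq distr_distr comp_def space_embed_measure)
qed

lemma dist_density_nonneg: "0 \<le> dist_density d \<gamma> v"
  by (cases d) (auto simp: unif_density_def)

text \<open>Only natural numbers carry mass, and rounding down recovers the one candidate. In this
  form the mass is visibly a Borel function of the real argument.\<close>

lemma pmf_map_real: "pmf (map_pmf real q) x = (if x = real (nat \<lfloor>x\<rfloor>) then pmf q (nat \<lfloor>x\<rfloor>) else 0)"
proof (cases "x \<in> range real")
  case True
  then obtain n where "x = real n" by blast
  then show ?thesis using pmf_map_inj'[of real q n] by (simp add: inj_def)
next
  case False
  then show ?thesis by (auto simp: pmf_map_outside image_iff)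
qed

lemma unif_density_measurable:
  assumes [measurable]: "a \<in> borel_measurable N" "b \<in> borel_measurable N" "x \<in> borel_measurable N"
  shows "(\<lambda>n. unif_density (a n) (b n) (x n)) \<in> borel_measurable N"
proof -
  have "unif_density c d y = (if c < d then 1 / (d - c) * (if c \<le> y \<and> y \<le> d then 1 else 0)
      else if y = min c d then 1 else 0)" for c d y
    by (auto simp: unif_density_def)
  then show ?thesis by simp
qed

lemma dist_density_measurable:
  assumes "dist_typed \<Gamma> d \<tau>" "v \<in> ctx_space \<Gamma> \<rightarrow>\<^sub>M sample_space \<tau>"
  shows "(\<lambda>\<gamma>. dist_density d \<gamma> (v \<gamma>)) \<in> borel_measurable (ctx_space \<Gamma>)"
  using assms
proof (induction rule: dist_typed.induct)
  case (1 e)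
  have "(\<lambda>\<gamma>. the_bool (v \<gamma>)) \<in> ctx_space \<Gamma> \<rightarrow>\<^sub>M count_space UNIV"
    by (rule measurable_compose[OF 1(2) measurable_the_bool])
  from measurable_compose_countable[OF flip_pmf_measurable[OF real_sem_measurable[OF 1(1)]] this]
  show ?case by simp
next
  case (2 e1 e2)
  show ?case
    unfolding dist_density.simps
    by (rule unif_density_measurable[OF real_sem_measurable[OF 2(1)] real_sem_measurable[OF 2(2)]
          measurable_compose[OF 2(3) measurable_the_real]])
next
  case (3 e)
  note [measurable] = measurable_compose[OF 3(2) measurable_the_real]
  have 1: "(\<lambda>\<gamma>. nat \<lfloor>the_real (v \<gamma>)\<rfloor>) \<in> ctx_space \<Gamma> \<rightarrow>\<^sub>M count_space UNIV"
    by measurable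
  note [measurable] = measurable_compose_countable[OF pois_nat_pmf_measurable[OF real_sem_measurable[OF 3(1)]] 1]
  show ?case by (simp add: pois_pmf_eq pmf_map_real)
qed

subsection \<open>Measurability of the high-level semantics\<close>

text \<open>Only \<open>\<gamma>\<close> is treated as a measurable parameter; the exact
  substitution ranges over a finite set and is fixed.\<close>

lemma high_measurable:
  "exact_typed \<Gamma> \<Delta> M A \<Longrightarrow>
    (\<And>\<delta>. \<delta> \<in> substs \<Delta> \<Longrightarrow> (\<lambda>\<gamma>. exact_high M \<Gamma> \<Delta> \<gamma> \<delta>) \<in> ctx_space \<Gamma> \<rightarrow>\<^sub>M P_space (exact_space A))"
  "sample_typed \<Gamma> \<Delta> e \<tau> \<Longrightarrow>
    (\<And>\<delta>. \<delta> \<in> substs \<Delta> \<Longrightarrow> (\<lambda>\<gamma>. sample_high e \<Gamma> \<Delta> \<gamma> \<delta>) \<in> ctx_space \<Gamma> \<rightarrow>\<^sub>M P_space (sample_space \<tau>))"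
proof (induction rule: exact_typed_sample_typed.inducts)
  case (1 \<Delta> M A \<Gamma>)
  then show ?case using exact_pure_sem_in[OF 1] by (auto intro!: P_return_measurable)
next
  case (2 \<Gamma> \<Delta> M A X N B)
  \<comment> \<open>Exact values form a finite discrete space, so joint measurability follows from
    measurability in \<open>\<gamma>\<close> at each single value.\<close>
  have "(\<lambda>z. exact_high N \<Gamma> (fmupd X A \<Delta>) (fst z) (\<delta>(X := snd z))) \<in> ctx_space \<Gamma> \<Otimes>\<^sub>M exact_space A \<rightarrow>\<^sub>M P_space (exact_space B)"
  proof (rule measurable_compose_countable'[where g=snd and I="space (exact_space A)"
        and f="\<lambda>x z. exact_high N \<Gamma> (fmupd X A \<Delta>) (fst z) (\<delta>(X := x))"])
    show "(\<lambda>z. exact_high N \<Gamma> (fmupd X A \<Delta>) (fst z) (\<delta>(X := x))) \<in> ctx_space \<Gamma> \<Otimes>\<^sub>M exact_space A \<rightarrow>\<^sub>M P_space (exact_space B)"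
      if "x \<in> space (exact_space A)" for x
      by (rule measurable_compose[OF measurable_fst 2(4)[OF substs_upd[OF 2(5) that]]])
    show "snd \<in> ctx_space \<Gamma> \<Otimes>\<^sub>M exact_space A \<rightarrow>\<^sub>M count_space (space (exact_space A))"
      unfolding measurable_exact_space2[symmetric] by simp
  qed (rule countable_finite[OF finite_exact_space])
  then show ?case
    unfolding exact_high.simps exact_ty_of_eq[OF 2(1)] by (rule P_bind_measurable[OF 2(3)[OF 2(5)]])
next
  case (3 \<Gamma> e \<Delta> M A N)
  then show ?case using guard_measurable[OF 3(1)] by (simp add: measurable_If)
next
  case (4 \<Gamma> e \<Delta>)
  then show ?case using P_lift_measurable[OF flip_measurable[OF 4(1)]] by simp
next
  case (5 \<Delta> M \<Gamma>)
  show ?case unfolding exact_high.simps exact_space.simps by (rule score_measurable[OF borel_measurable_const]) simp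
next
  case (6 \<Gamma> \<Delta> e \<tau> A)
  then show ?case by (simp add: convertible_space)
next
  case (7 \<Gamma> e \<tau> \<Delta>)
  then show ?case using P_return_measurable[OF sample_pure_sem_measurable[OF 7(1)]] by simp
next
  case (8 \<Gamma> \<Delta> e1 \<sigma> x e2 \<tau>)
  have "(\<lambda>z. sample_high e2 (fmupd x \<sigma> \<Gamma>) \<Delta> ((fst z)(x := snd z)) \<delta>) \<in> ctx_space \<Gamma> \<Otimes>\<^sub>M sample_space \<sigma> \<rightarrow>\<^sub>M P_space (sample_space \<tau>)"
    by (rule measurable_compose[OF measurable_ctx_upd[OF measurable_fst measurable_snd] 8(4)[OF 8(5)]])
  then show ?case
    unfolding sample_high.simps sample_ty_of_eq[OF 8(1)] by (rule P_bind_measurable[OF 8(3)[OF 8(5)]])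
next
  case (9 \<Gamma> e1 \<Delta> e2 \<tau> e3)
  then show ?case using guard_measurable[OF 9(1)] by (simp add: measurable_If)
next
  case (10 \<Gamma> d \<tau> \<Delta>)
  then show ?case using P_lift_measurable[OF dist_sem_measurable[OF 10(1)]] by simp
next
  case (11 \<Gamma> eo \<tau> d \<Delta>)
  then show ?case
    using score_measurable[OF dist_density_measurable[OF 11(2) sample_pure_sem_measurable[OF 11(1)]] dist_density_nonneg]
    by simp
next
  case (12 \<Gamma> \<Delta> M A \<tau>)
  then show ?case by (simp add: convertible_space[symmetric])
qed

subsection \<open>Discrete data\<close>

lemma measurable_count_spaceI:
  "f \<in> N \<rightarrow>\<^sub>M count_space UNIV \<Longrightarrow> (\<And>x. x \<in> space N \<Longrightarrow> f x \<in> I) \<Longrightarrow> f \<in> N \<rightarrow>\<^sub>M count_space I"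
  using measurable_restrict_space2[of f N I "count_space UNIV"] by (auto simp: restrict_count_space)

lemma measurable_count_spaceD:
  "f \<in> N \<rightarrow>\<^sub>M count_space I \<Longrightarrow> f \<in> N \<rightarrow>\<^sub>M count_space UNIV"
  by (rule measurable_compose[where g="\<lambda>x. x"]) auto

lemma discrete_compose1:
  "f \<in> N \<rightarrow>\<^sub>M count_space I \<Longrightarrow> (\<lambda>x. h (f x)) \<in> N \<rightarrow>\<^sub>M count_space UNIV"
  by (rule measurable_compose) auto

text \<open>Splitting over the countably many values of the first argument leaves a function of the
  second alone, whose range may be uncountable. Here and in the variants below, every argument but
  the last comes from a countable set.\<close>

lemma discrete_compose2:
  assumes "f \<in> N \<rightarrow>\<^sub>M count_space I" "countable I" "g \<in> N \<rightarrow>\<^sub>M count_space J"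
  shows "(\<lambda>x. h (f x) (g x)) \<in> N \<rightarrow>\<^sub>M count_space UNIV"
  by (rule measurable_compose_countable'[OF _ assms(1,2), where f="\<lambda>i x. h i (g x)"])
    (rule discrete_compose1[OF assms(3)])

lemma discrete_compose3:
  assumes "f \<in> N \<rightarrow>\<^sub>M count_space I" "countable I" "g \<in> N \<rightarrow>\<^sub>M count_space J" "countable J"
    "k \<in> N \<rightarrow>\<^sub>M count_space K"
  shows "(\<lambda>x. h (f x) (g x) (k x)) \<in> N \<rightarrow>\<^sub>M count_space UNIV"
  by (rule measurable_compose_countable'[OF _ assms(1,2), where f="\<lambda>i x. h i (g x) (k x)"])
    (rule discrete_compose2[OF assms(3-5)])

lemma discrete_compose4:
  assumes "f \<in> N \<rightarrow>\<^sub>M count_space I" "countable I" "g \<in> N \<rightarrow>\<^sub>M count_space J" "countable J"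
    "k \<in> N \<rightarrow>\<^sub>M count_space K" "countable K" "l \<in> N \<rightarrow>\<^sub>M count_space L"
  shows "(\<lambda>x. h (f x) (g x) (k x) (l x)) \<in> N \<rightarrow>\<^sub>M count_space UNIV"
  by (rule measurable_compose_countable'[OF _ assms(1,2), where f="\<lambda>i x. h i (g x) (k x) (l x)"])
    (rule discrete_compose3[OF assms(3-7)])

text \<open>Extensional functions on initial segments of the naturals, for all lengths at once. Maps
  and random variables on all finite spaces thus share one set, countable if \<open>S\<close>
  is.\<close>

definition exts :: "'a set \<Rightarrow> (nat \<Rightarrow> 'a) set" where
  "exts S = (\<Union>n. {..<n} \<rightarrow>\<^sub>E S)"

lemma countable_exts: "countable S \<Longrightarrow> countable (exts S)"
  unfolding exts_def by (intro countable_UN countable_PiE) auto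

lemma extsI: "f \<in> {..<n} \<rightarrow>\<^sub>E S \<Longrightarrow> f \<in> exts S"
  by (auto simp: exts_def)

lemma restrict_exts: "(\<And>i. i < n \<Longrightarrow> f i \<in> S) \<Longrightarrow> restrict f {..<n} \<in> exts S"
  by (intro extsI[of _ n]) auto

lemma countable_exts_exact: "countable (exts (space (exact_space A)))"
  by (intro countable_exts countable_finite finite_exact_space)

lemma countable_exts_substs: "countable (exts (substs \<Delta>))"
  by (intro countable_exts countable_finite finite_substs)

lemma countable_exts_nat: "countable (exts (UNIV :: nat set))"
  by (intro countable_exts) simp

subsection \<open>The space of finite conditional probability spaces\<close>

lemma sets_real_list_box:
  assumes "\<And>i. i < n \<Longrightarrow> A i \<in> sets borel"
  shows "{xs. length xs = n \<and> (\<forall>i < n. xs ! i \<in> A i)} \<in> sets real_list_space"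
  unfolding real_list_space_def using assms by (intro in_measure_of) auto

lemma space_real_list_space [simp]: "space real_list_space = UNIV"
  by (simp add: real_list_space_def)

text \<open>The list space is a disjoint union of powers of the real line; the default value 0
  extends a coordinate to shorter lists. It is also the correct mass of a point outside a finite
  space.\<close>

lemma real_list_nth_measurable:
  "(\<lambda>xs. if i < length xs then xs ! i else 0) \<in> borel_measurable real_list_space"
proof (rule measurableI)
  fix A :: "real set" assume A: "A \<in> sets borel"
  \<comment> \<open>The part of the preimage in length \<open>n\<close>: a box if \<open>i\<close>
    is a valid index, otherwise everything or nothing according to whether the default 0 lies in
    \<open>A\<close>.\<close>
  define Y where "Y n = (if i < n then {xs. length xs = n \<and> (\<forall>j < n. xs ! j \<in> (if j = i then A else UNIV))}
      else if 0 \<in> A then {xs. length xs = n \<and> (\<forall>j < n. xs ! j \<in> (UNIV :: real set))} else {})" for n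
  have "Y n \<in> sets real_list_space" for n
    using sets_real_list_box[of n "\<lambda>j. if j = i then A else UNIV"] sets_real_list_box[of n "\<lambda>_. UNIV"] A
    by (simp add: Y_def)
  then have "(\<Union>n. Y n) \<in> sets real_list_space" by blast
  also have "(\<Union>n. Y n) = (\<lambda>xs. if i < length xs then xs ! i else 0) -` A \<inter> space real_list_space"
    by (auto simp: Y_def split: if_splits)
  finally show "(\<lambda>xs. if i < length xs then xs ! i else 0) -` A \<inter> space real_list_space \<in> sets real_list_space" .
qed simp

text \<open>A generating box is a condition on the length together with conditions on finitely many
  coordinates.\<close>

lemma real_list_space_measurableI:
  assumes len: "(\<lambda>x. length (t x)) \<in> N \<rightarrow>\<^sub>M count_space UNIV"
    and nth: "\<And>i. (\<lambda>x. if i < length (t x) then t x ! i else 0) \<in> borel_measurable N"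
  shows "t \<in> N \<rightarrow>\<^sub>M real_list_space"
  unfolding real_list_space_def
proof (rule measurable_measure_of)
  fix Y :: "real list set" assume "Y \<in> {{xs. length xs = n \<and> (\<forall>i < n. xs ! i \<in> A i)} | n A. \<forall>i < n. A i \<in> sets borel}"
  then obtain n A where Y: "Y = {xs. length xs = n \<and> (\<forall>i < n. xs ! i \<in> A i)}" and A: "\<And>i. i < n \<Longrightarrow> A i \<in> sets borel"
    by blast
  have "t -` Y \<inter> space N =
      {x \<in> space N. length (t x) \<in> {n} \<and> (\<forall>i \<in> {..<n}. (if i < length (t x) then t x ! i else 0) \<in> A i)}"
    by (auto simp: Y)
  also have "\<dots> \<in> sets N"
    using A by (intro sets.sets_Collect_conj sets.sets_Collect_finite_All measurable_sets_Collect[OF len] measurable_sets_Collect[OF nth])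
      (auto simp: pred_def)
  finally show "t -` Y \<inter> space N \<in> sets N" .
qed auto

abbreviation fcps_code :: "fcps \<Rightarrow> nat \<times> real list \<times> nat set" where
  "fcps_code \<Omega> \<equiv> (fcps_size \<Omega>, map (pmf (fcps_pmf \<Omega>)) [0..<fcps_size \<Omega>], fcps_event \<Omega>)"

lemma space_fcps_space [simp]: "space fcps_space = {\<Omega>. is_fcps \<Omega>}"
  by (simp add: fcps_space_def)

lemma finite_carrier [simp]: "finite (fcps_carrier \<Omega>)"
  by (simp add: fcps_carrier_def)

lemma finite_event: "is_fcps \<Omega> \<Longrightarrow> finite (fcps_event \<Omega>)"
  unfolding is_fcps_def using finite_subset finite_carrier by blast

lemma fcps_code_measurable:
  "fcps_code \<in> fcps_space \<rightarrow>\<^sub>M count_space UNIV \<Otimes>\<^sub>M real_list_space \<Otimes>\<^sub>M count_space {E. finite E}"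
  unfolding fcps_space_def
  by (intro measurable_vimage_algebra1) (auto simp: space_pair_measure finite_event)

lemma fcps_size_measurable: "fcps_size \<in> fcps_space \<rightarrow>\<^sub>M count_space UNIV"
  using measurable_compose[OF fcps_code_measurable measurable_fst] by simp

lemma fcps_event_measurable: "fcps_event \<in> fcps_space \<rightarrow>\<^sub>M count_space {E. finite E}"
  using measurable_compose[OF fcps_code_measurable measurable_compose[OF measurable_snd measurable_snd]] by simp

lemma pmf_eq_0_outside: "is_fcps \<Omega> \<Longrightarrow> \<not> i < fcps_size \<Omega> \<Longrightarrow> pmf (fcps_pmf \<Omega>) i = 0"
  by (auto simp: is_fcps_def fcps_carrier_def pmf_eq_0_set_pmf)

lemma fcps_pmf_measurable: "(\<lambda>\<Omega>. pmf (fcps_pmf \<Omega>) i) \<in> borel_measurable fcps_space"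
proof -
  have "(\<lambda>\<Omega>. if i < length (fst (snd (fcps_code \<Omega>))) then fst (snd (fcps_code \<Omega>)) ! i else 0) \<in> borel_measurable fcps_space"
    by (rule measurable_compose[OF measurable_compose[OF fcps_code_measurable measurable_compose[OF measurable_snd measurable_fst]]
          real_list_nth_measurable])
  then show ?thesis
    by (rule measurable_cong[THEN iffD1, rotated]) (auto simp: pmf_eq_0_outside)
qed

text \<open>Probabilities vanish outside the carrier, so masses can be examined at every natural
  number, without reference to a size that itself varies with \<open>x\<close>.\<close>

lemma fcps_space_measurableI:
  assumes fcps: "\<And>x. x \<in> space N \<Longrightarrow> is_fcps (t x)"
    and size: "(\<lambda>x. fcps_size (t x)) \<in> N \<rightarrow>\<^sub>M count_space UNIV"
    and event: "(\<lambda>x. fcps_event (t x)) \<in> N \<rightarrow>\<^sub>M count_space UNIV"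
    and pmf: "\<And>i. (\<lambda>x. pmf (fcps_pmf (t x)) i) \<in> borel_measurable N"
  shows "t \<in> N \<rightarrow>\<^sub>M fcps_space"
  unfolding fcps_space_def
proof (rule measurable_vimage_algebra2)
  have "(\<lambda>x. map (pmf (fcps_pmf (t x))) [0..<fcps_size (t x)]) \<in> N \<rightarrow>\<^sub>M real_list_space"
  proof (rule real_list_space_measurableI)
    fix i
    show "(\<lambda>x. if i < length (map (pmf (fcps_pmf (t x))) [0..<fcps_size (t x)])
        then map (pmf (fcps_pmf (t x))) [0..<fcps_size (t x)] ! i else 0) \<in> borel_measurable N"
      by (rule measurable_cong[THEN iffD1, OF _ pmf[of i]]) (auto simp: fcps pmf_eq_0_outside)
  qed (simp add: size)
  moreover have "(\<lambda>x. fcps_event (t x)) \<in> N \<rightarrow>\<^sub>M count_space {E. finite E}"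
    using fcps by (intro measurable_count_spaceI[OF event]) (simp add: finite_event)
  ultimately show "(\<lambda>x. fcps_code (t x)) \<in> N \<rightarrow>\<^sub>M count_space UNIV \<Otimes>\<^sub>M real_list_space \<Otimes>\<^sub>M count_space {E. finite E}"
    using size by (intro measurable_Pair)
qed (use fcps in auto)

lemma countable_finite_sets: "countable {E :: nat set. finite E}"
  by (rule countable_Collect_finite)

text \<open>There are only countably many finite sets of naturals, and the probability of a fixed
  one is a finite sum of point masses.\<close>

lemma fcps_prob_measurable:
  assumes t: "t \<in> N \<rightarrow>\<^sub>M fcps_space" and F: "F \<in> N \<rightarrow>\<^sub>M count_space {E. finite E}"
  shows "(\<lambda>x. fcps_prob (t x) (F x)) \<in> borel_measurable N"
proof (rule measurable_compose_countable'[OF _ F countable_finite_sets, where f="\<lambda>E x. fcps_prob (t x) E"])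
  fix E :: "nat set" assume "E \<in> {E. finite E}"
  then have *: "fcps_prob (t x) E = (\<Sum>i\<in>E. pmf (fcps_pmf (t x)) i)" for x
    by (simp add: fcps_prob_def measure_measure_pmf_finite)
  show "(\<lambda>x. fcps_prob (t x) E) \<in> borel_measurable N"
    unfolding * by (intro borel_measurable_sum measurable_compose[OF t fcps_pmf_measurable])
qed

lemma fcps_cond_prob_measurable:
  assumes t: "t \<in> N \<rightarrow>\<^sub>M fcps_space" and F: "F \<in> N \<rightarrow>\<^sub>M count_space {E. finite E}"
  shows "(\<lambda>x. fcps_cond_prob (t x) (F x)) \<in> borel_measurable N"
proof -
  note E = measurable_compose[OF t fcps_event_measurable]
  have "(\<lambda>x. fcps_event (t x) \<inter> F x) \<in> N \<rightarrow>\<^sub>M count_space {E. finite E}"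
    using measurable_space[OF E] by (intro measurable_count_spaceI[OF discrete_compose2[OF E countable_finite_sets F]]) auto
  note [measurable] = fcps_prob_measurable[OF t this] fcps_prob_measurable[OF t E]
  show ?thesis unfolding fcps_cond_prob_def by measurable
qed

definition fcps_pos :: "fcps \<Rightarrow> bool" where
  "fcps_pos \<Omega> \<longleftrightarrow> 0 < fcps_prob \<Omega> (fcps_event \<Omega>)"

lemma fcps_pos_measurable:
  assumes t: "t \<in> N \<rightarrow>\<^sub>M fcps_space"
  shows "Measurable.pred N (\<lambda>x. fcps_pos (t x))"
proof -
  note [measurable] = fcps_prob_measurable[OF t measurable_compose[OF t fcps_event_measurable]]
  show ?thesis unfolding fcps_pos_def by measurable
qed

text \<open>If the event of \<open>\<Omega>\<close> is null, all its conditional probabilities are \<open>0\<close>, and \<open>cint \<Omega> \<phi> = 0\<close>.\<close>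

definition cint :: "fcps \<Rightarrow> (nat \<Rightarrow> ennreal) \<Rightarrow> ennreal" where
  "cint \<Omega> \<phi> = (\<Sum>\<omega>\<in>fcps_carrier \<Omega>. ennreal (fcps_cond_prob \<Omega> {\<omega>}) * \<phi> \<omega>)"

lemma cint_cong: "(\<And>\<omega>. \<omega> \<in> fcps_carrier \<Omega> \<Longrightarrow> \<phi> \<omega> = \<psi> \<omega>) \<Longrightarrow> cint \<Omega> \<phi> = cint \<Omega> \<psi>"
  unfolding cint_def by (intro sum.cong) auto

text \<open>Splitting by the size fixes the range of the sum.\<close>

lemma cint_measurable:
  assumes t: "t \<in> N \<rightarrow>\<^sub>M fcps_space" and \<phi>: "\<And>\<omega>. (\<lambda>x. \<phi> x \<omega>) \<in> borel_measurable N"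
  shows "(\<lambda>x. cint (t x) (\<phi> x)) \<in> borel_measurable N"
  unfolding cint_def fcps_carrier_def
proof (rule measurable_compose_countable[OF _ measurable_compose[OF t fcps_size_measurable],
      where f="\<lambda>n x. \<Sum>\<omega>\<in>{..<n}. ennreal (fcps_cond_prob (t x) {\<omega>}) * \<phi> x \<omega>"])
  have [measurable]: "(\<lambda>x. fcps_cond_prob (t x) {\<omega>}) \<in> borel_measurable N" for \<omega>
    by (rule fcps_cond_prob_measurable[OF t]) simp
  show "(\<lambda>x. \<Sum>\<omega>\<in>{..<n}. ennreal (fcps_cond_prob (t x) {\<omega>}) * \<phi> x \<omega>) \<in> borel_measurable N" for n
    using \<phi> by measurable
qed

subsection \<open>Constructions on finite conditional probability spaces\<close>

lemma is_fcps_restrict: "is_fcps \<Omega> \<Longrightarrow> is_fcps (fcps_restrict \<Omega> F)"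
  by (auto simp: is_fcps_def fcps_restrict_def fcps_carrier_def)

lemma carrier_restrict [simp]: "fcps_carrier (fcps_restrict \<Omega> F) = fcps_carrier \<Omega>"
  by (simp add: fcps_carrier_def fcps_restrict_def)

lemma fcps_restrict_measurable:
  assumes t: "t \<in> N \<rightarrow>\<^sub>M fcps_space" and F: "F \<in> N \<rightarrow>\<^sub>M count_space UNIV"
  shows "(\<lambda>x. fcps_restrict (t x) (F x)) \<in> N \<rightarrow>\<^sub>M fcps_space"
proof (rule fcps_space_measurableI)
  show "is_fcps (fcps_restrict (t x) (F x))" if "x \<in> space N" for x
    using measurable_space[OF t that] is_fcps_restrict by simp
  show "(\<lambda>x. fcps_event (fcps_restrict (t x) (F x))) \<in> N \<rightarrow>\<^sub>M count_space UNIV"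
    unfolding fcps_restrict_def fcps.sel
    by (rule discrete_compose2[OF measurable_compose[OF t fcps_event_measurable] countable_finite_sets F])
qed (use measurable_compose[OF t fcps_size_measurable] measurable_compose[OF t fcps_pmf_measurable]
    in \<open>simp_all add: fcps_restrict_def\<close>)

lemma fcps_id_hom_restrict:
  assumes "is_fcps \<Omega>"
  shows "fcps_id \<Omega> \<in> fcps_hom (fcps_restrict \<Omega> F) \<Omega>"
proof -
  have "map_pmf (fcps_id \<Omega>) (fcps_pmf \<Omega>) = map_pmf (\<lambda>x. x) (fcps_pmf \<Omega>)"
    using assms by (intro map_pmf_cong) (auto simp: fcps_id_def is_fcps_def)
  then show ?thesis
    using assms by (auto simp: fcps_hom_def fcps_id_def fcps_restrict_def fcps_carrier_def is_fcps_def)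
qed

lemma fcps_id_hom: "is_fcps \<Omega> \<Longrightarrow> fcps_id \<Omega> \<in> fcps_hom \<Omega> \<Omega>"
  using fcps_id_hom_restrict[of \<Omega> "fcps_event \<Omega>"] by (cases \<Omega>) (simp add: fcps_restrict_def)

lemma fcps_hom_restrict: "f \<in> fcps_hom \<Omega>' \<Omega> \<Longrightarrow> f \<in> fcps_hom (fcps_restrict \<Omega>' F) \<Omega>"
  by (auto simp: fcps_hom_def fcps_restrict_def fcps_carrier_def)

lemma fcps_hom_PiE: "f \<in> fcps_hom \<Omega>' \<Omega> \<Longrightarrow> f \<in> fcps_carrier \<Omega>' \<rightarrow>\<^sub>E fcps_carrier \<Omega>"
  by (simp add: fcps_hom_def)

lemma fcps_hom_compose:
  assumes \<Omega>2: "is_fcps \<Omega>2" and f: "f \<in> fcps_hom \<Omega>1 \<Omega>" and g: "g \<in> fcps_hom \<Omega>2 \<Omega>1"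
  shows "compose (fcps_carrier \<Omega>2) f g \<in> fcps_hom \<Omega>2 \<Omega>"
proof -
  have "map_pmf (compose (fcps_carrier \<Omega>2) f g) (fcps_pmf \<Omega>2) = map_pmf (\<lambda>x. f (g x)) (fcps_pmf \<Omega>2)"
    using \<Omega>2 by (intro map_pmf_cong) (auto simp: compose_def is_fcps_def)
  also have "\<dots> = map_pmf f (map_pmf g (fcps_pmf \<Omega>2))"
    by (simp add: pmf.map_comp comp_def)
  also have "\<dots> = fcps_pmf \<Omega>"
    using f g by (simp add: fcps_hom_def)
  finally have 1: "map_pmf (compose (fcps_carrier \<Omega>2) f g) (fcps_pmf \<Omega>2) = fcps_pmf \<Omega>" .
  have "compose (fcps_carrier \<Omega>2) f g \<omega> = f (g \<omega>)" if "\<omega> \<in> fcps_event \<Omega>2" for \<omega>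
    using that \<Omega>2 by (auto simp: compose_def is_fcps_def)
  with 1 show ?thesis
    using fcps_hom_PiE[OF f] fcps_hom_PiE[OF g] f g unfolding fcps_hom_def
    by (auto simp: compose_def PiE_iff)
qed

text \<open>The map takes countably many values. For a fixed one the carrier and event conditions
  are discrete, and preservation of the measure is a countable family of equations between point
  masses and probabilities of fibres.\<close>

lemma fcps_hom_measurable:
  assumes t: "t \<in> N \<rightarrow>\<^sub>M fcps_space" and u: "u \<in> N \<rightarrow>\<^sub>M fcps_space"
    and f: "f \<in> N \<rightarrow>\<^sub>M count_space (exts UNIV)"
  shows "Measurable.pred N (\<lambda>x. f x \<in> fcps_hom (t x) (u x))"
proof (rule measurable_compose_countable'[OF _ f countable_exts_nat, where f="\<lambda>f x. f \<in> fcps_hom (t x) (u x)"])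
  fix f :: "nat \<Rightarrow> nat"
  have [measurable]: "Measurable.pred N (\<lambda>x. f \<in> fcps_carrier (t x) \<rightarrow>\<^sub>E fcps_carrier (u x))"
    unfolding fcps_carrier_def
    by (rule discrete_compose2[OF measurable_compose[OF t fcps_size_measurable] _ measurable_compose[OF u fcps_size_measurable]]) simp
  have [measurable]: "Measurable.pred N (\<lambda>x. \<forall>\<omega>\<in>fcps_event (t x). f \<omega> \<in> fcps_event (u x))"
    by (rule discrete_compose2[OF measurable_compose[OF t fcps_event_measurable] countable_finite_sets
          measurable_compose[OF u fcps_event_measurable]])
  \<comment> \<open>The fibre is cut down to the carrier to make it finite; the points removed have
    mass 0.\<close>
  have [measurable]: "(\<lambda>x. fcps_prob (t x) {j. j < fcps_size (t x) \<and> f j = i}) \<in> borel_measurable N" for i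
    by (rule fcps_prob_measurable[OF t measurable_count_spaceI[OF discrete_compose1[OF measurable_compose[OF t fcps_size_measurable]]]]) simp
  have [measurable]: "(\<lambda>x. pmf (fcps_pmf (u x)) i) \<in> borel_measurable N" for i
    by (rule measurable_compose[OF u fcps_pmf_measurable])
  have "map_pmf f (fcps_pmf (t x)) = fcps_pmf (u x) \<longleftrightarrow>
      (\<forall>i. fcps_prob (t x) {j. j < fcps_size (t x) \<and> f j = i} = pmf (fcps_pmf (u x)) i)" if "x \<in> space N" for x
  proof -
    have "is_fcps (t x)" using measurable_space[OF t that] by simp
    then have "pmf (map_pmf f (fcps_pmf (t x))) i = fcps_prob (t x) {j. j < fcps_size (t x) \<and> f j = i}" for i
      unfolding pmf_map fcps_prob_def by (intro measure_prob_cong_0) (auto simp: pmf_eq_0_outside)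
    then show ?thesis by (simp add: pmf_eq_iff)
  qed
  then have "f \<in> fcps_hom (t x) (u x) \<longleftrightarrow> f \<in> fcps_carrier (t x) \<rightarrow>\<^sub>E fcps_carrier (u x) \<and>
      (\<forall>i. fcps_prob (t x) {j. j < fcps_size (t x) \<and> f j = i} = pmf (fcps_pmf (u x)) i) \<and>
      (\<forall>\<omega>\<in>fcps_event (t x). f \<omega> \<in> fcps_event (u x))" if "x \<in> space N" for x
    using that by (simp add: fcps_hom_def)
  moreover have "Measurable.pred N (\<lambda>x. f \<in> fcps_carrier (t x) \<rightarrow>\<^sub>E fcps_carrier (u x) \<and>
      (\<forall>i. fcps_prob (t x) {j. j < fcps_size (t x) \<and> f j = i} = pmf (fcps_pmf (u x)) i) \<and>
      (\<forall>\<omega>\<in>fcps_event (t x). f \<omega> \<in> fcps_event (u x)))"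
    by measurable
  ultimately show "Measurable.pred N (\<lambda>x. f \<in> fcps_hom (t x) (u x))"
    by (simp cong: measurable_cong)
qed

section \<open>Conditional probabilities, the chain rule and total probability\<close>

lemma sum_cond_prob_event:
  assumes "finite F"
  shows "(\<Sum>i\<in>F. fcps_cond_prob \<Omega> {i}) = fcps_cond_prob \<Omega> F"
proof -
  have "fcps_prob \<Omega> (fcps_event \<Omega> \<inter> F) = (\<Sum>i\<in>F. fcps_prob \<Omega> (fcps_event \<Omega> \<inter> {i}))"
  proof -
    have *: "fcps_event \<Omega> \<inter> F = (\<Union>i\<in>F. fcps_event \<Omega> \<inter> {i})" by auto
    show ?thesis
      unfolding fcps_prob_def
      by (subst *) (rule measure_pmf.finite_measure_finite_Union[OF assms], auto simp: disjoint_family_on_def)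
  qed
  then show ?thesis
    by (simp add: fcps_cond_prob_def sum_divide_distrib)
qed

lemma fcps_cond_prob_nonneg: "0 \<le> fcps_cond_prob \<Omega> F"
  by (simp add: fcps_cond_prob_def fcps_prob_def)

text \<open>With E the event of \<Omega>, this is the chain rule P(F|E) P(G|E \<inter> F) = P(F
  \<inter> G|E). When E \<inter> F is null, both sides are 0.\<close>

lemma fcps_cond_prob_restrict:
  "fcps_cond_prob \<Omega> F * fcps_cond_prob (fcps_restrict \<Omega> F) G = fcps_cond_prob \<Omega> (F \<inter> G)"
proof -
  have "fcps_prob \<Omega> (fcps_event \<Omega> \<inter> (F \<inter> G)) \<le> fcps_prob \<Omega> (fcps_event \<Omega> \<inter> F)"
    unfolding fcps_prob_def by (intro measure_pmf.finite_measure_mono) auto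
  moreover have "0 \<le> fcps_prob \<Omega> X" for X by (simp add: fcps_prob_def)
  ultimately show ?thesis
    by (cases "fcps_prob \<Omega> (fcps_event \<Omega> \<inter> F) = 0")
      (auto simp: fcps_cond_prob_def fcps_restrict_def fcps_prob_def Int_assoc less_le intro: antisym)
qed

lemma fcps_pos_restrict: "fcps_pos \<Omega> \<Longrightarrow> fcps_pos (fcps_restrict \<Omega> F) \<longleftrightarrow> 0 < fcps_cond_prob \<Omega> F"
  by (simp add: fcps_pos_def fcps_cond_prob_def fcps_restrict_def fcps_prob_def zero_less_divide_iff)

text \<open>The chain rule applied point by point: scoring the probability of \<open>F\<close>
  undoes the renormalization to the smaller event and leaves an indicator. This is what an exact
  observation computes.\<close>

lemma cint_restrict:
  "ennreal (fcps_cond_prob \<Omega> F) * cint (fcps_restrict \<Omega> F) \<phi> = cint \<Omega> (\<lambda>\<omega>. indicator F \<omega> * \<phi> \<omega>)"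
proof -
  have "ennreal (fcps_cond_prob \<Omega> F) * (ennreal (fcps_cond_prob (fcps_restrict \<Omega> F) {\<omega>}) * \<phi> \<omega>)
      = ennreal (fcps_cond_prob \<Omega> {\<omega>}) * (indicator F \<omega> * \<phi> \<omega>)" for \<omega>
  proof -
    have "ennreal (fcps_cond_prob \<Omega> F) * ennreal (fcps_cond_prob (fcps_restrict \<Omega> F) {\<omega>})
        = ennreal (fcps_cond_prob \<Omega> (F \<inter> {\<omega>}))"
      by (simp add: fcps_cond_prob_nonneg fcps_cond_prob_restrict flip: ennreal_mult)
    also have "\<dots> = ennreal (fcps_cond_prob \<Omega> {\<omega>}) * indicator F \<omega>"
      by (cases "\<omega> \<in> F") (auto simp: fcps_cond_prob_def fcps_prob_def)
    finally show ?thesis by (simp flip: mult.assoc)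
  qed
  then show ?thesis by (simp add: cint_def sum_distrib_left)
qed

text \<open>The law of total probability for the partition into fibres of \<open>X\<close>. A fibre
  contributes its conditional probability times the average over it, which
  \<open>cint_restrict\<close> turns into a plain sum over the fibre; fibres of probability 0 vanish
  on both sides.\<close>

lemma cint_fibres:
  "cint \<Omega> (\<lambda>\<omega>. cint (fcps_restrict \<Omega> {\<omega>' \<in> fcps_carrier \<Omega>. X \<omega>' = X \<omega>}) (\<phi> (X \<omega>))) = cint \<Omega> (\<lambda>\<omega>. \<phi> (X \<omega>) \<omega>)"
proof -
  let ?F = "\<lambda>x. {\<omega> \<in> fcps_carrier \<Omega>. X \<omega> = x}"
  let ?c = "\<lambda>\<omega>. ennreal (fcps_cond_prob \<Omega> {\<omega>})"
  have "cint \<Omega> (\<lambda>\<omega>. cint (fcps_restrict \<Omega> (?F (X \<omega>))) (\<phi> (X \<omega>)))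
      = (\<Sum>x\<in>X ` fcps_carrier \<Omega>. \<Sum>\<omega>\<in>?F x. ?c \<omega> * cint (fcps_restrict \<Omega> (?F (X \<omega>))) (\<phi> (X \<omega>)))"
    unfolding cint_def[of \<Omega>] by (rule sum.image_gen) simp
  also have "\<dots> = (\<Sum>x\<in>X ` fcps_carrier \<Omega>. (\<Sum>\<omega>\<in>?F x. ?c \<omega>) * cint (fcps_restrict \<Omega> (?F x)) (\<phi> x))"
    by (intro sum.cong refl) (simp add: sum_distrib_right)
  also have "\<dots> = (\<Sum>x\<in>X ` fcps_carrier \<Omega>. ennreal (fcps_cond_prob \<Omega> (?F x)) * cint (fcps_restrict \<Omega> (?F x)) (\<phi> x))"
    by (simp add: fcps_cond_prob_nonneg sum_cond_prob_event)
  also have "\<dots> = (\<Sum>x\<in>X ` fcps_carrier \<Omega>. \<Sum>\<omega>\<in>?F x. ?c \<omega> * \<phi> (X \<omega>) \<omega>)"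
    unfolding cint_restrict unfolding cint_def
    by (intro sum.cong refl sum.mono_neutral_cong_right) (auto split: split_indicator)
  also have "\<dots> = cint \<Omega> (\<lambda>\<omega>. \<phi> (X \<omega>) \<omega>)"
    unfolding cint_def by (rule sum.image_gen[symmetric]) simp
  finally show ?thesis .
qed

text \<open>The conditional probabilities add up to 1, or to 0 if the event is null. The second case
  is the gap that the second invariant closes.\<close>

lemma cint_const: 
  assumes "is_fcps \<Omega>"
  shows "cint \<Omega> (\<lambda>_. c) = (if fcps_pos \<Omega> then c else 0)"
proof -
  have "fcps_event \<Omega> \<inter> fcps_carrier \<Omega> = fcps_event \<Omega>"
    using assms by (auto simp: is_fcps_def)
  then have "fcps_cond_prob \<Omega> (fcps_carrier \<Omega>) = (if fcps_pos \<Omega> then 1 else 0)"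
    by (simp add: fcps_cond_prob_def fcps_pos_def)
  then show ?thesis
    by (simp add: cint_def fcps_cond_prob_nonneg sum_cond_prob_event flip: sum_distrib_right)
qed

section \<open>The conditional distribution as a kernel\<close>

lemma prob_restrict_cond_pmf:
  assumes \<Omega>: "is_fcps \<Omega>" and pos: "fcps_pos \<Omega>"
  shows "prob_space (restrict_space (measure_pmf (cond_pmf (fcps_pmf \<Omega>) (fcps_event \<Omega>))) (fcps_carrier \<Omega>))"
    and "(\<integral>\<^sup>+i. \<phi> i \<partial>restrict_space (measure_pmf (cond_pmf (fcps_pmf \<Omega>) (fcps_event \<Omega>))) (fcps_carrier \<Omega>)) = cint \<Omega> \<phi>"
proof -
  let ?q = "cond_pmf (fcps_pmf \<Omega>) (fcps_event \<Omega>)"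
  have ne: "set_pmf (fcps_pmf \<Omega>) \<inter> fcps_event \<Omega> \<noteq> {}"
    using pos by (auto simp: fcps_pos_def fcps_prob_def measure_pmf_zero_iff[symmetric] simp del: measure_pmf_zero_iff)
  have sub: "set_pmf ?q \<subseteq> fcps_carrier \<Omega>"
    using \<Omega> by (auto simp: set_cond_pmf[OF ne] is_fcps_def)
  have "emeasure (measure_pmf ?q) (fcps_carrier \<Omega>) = 1"
    using sub measure_pmf.emeasure_eq_1_AE[of "fcps_carrier \<Omega>" ?q] by (auto simp: AE_measure_pmf_iff)
  then show "prob_space (restrict_space (measure_pmf ?q) (fcps_carrier \<Omega>))"
    by (intro prob_space_restrict_space) auto
  have pmf: "pmf ?q i = fcps_cond_prob \<Omega> {i}" for i
    using pos by (cases "i \<in> fcps_event \<Omega>")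
      (auto simp: pmf_cond[OF ne] fcps_cond_prob_def fcps_pos_def fcps_prob_def measure_pmf_single)
  have "(\<integral>\<^sup>+i. \<phi> i \<partial>restrict_space (measure_pmf ?q) (fcps_carrier \<Omega>))
      = (\<integral>\<^sup>+i. \<phi> i * indicator (fcps_carrier \<Omega>) i \<partial>measure_pmf ?q)"
    by (rule nn_integral_restrict_space) simp
  also have "\<dots> = (\<Sum>i\<in>fcps_carrier \<Omega>. \<phi> i * indicator (fcps_carrier \<Omega>) i * ennreal (pmf ?q i))"
    using sub by (intro nn_integral_measure_pmf_support) auto
  also have "\<dots> = cint \<Omega> \<phi>"
    unfolding cint_def by (intro sum.cong) (auto simp: pmf mult.commute)
  finally show "(\<integral>\<^sup>+i. \<phi> i \<partial>restrict_space (measure_pmf ?q) (fcps_carrier \<Omega>)) = cint \<Omega> \<phi>" .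
qed

lemma sets_restrict_cond_pmf:
  "sets (restrict_space (measure_pmf q) (fcps_carrier \<Omega>)) = sets (count_space (fcps_carrier \<Omega>))"
  by (auto simp: sets_restrict_space)

lemma some_in_carrier: "is_fcps \<Omega> \<Longrightarrow> (SOME \<omega>. \<omega> \<in> fcps_carrier \<Omega>) \<in> fcps_carrier \<Omega>"
  by (rule someI[of _ 0]) (simp add: is_fcps_def fcps_carrier_def)

lemma fcps_cond_in_space:
  assumes "is_fcps \<Omega>"
  shows "fcps_cond \<Omega> \<in> space (P_space (count_space (fcps_carrier \<Omega>)))"
proof (cases "fcps_pos \<Omega>")
  case True
  let ?M = "restrict_space (measure_pmf (cond_pmf (fcps_pmf \<Omega>) (fcps_event \<Omega>))) (fcps_carrier \<Omega>)"
  have "(\<lambda>_. ?M) \<in> count_space {()} \<rightarrow>\<^sub>M prob_algebra (count_space (fcps_carrier \<Omega>))"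
    using prob_restrict_cond_pmf(1)[OF assms True]
    by (simp add: space_prob_algebra sets_restrict_cond_pmf)
  from measurable_space[OF P_lift_measurable[OF this], of "()"] True show ?thesis
    by (simp add: fcps_cond_def fcps_pos_def)
next
  case False
  then show ?thesis
    using some_in_carrier[OF assms]
    by (auto simp: fcps_cond_def fcps_pos_def space_P_space space_pair_measure intro!: prob_space_return)
qed

lemma nn_integral_fcps_cond:
  assumes \<Omega>: "is_fcps \<Omega>" and g: "g \<in> borel_measurable (weight_space \<Otimes>\<^sub>M count_space (fcps_carrier \<Omega>))"
  shows "(\<integral>\<^sup>+p. g p \<partial>fcps_cond \<Omega>) =
    (if fcps_pos \<Omega> then cint \<Omega> (\<lambda>\<omega>. g (1, \<omega>)) else g (0, SOME \<omega>. \<omega> \<in> fcps_carrier \<Omega>))"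
proof (cases "fcps_pos \<Omega>")
  case True
  let ?M = "restrict_space (measure_pmf (cond_pmf (fcps_pmf \<Omega>) (fcps_event \<Omega>))) (fcps_carrier \<Omega>)"
  have "Pair 1 \<in> ?M \<rightarrow>\<^sub>M weight_space \<Otimes>\<^sub>M count_space (fcps_carrier \<Omega>)"
    by (subst measurable_cong_sets[OF sets_restrict_cond_pmf refl]) (auto simp: space_pair_measure)
  from nn_integral_distr[OF this] g
  have "(\<integral>\<^sup>+p. g p \<partial>P_lift ?M) = (\<integral>\<^sup>+i. g (1, i) \<partial>?M)"
    by (simp add: P_lift_pair_cong[OF sets_restrict_cond_pmf])
  with True show ?thesis
    by (simp add: prob_restrict_cond_pmf(2)[OF \<Omega> True] fcps_cond_def flip: fcps_pos_def)
next
  case False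
  then show ?thesis
    using g some_in_carrier[OF \<Omega>]
    by (simp add: fcps_cond_def nn_integral_return space_pair_measure flip: fcps_pos_def)
qed

lemma cint_not_pos: "\<not> fcps_pos \<Omega> \<Longrightarrow> cint \<Omega> \<phi> = 0"
  by (simp add: cint_def fcps_cond_prob_def fcps_pos_def)

text \<open>The Dirac measure that stands in for a null event has weight 0, in agreement with the
  convention that \<open>cint\<close> vanishes there; its arbitrary point has no influence.\<close>

lemma wint_fcps_cond: "is_fcps \<Omega> \<Longrightarrow> wint (fcps_cond \<Omega>) \<phi> = cint \<Omega> \<phi>"
  unfolding wint_def using weight_times_measurable[of \<phi> "count_space (fcps_carrier \<Omega>)"]
  by (subst nn_integral_fcps_cond) (auto simp: cint_not_pos)

lemma P_space_restrict_count_space: "P_space (restrict_space (count_space UNIV) S) = P_space (count_space S)"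
  by (simp add: restrict_count_space)

lemma dkernel_fcps_cond: "dkernel fcps_space fcps_carrier (count_space UNIV) fcps_cond"
proof (rule dkernelI)
  fix X :: "(real \<times> nat) set" assume X: "X \<in> sets (weight_space \<Otimes>\<^sub>M count_space UNIV)"
  \<comment> \<open>The arbitrary point is chosen from an initial segment and so depends on the size
    alone, which makes the choice measurable.\<close>
  have "(\<integral>\<^sup>+p. indicator X p \<partial>fcps_cond \<Omega>) = (if fcps_pos \<Omega> then cint \<Omega> (\<lambda>\<omega>. indicator X (1, \<omega>))
      else indicator X (0, SOME \<omega>. \<omega> \<in> {..<fcps_size \<Omega>}))" if "\<Omega> \<in> space fcps_space" for \<Omega>
    using that measurable_compose[OF measurable_pair_restrict_ident borel_measurable_indicator[OF X]]
    by (subst nn_integral_fcps_cond) (auto simp: restrict_count_space fcps_carrier_def)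
  moreover have "(\<lambda>\<Omega>. cint \<Omega> (\<lambda>\<omega>. indicator X (1, \<omega>))) \<in> borel_measurable fcps_space"
    by (rule cint_measurable) auto
  moreover have "(\<lambda>\<Omega>. indicator X (0 :: real, SOME \<omega>. \<omega> \<in> {..<fcps_size \<Omega>}) :: ennreal) \<in> borel_measurable fcps_space"
    by (rule measurable_compose[OF fcps_size_measurable]) simp
  ultimately show "(\<lambda>\<Omega>. \<integral>\<^sup>+p. indicator X p \<partial>fcps_cond \<Omega>) \<in> borel_measurable fcps_space"
    using fcps_pos_measurable[of "\<lambda>\<Omega>. \<Omega>" fcps_space]
    by (subst measurable_cong) (assumption, auto intro!: measurable_If simp: pred_def)
qed (simp add: P_space_restrict_count_space fcps_cond_in_space)

text \<open>The draw made at the boundary from the exact to the sampling language. The random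
  variable has values of the right type only on the carrier of \<open>t x\<close>, which varies with
  \<open>x\<close>; hence a varying fibre followed by a constant target.\<close>

lemma cond_value:
  assumes t: "t \<in> N \<rightarrow>\<^sub>M fcps_space" and X: "X \<in> N \<rightarrow>\<^sub>M count_space (exts (space (exact_space A)))"
    and XS: "\<And>x. x \<in> space N \<Longrightarrow> X x \<in> fcps_carrier (t x) \<rightarrow>\<^sub>E space (exact_space A)"
  shows cond_value_measurable:
      "(\<lambda>x. P_bind (fcps_cond (t x)) (\<lambda>\<omega>. P_return (exact_space A) (X x \<omega>))) \<in> N \<rightarrow>\<^sub>M P_space (exact_space A)"
    and wint_cond_value: "x \<in> space N \<Longrightarrow> g \<in> borel_measurable (exact_space A) \<Longrightarrow>
      wint (P_bind (fcps_cond (t x)) (\<lambda>\<omega>. P_return (exact_space A) (X x \<omega>))) g = cint (t x) (\<lambda>\<omega>. g (X x \<omega>))"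
proof -
  let ?R = "restrict_space (N \<Otimes>\<^sub>M count_space UNIV) {z. snd z \<in> fcps_carrier (t (fst z))}"
  note k = dkernel_compose[OF dkernel_fcps_cond t]
  have "(\<lambda>z. X (fst z) (snd z)) \<in> ?R \<rightarrow>\<^sub>M exact_space A"
    unfolding measurable_exact_space2
  proof (rule measurable_count_spaceI)
    show "(\<lambda>z. X (fst z) (snd z)) \<in> ?R \<rightarrow>\<^sub>M count_space UNIV"
      by (rule discrete_compose2[OF measurable_restrict_space1[OF measurable_compose[OF measurable_fst X]] countable_exts_exact
            measurable_restrict_space1[OF measurable_snd]])
    show "X (fst z) (snd z) \<in> space (exact_space A)" if "z \<in> space ?R" for z
      using that XS[of "fst z"] by (auto simp: space_restrict_space space_pair_measure)
  qed
  then have \<eta>: "dkernel ?R (\<lambda>z. UNIV) (exact_space A) (\<lambda>z. P_return (exact_space A) (X (fst z) (snd z)))"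
    by (simp add: dkernel_UNIV P_return_measurable)
  have P: "Measurable.pred (N \<Otimes>\<^sub>M count_space UNIV) (\<lambda>z. snd z \<in> fcps_carrier (t (fst z)))"
    unfolding fcps_carrier_def
    by (rule discrete_compose2[OF measurable_snd _ measurable_compose[OF measurable_compose[OF measurable_fst t] fcps_size_measurable]])
      simp
  from dkernel_bind[OF k P \<eta>]
  show "(\<lambda>x. P_bind (fcps_cond (t x)) (\<lambda>\<omega>. P_return (exact_space A) (X x \<omega>))) \<in> N \<rightarrow>\<^sub>M P_space (exact_space A)"
    by (simp add: dkernel_UNIV)
  assume x: "x \<in> space N" and g: "g \<in> borel_measurable (exact_space A)"
  have \<Omega>: "is_fcps (t x)" using measurable_space[OF t x] by simp
  have "wint (P_bind (fcps_cond (t x)) (\<lambda>\<omega>. P_return (exact_space A) (X x \<omega>))) g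
      = wint (fcps_cond (t x)) (\<lambda>\<omega>. wint (P_return (exact_space A) (X x \<omega>)) g)"
    by (rule wint_dkernel_bind[OF k \<eta> x g])
  also have "\<dots> = wint (fcps_cond (t x)) (\<lambda>\<omega>. g (X x \<omega>))"
    using XS[OF x] g by (intro wint_cong[OF fcps_cond_in_space[OF \<Omega>]] wint_P_return) auto
  finally show "wint (P_bind (fcps_cond (t x)) (\<lambda>\<omega>. P_return (exact_space A) (X x \<omega>))) g = cint (t x) (\<lambda>\<omega>. g (X x \<omega>))"
    by (simp add: wint_fcps_cond[OF \<Omega>])
qed

subsection \<open>Tensoring with a coin flip\<close>

text \<open>The low-level coin replaces an out-of-range parameter by 0, the high-level one falls
  back to the point mass at false. A coin with parameter 0 is that point mass.\<close>

lemma flip_pmf_clip: "bernoulli_pmf (if p \<in> {0..1} then p else 0) = flip_pmf p"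
proof -
  have "pmf (bernoulli_pmf 0) b = pmf (return_pmf False) b" for b
    by (cases b) (simp_all add: indicator_def)
  then have "bernoulli_pmf 0 = return_pmf False"
    by (rule pmf_eqI)
  then show ?thesis by (simp add: flip_pmf_def)
qed

lemma pmf_fcps_flip:
  "pmf (fcps_pmf (fcps_flip p)) i =
     (if i = 0 then pmf (flip_pmf p) False else if i = 1 then pmf (flip_pmf p) True else 0)"
proof -
  have inj: "inj (of_bool :: bool \<Rightarrow> nat)" by (simp add: inj_def)
  have "pmf (map_pmf of_bool q) (of_bool b :: nat) = pmf q b" for q b
    by (rule pmf_map_inj'[OF inj])
  from this[of _ True] this[of _ False]
  have 01: "pmf (map_pmf of_bool q) (1 :: nat) = pmf q True" "pmf (map_pmf of_bool q) (0 :: nat) = pmf q False" for q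
    by simp_all
  have "pmf (map_pmf of_bool q) i = 0" if "i \<noteq> 0" "i \<noteq> 1" for q
    using that by (intro pmf_map_outside) (auto simp: of_bool_def split: if_splits)
  with 01 show ?thesis by (simp add: fcps_flip_def flip_pmf_clip[of p, simplified])
qed

lemma fcps_flip_simps [simp]: "fcps_size (fcps_flip p) = 2" "fcps_event (fcps_flip p) = {0, 1}"
  by (simp_all add: fcps_flip_def)

lemma set_pmf_fcps_flip: "set_pmf (fcps_pmf (fcps_flip p)) \<subseteq> {0, 1}"
  by (auto simp: fcps_flip_def)

lemma pairing_flip: "fcps_pairing (fcps_flip p) (a, b) = 2 * a + b"
  by (simp add: fcps_pairing_def)

text \<open>The coin has size 2, so a pair is coded as \<open>2 * a + b\<close>, and quotient and
  remainder by 2 are the projections. Both faces belong to the event of the coin, so membership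
  depends on the quotient alone.\<close>

lemma event_tensor_flip: "fcps_event (fcps_tensor \<Omega> (fcps_flip p)) = {i. i div 2 \<in> fcps_event \<Omega>}"
proof -
  have "i \<in> (\<lambda>(a, b). 2 * a + b) ` (E \<times> {0, 1}) \<longleftrightarrow> i div 2 \<in> E" for i :: nat and E
  proof
    assume "i div 2 \<in> E"
    then show "i \<in> (\<lambda>(a, b). 2 * a + b) ` (E \<times> {0, 1})"
      by (intro image_eqI[of _ _ "(i div 2, i mod 2)"]) auto
  qed auto
  then show ?thesis by (auto simp: fcps_tensor_def fcps_pairing_def)
qed

lemma size_tensor_flip: "fcps_size (fcps_tensor \<Omega> (fcps_flip p)) = fcps_size \<Omega> * 2"
  by (simp add: fcps_tensor_def)

lemma pmf_tensor_flip:
  "pmf (fcps_pmf (fcps_tensor \<Omega> (fcps_flip p))) i = pmf (fcps_pmf \<Omega>) (i div 2) * pmf (fcps_pmf (fcps_flip p)) (i mod 2)"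
proof -
  let ?q = "pair_pmf (fcps_pmf \<Omega>) (fcps_pmf (fcps_flip p))"
  have "pmf (fcps_pmf (fcps_tensor \<Omega> (fcps_flip p))) i = measure ?q (fcps_pairing (fcps_flip p) -` {i})"
    by (simp add: fcps_tensor_def pmf_map)
  also have "\<dots> = measure ?q {(i div 2, i mod 2)}"
  proof (rule measure_prob_cong_0)
    \<comment> \<open>The coding is injective only for second components below 2. Any other pair
      with code \<open>i\<close> has a second component that the coin never takes, hence mass
      0.\<close>
    fix z assume z: "z \<in> fcps_pairing (fcps_flip p) -` {i} - {(i div 2, i mod 2)}"
    obtain a b where "z = (a, b)" by (cases z)
    with z have "b \<notin> {0, 1}" by (auto simp: pairing_flip intro!: gr0I)
    then show "pmf ?q z = 0"
      using \<open>z = (a, b)\<close> by (simp add: pmf_pair pmf_fcps_flip)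
  qed (auto simp: pairing_flip)
  also have "\<dots> = pmf ?q (i div 2, i mod 2)" by (simp add: measure_pmf_single)
  finally show ?thesis by (simp add: pmf_pair)
qed

lemma is_fcps_tensor_flip:
  assumes "is_fcps \<Omega>"
  shows "is_fcps (fcps_tensor \<Omega> (fcps_flip p))"
proof -
  have "i < fcps_size \<Omega> * 2" if "pmf (fcps_pmf (fcps_tensor \<Omega> (fcps_flip p))) i \<noteq> 0" for i
    using that pmf_eq_0_outside[OF assms, of "i div 2"] by (auto simp: pmf_tensor_flip div_less_iff_less_mult)
  then have "set_pmf (fcps_pmf (fcps_tensor \<Omega> (fcps_flip p))) \<subseteq> {..<fcps_size \<Omega> * 2}"
    by (auto simp: set_pmf_iff)
  moreover have "i < fcps_size \<Omega> * 2" if "i div 2 \<in> fcps_event \<Omega>" for i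
    using that assms by (auto simp: is_fcps_def fcps_carrier_def)
  ultimately show ?thesis
    using assms unfolding is_fcps_def fcps_carrier_def size_tensor_flip event_tensor_flip by auto
qed

lemma fcps_proj1_hom:
  assumes "is_fcps \<Omega>"
  shows "fcps_proj1 \<Omega> (fcps_flip p) \<in> fcps_hom (fcps_tensor \<Omega> (fcps_flip p)) \<Omega>"
proof -
  let ?T = "fcps_tensor \<Omega> (fcps_flip p)"
  have T: "is_fcps ?T" by (rule is_fcps_tensor_flip[OF assms])
  have "map_pmf (fcps_proj1 \<Omega> (fcps_flip p)) (fcps_pmf ?T) = map_pmf (\<lambda>i. i div 2) (fcps_pmf ?T)"
    using T by (intro map_pmf_cong) (auto simp: fcps_proj1_def is_fcps_def)
  also have "\<dots> = map_pmf (\<lambda>z. fcps_pairing (fcps_flip p) z div 2) (pair_pmf (fcps_pmf \<Omega>) (fcps_pmf (fcps_flip p)))"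
    by (simp add: fcps_tensor_def pmf.map_comp comp_def)
  also have "\<dots> = map_pmf fst (pair_pmf (fcps_pmf \<Omega>) (fcps_pmf (fcps_flip p)))"
    using set_pmf_fcps_flip[of p] by (intro map_pmf_cong) (auto simp: pairing_flip)
  also have "\<dots> = fcps_pmf \<Omega>" by (rule map_fst_pair_pmf)
  finally show ?thesis
    using T unfolding fcps_hom_def
    by (auto simp: fcps_proj1_def event_tensor_flip is_fcps_def fcps_carrier_def size_tensor_flip)
qed

text \<open>The coin is not conditioned on: up to null sets, the event of the tensor is the cylinder
  over the event of \<Omega>.\<close>

lemma prob_tensor_flip_event:
  "fcps_prob (fcps_tensor \<Omega> (fcps_flip p)) (fcps_event (fcps_tensor \<Omega> (fcps_flip p))) = fcps_prob \<Omega> (fcps_event \<Omega>)"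
proof -
  let ?q = "pair_pmf (fcps_pmf \<Omega>) (fcps_pmf (fcps_flip p))"
  have "fcps_prob (fcps_tensor \<Omega> (fcps_flip p)) (fcps_event (fcps_tensor \<Omega> (fcps_flip p)))
      = measure ?q (fcps_pairing (fcps_flip p) -` {i. i div 2 \<in> fcps_event \<Omega>})"
    unfolding event_tensor_flip by (simp add: fcps_prob_def fcps_tensor_def)
  also have "\<dots> = measure ?q (fst -` fcps_event \<Omega>)"
  proof (rule measure_prob_cong_0)
    fix z assume z: "z \<in> fcps_pairing (fcps_flip p) -` {i. i div 2 \<in> fcps_event \<Omega>} - fst -` fcps_event \<Omega>"
    obtain a b where "z = (a, b)" by (cases z)
    with z have "b \<notin> {0, 1}" by (auto simp: pairing_flip intro!: gr0I)
    then show "pmf ?q z = 0"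
      using \<open>z = (a, b)\<close> by (simp add: pmf_pair pmf_fcps_flip)
  next
    fix z assume z: "z \<in> fst -` fcps_event \<Omega> - fcps_pairing (fcps_flip p) -` {i. i div 2 \<in> fcps_event \<Omega>}"
    obtain a b where "z = (a, b)" by (cases z)
    with z have "b \<notin> {0, 1}" by (auto simp: pairing_flip intro!: gr0I)
    then show "pmf ?q z = 0"
      using \<open>z = (a, b)\<close> by (simp add: pmf_pair pmf_fcps_flip)
  qed
  also have "\<dots> = measure (map_pmf fst ?q) (fcps_event \<Omega>)" by simp
  finally show ?thesis by (simp add: map_fst_pair_pmf fcps_prob_def)
qed

lemma fcps_pos_tensor_flip: "fcps_pos (fcps_tensor \<Omega> (fcps_flip p)) \<longleftrightarrow> fcps_pos \<Omega>"
  by (simp add: fcps_pos_def prob_tensor_flip_event)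

text \<open>Division by zero yields 0, so the formula includes spaces with a null event.\<close>

lemma fcps_cond_prob_single: "fcps_cond_prob \<Omega> {i} = of_bool (i \<in> fcps_event \<Omega>) * pmf (fcps_pmf \<Omega>) i / fcps_prob \<Omega> (fcps_event \<Omega>)"
  by (auto simp: fcps_cond_prob_def fcps_prob_def measure_pmf_single less_le)

text \<open>Each point splits into two, weighted by the coin, while the normalizing constant stays
  the same. The average over the larger space is therefore an average over \<Omega> of the
  expectation of a coin at each point.\<close>

lemma cint_tensor_flip:
  "cint (fcps_tensor \<Omega> (fcps_flip p)) \<psi> = cint \<Omega> (\<lambda>\<omega>.
     ennreal (pmf (flip_pmf p) False) * \<psi> (2 * \<omega>) + ennreal (pmf (flip_pmf p) True) * \<psi> (2 * \<omega> + 1))"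
proof -
  let ?T = "fcps_tensor \<Omega> (fcps_flip p)"
  have cp: "ennreal (fcps_cond_prob ?T {i}) = ennreal (fcps_cond_prob \<Omega> {i div 2}) * ennreal (pmf (fcps_pmf (fcps_flip p)) (i mod 2))" for i
    unfolding fcps_cond_prob_single prob_tensor_flip_event unfolding pmf_tensor_flip event_tensor_flip
    by (subst ennreal_mult[symmetric]) (auto simp: fcps_prob_def)
  have "cint ?T \<psi> = (\<Sum>i<fcps_size \<Omega> * 2. ennreal (fcps_cond_prob ?T {i}) * \<psi> i)"
    by (simp add: cint_def fcps_carrier_def size_tensor_flip)
  \<comment> \<open>Consecutive pairs of codes are the fibres of the first projection.\<close>
  also have "\<dots> = (\<Sum>\<omega><fcps_size \<Omega>. \<Sum>i\<in>{\<omega> * 2..<\<omega> * 2 + 2}. ennreal (fcps_cond_prob ?T {i}) * \<psi> i)"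
    by (rule sum.nat_group[symmetric])
  also have "\<dots> = (\<Sum>\<omega><fcps_size \<Omega>. ennreal (fcps_cond_prob ?T {2 * \<omega>}) * \<psi> (2 * \<omega>)
      + ennreal (fcps_cond_prob ?T {2 * \<omega> + 1}) * \<psi> (2 * \<omega> + 1))"
  proof (rule sum.cong[OF refl])
    fix \<omega> :: nat
    have "{\<omega> * 2..<\<omega> * 2 + 2} = {2 * \<omega>, 2 * \<omega> + 1}" by auto
    then show "(\<Sum>i\<in>{\<omega> * 2..<\<omega> * 2 + 2}. ennreal (fcps_cond_prob ?T {i}) * \<psi> i) =
        ennreal (fcps_cond_prob ?T {2 * \<omega>}) * \<psi> (2 * \<omega>) + ennreal (fcps_cond_prob ?T {2 * \<omega> + 1}) * \<psi> (2 * \<omega> + 1)"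
      by simp
  qed
  also have "\<dots> = cint \<Omega> (\<lambda>\<omega>. ennreal (pmf (flip_pmf p) False) * \<psi> (2 * \<omega>) + ennreal (pmf (flip_pmf p) True) * \<psi> (2 * \<omega> + 1))"
    unfolding cint_def fcps_carrier_def
    by (intro sum.cong refl) (simp add: cp pmf_fcps_flip distrib_left mult.assoc)
  finally show ?thesis .
qed

lemma fcps_tensor_flip_measurable:
  assumes t: "t \<in> N \<rightarrow>\<^sub>M fcps_space" and p: "p \<in> borel_measurable N"
  shows "(\<lambda>x. fcps_tensor (t x) (fcps_flip (p x))) \<in> N \<rightarrow>\<^sub>M fcps_space"
proof (rule fcps_space_measurableI)
  show "is_fcps (fcps_tensor (t x) (fcps_flip (p x)))" if "x \<in> space N" for x
    using measurable_space[OF t that] is_fcps_tensor_flip by simp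
  show "(\<lambda>x. fcps_size (fcps_tensor (t x) (fcps_flip (p x)))) \<in> N \<rightarrow>\<^sub>M count_space UNIV"
    unfolding size_tensor_flip by (rule discrete_compose1[OF measurable_compose[OF t fcps_size_measurable]])
  show "(\<lambda>x. fcps_event (fcps_tensor (t x) (fcps_flip (p x)))) \<in> N \<rightarrow>\<^sub>M count_space UNIV"
    unfolding event_tensor_flip by (rule discrete_compose1[OF measurable_compose[OF t fcps_event_measurable]])
  fix i
  note [measurable] = measurable_compose[OF t fcps_pmf_measurable] flip_pmf_measurable[OF p]
  show "(\<lambda>x. pmf (fcps_pmf (fcps_tensor (t x) (fcps_flip (p x)))) i) \<in> borel_measurable N"
    unfolding pmf_tensor_flip pmf_fcps_flip by measurable
qed

lemma wint_P_lift_flip: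
  "wint (P_lift (distr (measure_pmf (flip_pmf p)) (exact_space EBoolT) VBool)) g =
     ennreal (pmf (flip_pmf p) False) * g (VBool False) + ennreal (pmf (flip_pmf p) True) * g (VBool True)"
proof -
  have "wint (P_lift (distr (measure_pmf (flip_pmf p)) (exact_space EBoolT) VBool)) g =
      (\<integral>\<^sup>+x. g x \<partial>distr (measure_pmf (flip_pmf p)) (exact_space EBoolT) VBool)"
    by (rule wint_P_lift[where A="exact_space EBoolT"]) auto
  also have "\<dots> = (\<integral>\<^sup>+b. g (VBool b) \<partial>measure_pmf (flip_pmf p))"
    by (rule nn_integral_distr) auto
  also have "\<dots> = (\<Sum>b\<in>UNIV. g (VBool b) * ennreal (pmf (flip_pmf p) b))"
    by (rule nn_integral_measure_pmf_support) auto
  finally show ?thesis by (simp add: UNIV_bool mult.commute add.commute)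
qed

subsection \<open>Spaces of low-level results\<close>

lemma sets_eq_if_measurable_ident:
  assumes "(\<lambda>x. x) \<in> M \<rightarrow>\<^sub>M N" "(\<lambda>x. x) \<in> N \<rightarrow>\<^sub>M M"
  shows "sets M = sets N"
proof -
  have sub: "sets N \<subseteq> sets M" if "(\<lambda>x. x) \<in> M \<rightarrow>\<^sub>M N" "(\<lambda>x. x) \<in> N \<rightarrow>\<^sub>M M" for M N :: "'a measure"
  proof
    fix A assume A: "A \<in> sets N"
    have "A \<subseteq> space M"
      using sets.sets_into_space[OF A] measurable_space[OF that(2)] by auto
    with measurable_sets[OF that(1) A] show "A \<in> sets M" by (simp add: Int_absorb2)
  qed
  from sub[OF assms] sub[OF assms(2,1)] show ?thesis by blast
qed

lemma measurable_pair3: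
  assumes "(\<lambda>p. fst p) \<in> N \<rightarrow>\<^sub>M A" "(\<lambda>p. fst (snd p)) \<in> N \<rightarrow>\<^sub>M B" "(\<lambda>p. snd (snd p)) \<in> N \<rightarrow>\<^sub>M C"
  shows "(\<lambda>p. p) \<in> N \<rightarrow>\<^sub>M A \<Otimes>\<^sub>M B \<Otimes>\<^sub>M C"
  using measurable_Pair[OF assms(1) measurable_Pair[OF assms(2,3)]] by simp

text \<open>One space for the results over all initial spaces. The maps come from a countable set
  instead of from all functions, so that properties of results can be checked map by map.\<close>

definition big :: "'v measure \<Rightarrow> (fcps \<times> (nat \<Rightarrow> nat) \<times> 'v) measure" where
  "big V = fcps_space \<Otimes>\<^sub>M count_space (exts UNIV) \<Otimes>\<^sub>M V"

text \<open>The two ambient spaces differ in their maps and values, but on a set of well-formed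
  results the identity is measurable in both directions. \<open>P_return\<close> depends on a space
  only through its \<sigma>-algebra, so the result spaces of the semantics can be exchanged for
  traces of \<open>big\<close>.\<close>

lemma sets_restrict_big:
  assumes V: "sets V = sets (restrict_space V' T)"
    and S: "\<And>\<Omega> f v. (\<Omega>, f, v) \<in> S \<Longrightarrow> f \<in> exts UNIV \<and> v \<in> T"
  shows "sets (restrict_space (fcps_space \<Otimes>\<^sub>M count_space UNIV \<Otimes>\<^sub>M V') S) = sets (restrict_space (big V) S)"
proof (rule sets_eq_if_measurable_ident)
  let ?M = "restrict_space (fcps_space \<Otimes>\<^sub>M count_space UNIV \<Otimes>\<^sub>M V') S"
  have s: "fst (snd p) \<in> exts UNIV \<and> snd (snd p) \<in> T" if "p \<in> space ?M" for p
    using that S[of "fst p" "fst (snd p)" "snd (snd p)"] by (simp add: space_restrict_space)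
  show "(\<lambda>p. p) \<in> ?M \<rightarrow>\<^sub>M restrict_space (big V) S"
    unfolding big_def
  proof (intro measurable_restrict_space2 measurable_pair3)
    show "(\<lambda>p. fst p) \<in> ?M \<rightarrow>\<^sub>M fcps_space"
      by (rule measurable_restrict_space1) simp
    have "(\<lambda>p. fst (snd p)) \<in> ?M \<rightarrow>\<^sub>M count_space UNIV"
      by (rule measurable_restrict_space1) simp
    then show "(\<lambda>p. fst (snd p)) \<in> ?M \<rightarrow>\<^sub>M count_space (exts UNIV)"
      by (rule measurable_count_spaceI) (use s in blast)
    have "(\<lambda>p. snd (snd p)) \<in> ?M \<rightarrow>\<^sub>M restrict_space V' T"
      using s by (intro measurable_restrict_space2 measurable_restrict_space1) auto
    then show "(\<lambda>p. snd (snd p)) \<in> ?M \<rightarrow>\<^sub>M V"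
      using measurable_cong_sets[OF refl V] by blast
  qed (simp add: space_restrict_space)
  let ?N = "restrict_space (big V) S"
  show "(\<lambda>p. p) \<in> ?N \<rightarrow>\<^sub>M ?M"
  proof (intro measurable_restrict_space2 measurable_pair3)
    have "(\<lambda>p. fst (snd p)) \<in> ?N \<rightarrow>\<^sub>M count_space (exts UNIV)"
      unfolding big_def by (rule measurable_restrict_space1) simp
    then show "(\<lambda>p. fst (snd p)) \<in> ?N \<rightarrow>\<^sub>M count_space UNIV"
      by (rule measurable_count_spaceD)
    have "(\<lambda>p. snd (snd p)) \<in> ?N \<rightarrow>\<^sub>M V"
      unfolding big_def by (rule measurable_restrict_space1) simp
    then have "(\<lambda>p. snd (snd p)) \<in> ?N \<rightarrow>\<^sub>M restrict_space V' T"
      using measurable_cong_sets[OF refl V] by blast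
    then show "(\<lambda>p. snd (snd p)) \<in> ?N \<rightarrow>\<^sub>M V'"
      by (simp add: measurable_restrict_space2_iff)
    show "(\<lambda>p. fst p) \<in> ?N \<rightarrow>\<^sub>M fcps_space"
      unfolding big_def by (rule measurable_restrict_space1) simp
  qed (simp add: space_restrict_space)
qed

definition exact_vals :: "exact_ty \<Rightarrow> (nat \<Rightarrow> val) measure" where
  "exact_vals A = count_space (exts (space (exact_space A)))"

lemma exact_vals_measurableD:
  "f \<in> N \<rightarrow>\<^sub>M exact_vals A \<Longrightarrow> f \<in> N \<rightarrow>\<^sub>M count_space (exts (space (exact_space A)))"
  by (simp add: exact_vals_def)

definition exact_fib :: "exact_ty \<Rightarrow> fcps \<Rightarrow> (fcps \<times> (nat \<Rightarrow> nat) \<times> (nat \<Rightarrow> val)) set" where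
  "exact_fib A \<Omega> = {(\<Omega>', f, X). is_fcps \<Omega>' \<and> f \<in> fcps_hom \<Omega>' \<Omega> \<and> X \<in> fcps_carrier \<Omega>' \<rightarrow>\<^sub>E space (exact_space A)}"

definition sample_fib :: "sample_ty \<Rightarrow> fcps \<Rightarrow> (fcps \<times> (nat \<Rightarrow> nat) \<times> val) set" where
  "sample_fib \<tau> \<Omega> = {(\<Omega>', f, v). is_fcps \<Omega>' \<and> f \<in> fcps_hom \<Omega>' \<Omega> \<and> v \<in> space (sample_space \<tau>)}"

abbreviation exact_results :: "exact_ty \<Rightarrow> fcps \<Rightarrow> (fcps \<times> (nat \<Rightarrow> nat) \<times> (nat \<Rightarrow> val)) measure" where
  "exact_results A \<Omega> \<equiv> restrict_space (big (exact_vals A)) (exact_fib A \<Omega>)"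

abbreviation sample_results :: "sample_ty \<Rightarrow> fcps \<Rightarrow> (fcps \<times> (nat \<Rightarrow> nat) \<times> val) measure" where
  "sample_results \<tau> \<Omega> \<equiv> restrict_space (big (sample_space \<tau>)) (sample_fib \<tau> \<Omega>)"

lemma hom_exts: "f \<in> fcps_hom \<Omega>' \<Omega> \<Longrightarrow> f \<in> exts UNIV"
  by (rule extsI[of _ "fcps_size \<Omega>'"]) (auto simp: fcps_hom_def fcps_carrier_def PiE_iff)

lemma P_return_exact_low:
  "P_return (exact_low_space \<Omega> A) = P_return (exact_results A \<Omega>)"
proof -
  have "sets (exact_low_space \<Omega> A) = sets (exact_results A \<Omega>)"
    unfolding exact_low_space_def exact_fib_def exact_vals_def
    by (rule sets_restrict_big[where T="exts (space (exact_space A))"])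
      (auto simp: restrict_count_space hom_exts fcps_carrier_def intro: extsI)
  then show ?thesis by (intro ext P_return_cong)
qed

lemma P_return_sample_low:
  "P_return (sample_low_space \<Omega> \<tau>) = P_return (sample_results \<tau> \<Omega>)"
proof -
  have "sets (sample_low_space \<Omega> \<tau>) = sets (sample_results \<tau> \<Omega>)"
    unfolding sample_low_space_def sample_fib_def
    by (rule sets_restrict_big[where T=UNIV]) (auto simp: restrict_space_UNIV_sets hom_exts)
  then show ?thesis by (intro ext P_return_cong)
qed

text \<open>The triples at which a low-level semantics is evaluated. Random substitutions form a
  countable set, so only \<open>\<gamma>\<close> and the probabilities of \<Omega> vary
  continuously.\<close>

definition low_ctx :: "sample_ctx \<Rightarrow> exact_ctx \<Rightarrow> (fcps \<times> subst \<times> (nat \<Rightarrow> subst)) measure" where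
  "low_ctx \<Gamma> \<Delta> = restrict_space (fcps_space \<Otimes>\<^sub>M ctx_space \<Gamma> \<Otimes>\<^sub>M count_space (exts (substs \<Delta>)))
     {(\<Omega>, \<gamma>, D). D \<in> fcps_carrier \<Omega> \<rightarrow>\<^sub>E substs \<Delta>}"

lemma in_space_low_ctx:
  "(\<Omega>, \<gamma>, D) \<in> space (low_ctx \<Gamma> \<Delta>) \<longleftrightarrow> is_fcps \<Omega> \<and> \<gamma> \<in> space (ctx_space \<Gamma>) \<and> D \<in> fcps_carrier \<Omega> \<rightarrow>\<^sub>E substs \<Delta>"
  by (auto simp: low_ctx_def space_restrict_space space_pair_measure fcps_carrier_def intro: extsI)

lemma low_ctx_measurable:
  "fst \<in> low_ctx \<Gamma> \<Delta> \<rightarrow>\<^sub>M fcps_space"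
  "(\<lambda>z. fst (snd z)) \<in> low_ctx \<Gamma> \<Delta> \<rightarrow>\<^sub>M ctx_space \<Gamma>"
  "(\<lambda>z. snd (snd z)) \<in> low_ctx \<Gamma> \<Delta> \<rightarrow>\<^sub>M count_space (exts (substs \<Delta>))"
  unfolding low_ctx_def by (auto intro!: measurable_restrict_space1)

lemma low_ctx_measurableI:
  assumes "t \<in> N \<rightarrow>\<^sub>M fcps_space" "g \<in> N \<rightarrow>\<^sub>M ctx_space \<Gamma>" "d \<in> N \<rightarrow>\<^sub>M count_space UNIV"
    and D: "\<And>x. x \<in> space N \<Longrightarrow> d x \<in> fcps_carrier (t x) \<rightarrow>\<^sub>E substs \<Delta>"
  shows "(\<lambda>x. (t x, g x, d x)) \<in> N \<rightarrow>\<^sub>M low_ctx \<Gamma> \<Delta>"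
  unfolding low_ctx_def
proof (intro measurable_restrict_space2 measurable_Pair assms(1,2))
  show "d \<in> N \<rightarrow>\<^sub>M count_space (exts (substs \<Delta>))"
  proof (rule measurable_count_spaceI[OF assms(3)])
    show "d x \<in> exts (substs \<Delta>)" if "x \<in> space N" for x
      using D[OF that] unfolding fcps_carrier_def by (rule extsI)
  qed
qed (use D in auto)

lemma big_measurable:
  "fst \<in> big V \<rightarrow>\<^sub>M fcps_space"
  "(\<lambda>z. fst (snd z)) \<in> big V \<rightarrow>\<^sub>M count_space (exts UNIV)"
  "(\<lambda>z. snd (snd z)) \<in> big V \<rightarrow>\<^sub>M V"
  unfolding big_def by simp_all

lemma big_measurableI:
  assumes "t \<in> N \<rightarrow>\<^sub>M fcps_space" "f \<in> N \<rightarrow>\<^sub>M count_space UNIV" "v \<in> N \<rightarrow>\<^sub>M V"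
    and f: "\<And>x. x \<in> space N \<Longrightarrow> f x \<in> exts UNIV"
  shows "(\<lambda>x. (t x, f x, v x)) \<in> N \<rightarrow>\<^sub>M big V"
  unfolding big_def by (intro measurable_Pair measurable_count_spaceI[OF assms(2) f] assms(1,3))

subsection \<open>Soundness of a low-level against a high-level computation\<close>

text \<open>The value of a low-level result is a random variable on \<open>\<Omega>'\<close> in the exact language and a single
  value in the sampling language; \<open>rd v \<omega>\<close> reads off the value at \<open>\<omega>\<close> in either case. The set
  \<open>fib \<Omega>\<close> contains the well-formed results over \<open>\<Omega>\<close>.\<close>

definition interp ::
    "(fcps \<Rightarrow> (fcps \<times> (nat \<Rightarrow> nat) \<times> 'v) set) \<Rightarrow> 'v measure \<Rightarrow> ('v \<Rightarrow> nat \<Rightarrow> val) \<Rightarrow> val measure \<Rightarrow> bool" where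
  "interp fib V rd T \<longleftrightarrow>
     Measurable.pred (fcps_space \<Otimes>\<^sub>M big V) (\<lambda>z. snd z \<in> fib (fst z)) \<and>
     (\<forall>\<Omega> \<Omega>' f v. (\<Omega>', f, v) \<in> fib \<Omega> \<longrightarrow> is_fcps \<Omega>' \<and> f \<in> fcps_hom \<Omega>' \<Omega>) \<and>
     (\<forall>\<Omega> \<Omega>1 \<Omega>2 f g v. (\<Omega>2, g, v) \<in> fib \<Omega>1 \<longrightarrow> f \<in> fcps_hom \<Omega>1 \<Omega> \<longrightarrow> (\<Omega>2, compose (fcps_carrier \<Omega>2) f g, v) \<in> fib \<Omega>) \<and>
     (\<forall>h \<omega>. h \<in> borel_measurable T \<longrightarrow> (\<lambda>v. h (rd v \<omega>) :: ennreal) \<in> borel_measurable V)"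

lemma interpD:
  assumes "interp fib V rd T"
  shows "(\<Omega>', f, v) \<in> fib \<Omega> \<Longrightarrow> is_fcps \<Omega>'" "(\<Omega>', f, v) \<in> fib \<Omega> \<Longrightarrow> f \<in> fcps_hom \<Omega>' \<Omega>"
    "(\<Omega>2, g, v) \<in> fib \<Omega>1 \<Longrightarrow> f \<in> fcps_hom \<Omega>1 \<Omega> \<Longrightarrow> (\<Omega>2, compose (fcps_carrier \<Omega>2) f g, v) \<in> fib \<Omega>"
    "h \<in> borel_measurable T \<Longrightarrow> (\<lambda>v. h (rd v \<omega>) :: ennreal) \<in> borel_measurable V"
    "t \<in> N \<rightarrow>\<^sub>M fcps_space \<Longrightarrow> p \<in> N \<rightarrow>\<^sub>M big V \<Longrightarrow> Measurable.pred N (\<lambda>x. p x \<in> fib (t x))"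
  using assms measurable_compose[OF measurable_Pair, of t N fcps_space p "big V" "\<lambda>z. snd z \<in> fib (fst z)" "count_space UNIV"]
  unfolding interp_def by (blast, blast, blast, blast, simp)

abbreviation (input) exact_rd :: "(nat \<Rightarrow> val) \<Rightarrow> nat \<Rightarrow> val" where "exact_rd \<equiv> \<lambda>X \<omega>. X \<omega>"
abbreviation (input) sample_rd :: "val \<Rightarrow> nat \<Rightarrow> val" where "sample_rd \<equiv> \<lambda>v _. v"

lemma interp_exact: "interp (exact_fib A) (exact_vals A) exact_rd (exact_space A)"
proof -
  let ?N = "fcps_space \<Otimes>\<^sub>M big (exact_vals A)"
  note m = measurable_compose[OF measurable_snd]
  have [measurable]: "Measurable.pred ?N (\<lambda>z. fst (snd (snd z)) \<in> fcps_hom (fst (snd z)) (fst z))"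
    by (rule fcps_hom_measurable[OF m[OF big_measurable(1)] measurable_fst m[OF big_measurable(2)]])
  have [measurable]: "Measurable.pred ?N (\<lambda>z. snd (snd (snd z)) \<in> fcps_carrier (fst (snd z)) \<rightarrow>\<^sub>E space (exact_space A))"
    unfolding fcps_carrier_def
    by (rule discrete_compose2[OF exact_vals_measurableD[OF m[OF big_measurable(3)]] countable_exts_exact
          measurable_compose[OF m[OF big_measurable(1)] fcps_size_measurable]])
  have "snd z \<in> exact_fib A (fst z) \<longleftrightarrow> fst (snd (snd z)) \<in> fcps_hom (fst (snd z)) (fst z) \<and>
      snd (snd (snd z)) \<in> fcps_carrier (fst (snd z)) \<rightarrow>\<^sub>E space (exact_space A)" if "z \<in> space ?N" for z
    using that by (auto simp: exact_fib_def big_def space_pair_measure)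
  then have "Measurable.pred ?N (\<lambda>z. snd z \<in> exact_fib A (fst z))"
    by (simp cong: measurable_cong)
  then show ?thesis
    unfolding interp_def exact_fib_def exact_vals_def by (auto simp: fcps_hom_compose)
qed

lemma interp_sample: "interp (sample_fib \<tau>) (sample_space \<tau>) sample_rd (sample_space \<tau>)"
proof -
  let ?N = "fcps_space \<Otimes>\<^sub>M big (sample_space \<tau>)"
  note m = measurable_compose[OF measurable_snd]
  have [measurable]: "Measurable.pred ?N (\<lambda>z. fst (snd (snd z)) \<in> fcps_hom (fst (snd z)) (fst z))"
    by (rule fcps_hom_measurable[OF m[OF big_measurable(1)] measurable_fst m[OF big_measurable(2)]])
  have "snd z \<in> sample_fib \<tau> (fst z) \<longleftrightarrow> fst (snd (snd z)) \<in> fcps_hom (fst (snd z)) (fst z)" if "z \<in> space ?N" for z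
    using that by (auto simp: sample_fib_def big_def space_pair_measure)
  then have "Measurable.pred ?N (\<lambda>z. snd z \<in> sample_fib \<tau> (fst z))"
    by (simp cong: measurable_cong)
  then show ?thesis
    unfolding interp_def sample_fib_def by (auto simp: fcps_hom_compose)
qed

definition post :: "('v \<Rightarrow> nat \<Rightarrow> val) \<Rightarrow> (nat \<Rightarrow> val \<Rightarrow> ennreal) \<Rightarrow> fcps \<times> (nat \<Rightarrow> nat) \<times> 'v \<Rightarrow> ennreal" where
  "post rd h p = cint (fst p) (\<lambda>\<omega>. h (fst (snd p) \<omega>) (rd (snd (snd p)) \<omega>))"

text \<open>Values 0 and 1 in \<open>ennreal\<close>: a vanishing weighted integral says that
  results with a null event have weight 0 almost surely.\<close>

definition degenerate :: "fcps \<times> (nat \<Rightarrow> nat) \<times> 'v \<Rightarrow> ennreal" where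
  "degenerate p = (if fcps_pos (fst p) then 0 else 1)"

lemma post_measurable:
  assumes i: "interp fib V rd T" and h: "\<And>\<omega>. h \<omega> \<in> borel_measurable T"
  shows "post rd h \<in> borel_measurable (big V)"
  unfolding post_def
proof (rule cint_measurable[OF big_measurable(1)])
  fix \<omega>
  have "(\<lambda>p. fst (snd p) \<omega>) \<in> big V \<rightarrow>\<^sub>M count_space UNIV"
    by (rule discrete_compose1[OF big_measurable(2)])
  then show "(\<lambda>p. h (fst (snd p) \<omega>) (rd (snd (snd p)) \<omega>)) \<in> borel_measurable (big V)"
    by (rule measurable_compose_countable[rotated, where f="\<lambda>m p. h m (rd (snd (snd p)) \<omega>)"])
      (rule measurable_compose[OF big_measurable(3) interpD(4)[OF i h]])
qed

lemma degenerate_measurable: "degenerate \<in> borel_measurable (big V)"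
proof -
  note [measurable] = fcps_pos_measurable[OF big_measurable(1)]
  show ?thesis unfolding degenerate_def by measurable
qed

text \<open>Abstracting from the shape of values lets conditionals, sequencing and scores be treated
  once for both languages. Kernel measurability belongs to the induction hypothesis because
  sequencing integrates one low-level computation against another.\<close>

definition sound ::
    "sample_ctx \<Rightarrow> exact_ctx \<Rightarrow> (fcps \<Rightarrow> (fcps \<times> (nat \<Rightarrow> nat) \<times> 'v) set) \<Rightarrow> 'v measure \<Rightarrow>
      ('v \<Rightarrow> nat \<Rightarrow> val) \<Rightarrow> val measure \<Rightarrow>
      (fcps \<Rightarrow> subst \<Rightarrow> (nat \<Rightarrow> subst) \<Rightarrow> (real \<times> fcps \<times> (nat \<Rightarrow> nat) \<times> 'v) measure) \<Rightarrow>
      (subst \<Rightarrow> subst \<Rightarrow> (real \<times> val) measure) \<Rightarrow> bool" where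
  "sound \<Gamma> \<Delta> fib V rd T low high \<longleftrightarrow>
     dkernel (low_ctx \<Gamma> \<Delta>) (\<lambda>z. fib (fst z)) (big V) (\<lambda>z. low (fst z) (fst (snd z)) (snd (snd z))) \<and>
     (\<forall>\<Omega> \<gamma> D. (\<Omega>, \<gamma>, D) \<in> space (low_ctx \<Gamma> \<Delta>) \<longrightarrow>
       (\<forall>h. (\<forall>\<omega>. h \<omega> \<in> borel_measurable T) \<longrightarrow>
          wint (low \<Omega> \<gamma> D) (post rd h) = cint \<Omega> (\<lambda>\<omega>. wint (high \<gamma> (D \<omega>)) (h \<omega>))) \<and>
       (fcps_pos \<Omega> \<longrightarrow> wint (low \<Omega> \<gamma> D) degenerate = 0))"

abbreviation exact_sound where
  "exact_sound \<Gamma> \<Delta> A \<equiv> sound \<Gamma> \<Delta> (exact_fib A) (exact_vals A) exact_rd (exact_space A)"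

abbreviation sample_sound where
  "sample_sound \<Gamma> \<Delta> \<tau> \<equiv> sound \<Gamma> \<Delta> (sample_fib \<tau>) (sample_space \<tau>) sample_rd (sample_space \<tau>)"

section \<open>Soundness of conditionals, deterministic steps, sequencing and scores\<close>

lemma soundD:
  assumes "sound \<Gamma> \<Delta> fib V rd T low high"
  shows sound_dkernel: "dkernel (low_ctx \<Gamma> \<Delta>) (\<lambda>z. fib (fst z)) (big V) (\<lambda>z. low (fst z) (fst (snd z)) (snd (snd z)))"
    and sound_post: "(\<Omega>, \<gamma>, D) \<in> space (low_ctx \<Gamma> \<Delta>) \<Longrightarrow> (\<And>\<omega>. h \<omega> \<in> borel_measurable T) \<Longrightarrow>
          wint (low \<Omega> \<gamma> D) (post rd h) = cint \<Omega> (\<lambda>\<omega>. wint (high \<gamma> (D \<omega>)) (h \<omega>))"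
    and sound_degenerate: "(\<Omega>, \<gamma>, D) \<in> space (low_ctx \<Gamma> \<Delta>) \<Longrightarrow> fcps_pos \<Omega> \<Longrightarrow> wint (low \<Omega> \<gamma> D) degenerate = 0"
  using assms unfolding sound_def by blast+

lemma sound_in_space:
  assumes "sound \<Gamma> \<Delta> fib V rd T low high" "(\<Omega>, \<gamma>, D) \<in> space (low_ctx \<Gamma> \<Delta>)"
  shows "low \<Omega> \<gamma> D \<in> space (P_space (restrict_space (big V) (fib \<Omega>)))"
  using dkernel_in_space[OF sound_dkernel[OF assms(1)] assms(2)] by simp

lemma soundI:
  assumes "dkernel (low_ctx \<Gamma> \<Delta>) (\<lambda>z. fib (fst z)) (big V) (\<lambda>z. low (fst z) (fst (snd z)) (snd (snd z)))"
    and "\<And>\<Omega> \<gamma> D h. (\<Omega>, \<gamma>, D) \<in> space (low_ctx \<Gamma> \<Delta>) \<Longrightarrow> (\<And>\<omega>. h \<omega> \<in> borel_measurable T) \<Longrightarrow>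
          wint (low \<Omega> \<gamma> D) (post rd h) = cint \<Omega> (\<lambda>\<omega>. wint (high \<gamma> (D \<omega>)) (h \<omega>))"
    and "\<And>\<Omega> \<gamma> D. (\<Omega>, \<gamma>, D) \<in> space (low_ctx \<Gamma> \<Delta>) \<Longrightarrow> fcps_pos \<Omega> \<Longrightarrow> wint (low \<Omega> \<gamma> D) degenerate = 0"
  shows "sound \<Gamma> \<Delta> fib V rd T low high"
  unfolding sound_def using assms by blast

lemma sound_cong:
  assumes "sound \<Gamma> \<Delta> fib V rd T low high"
    and "\<And>\<Omega> \<gamma> D. low' \<Omega> \<gamma> D = low \<Omega> \<gamma> D" "\<And>\<gamma> \<delta>. high' \<gamma> \<delta> = high \<gamma> \<delta>"
  shows "sound \<Gamma> \<Delta> fib V rd T low' high'"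
proof -
  have "low' = low" "high' = high" using assms(2,3) by (simp_all add: fun_eq_iff)
  with assms(1) show ?thesis by simp
qed

text \<open>The guard depends on \<open>\<gamma>\<close> alone, so all points of the finite space
  take the same branch and the average never mixes branches.\<close>

lemma sound_if:
  assumes e: "sample_pure_typed \<Gamma> e SBoolT"
    and s1: "sound \<Gamma> \<Delta> fib V rd T low1 high1" and s2: "sound \<Gamma> \<Delta> fib V rd T low2 high2"
  shows "sound \<Gamma> \<Delta> fib V rd T
    (\<lambda>\<Omega> \<gamma> D. if the_bool (sample_pure_sem e \<gamma>) then low1 \<Omega> \<gamma> D else low2 \<Omega> \<gamma> D)
    (\<lambda>\<gamma> \<delta>. if the_bool (sample_pure_sem e \<gamma>) then high1 \<gamma> \<delta> else high2 \<gamma> \<delta>)"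
proof (rule soundI)
  show "dkernel (low_ctx \<Gamma> \<Delta>) (\<lambda>z. fib (fst z)) (big V) (\<lambda>z. if the_bool (sample_pure_sem e (fst (snd z)))
      then low1 (fst z) (fst (snd z)) (snd (snd z)) else low2 (fst z) (fst (snd z)) (snd (snd z)))"
    by (rule dkernel_if[OF measurable_compose[OF low_ctx_measurable(2) guard_measurable[OF e]] sound_dkernel[OF s1] sound_dkernel[OF s2]])
qed (simp_all add: soundD[OF s1] soundD[OF s2])

text \<open>Leaving \<open>high\<close> arbitrary covers the two returns and also the exact coin
  flip, whose low-level semantics is a deterministic change of the finite space.\<close>

lemma sound_return:
  assumes i: "interp fib V rd T"
    and t: "(\<lambda>z. t (fst z) (fst (snd z)) (snd (snd z))) \<in> low_ctx \<Gamma> \<Delta> \<rightarrow>\<^sub>M big V"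
    and fib: "\<And>\<Omega> \<gamma> D. (\<Omega>, \<gamma>, D) \<in> space (low_ctx \<Gamma> \<Delta>) \<Longrightarrow> t \<Omega> \<gamma> D \<in> fib \<Omega>"
    and post: "\<And>\<Omega> \<gamma> D h. (\<Omega>, \<gamma>, D) \<in> space (low_ctx \<Gamma> \<Delta>) \<Longrightarrow> (\<And>\<omega>. h \<omega> \<in> borel_measurable T) \<Longrightarrow>
      post rd h (t \<Omega> \<gamma> D) = cint \<Omega> (\<lambda>\<omega>. wint (high \<gamma> (D \<omega>)) (h \<omega>))"
    and pos: "\<And>\<Omega> \<gamma> D. (\<Omega>, \<gamma>, D) \<in> space (low_ctx \<Gamma> \<Delta>) \<Longrightarrow> fcps_pos \<Omega> \<Longrightarrow> fcps_pos (fst (t \<Omega> \<gamma> D))"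
  shows "sound \<Gamma> \<Delta> fib V rd T (\<lambda>\<Omega> \<gamma> D. P_return (restrict_space (big V) (fib \<Omega>)) (t \<Omega> \<gamma> D)) high"
proof (rule soundI)
  show "dkernel (low_ctx \<Gamma> \<Delta>) (\<lambda>z. fib (fst z)) (big V)
      (\<lambda>z. P_return (restrict_space (big V) (fib (fst z))) (t (fst z) (fst (snd z)) (snd (snd z))))"
    by (rule dkernel_return[OF t]) (metis fib prod.collapse)
  fix \<Omega> \<gamma> D assume z: "(\<Omega>, \<gamma>, D) \<in> space (low_ctx \<Gamma> \<Delta>)"
  have w: "wint (P_return (restrict_space (big V) (fib \<Omega>)) (t \<Omega> \<gamma> D)) g = g (t \<Omega> \<gamma> D)"
    if "g \<in> borel_measurable (big V)" for g
    using measurable_space[OF t z] fib[OF z] that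
    by (intro wint_P_return measurable_restrict_space1) (auto simp: space_restrict_space)
  show "wint (P_return (restrict_space (big V) (fib \<Omega>)) (t \<Omega> \<gamma> D)) (post rd h) = cint \<Omega> (\<lambda>\<omega>. wint (high \<gamma> (D \<omega>)) (h \<omega>))"
    if "\<And>\<omega>. h \<omega> \<in> borel_measurable T" for h
    using w[OF post_measurable[OF i that]] post[OF z that] by simp
  show "wint (P_return (restrict_space (big V) (fib \<Omega>)) (t \<Omega> \<gamma> D)) degenerate = 0" if "fcps_pos \<Omega>"
    using w[OF degenerate_measurable] pos[OF z that] by (simp add: degenerate_def)
qed

lemma dkernel_map:
  assumes \<kappa>: "dkernel N S B \<kappa>" and S: "Measurable.pred (N \<Otimes>\<^sub>M B) (\<lambda>z. snd z \<in> S (fst z))"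
    and t: "(\<lambda>z. t (fst z) (snd z)) \<in> N \<Otimes>\<^sub>M B \<rightarrow>\<^sub>M C"
    and T: "\<And>x y. x \<in> space N \<Longrightarrow> y \<in> space B \<Longrightarrow> y \<in> S x \<Longrightarrow> t x y \<in> T x"
  shows "dkernel N T C (\<lambda>x. P_bind (\<kappa> x) (\<lambda>y. P_return (restrict_space C (T x)) (t x y)))"
    and "x \<in> space N \<Longrightarrow> g \<in> borel_measurable C \<Longrightarrow>
      wint (P_bind (\<kappa> x) (\<lambda>y. P_return (restrict_space C (T x)) (t x y))) g = wint (\<kappa> x) (\<lambda>y. g (t x y))"
proof -
  let ?R = "restrict_space (N \<Otimes>\<^sub>M B) {z. snd z \<in> S (fst z)}"
  have \<eta>: "dkernel ?R (\<lambda>z. T (fst z)) C (\<lambda>z. P_return (restrict_space C (T (fst z))) (t (fst z) (snd z)))"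
    using t T by (intro dkernel_return measurable_restrict_space1) (auto simp: space_restrict_space space_pair_measure)
  show "dkernel N T C (\<lambda>x. P_bind (\<kappa> x) (\<lambda>y. P_return (restrict_space C (T x)) (t x y)))"
    by (rule dkernel_bind[OF \<kappa> S \<eta>])
  assume x: "x \<in> space N" and g: "g \<in> borel_measurable C"
  have "wint (P_bind (\<kappa> x) (\<lambda>y. P_return (restrict_space C (T x)) (t x y))) g
      = wint (\<kappa> x) (\<lambda>y. wint (P_return (restrict_space C (T x)) (t x y)) g)"
    by (rule wint_dkernel_bind[OF \<kappa> \<eta> x g])
  also have "\<dots> = wint (\<kappa> x) (\<lambda>y. g (t x y))"
  proof (rule wint_cong[OF dkernel_in_space[OF \<kappa> x]])
    fix y assume "y \<in> space (restrict_space B (S x))"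
    then show "wint (P_return (restrict_space C (T x)) (t x y)) g = g (t x y)"
      using T[OF x, of y] measurable_space[OF t, of "(x, y)"] x g
      by (intro wint_P_return measurable_restrict_space1) (auto simp: space_restrict_space space_pair_measure)
  qed
  finally show "wint (P_bind (\<kappa> x) (\<lambda>y. P_return (restrict_space C (T x)) (t x y))) g = wint (\<kappa> x) (\<lambda>y. g (t x y))" .
qed

text \<open>\<open>cint\<close> is a finite sum with constant coefficients, so it commutes with the
  weighted integral.\<close>

lemma wint_cint:
  assumes \<mu>: "\<mu> \<in> space (P_space T)" and h: "\<And>\<omega>. h \<omega> \<in> borel_measurable T"
  shows "wint \<mu> (\<lambda>x. cint \<Omega> (\<lambda>\<omega>. h \<omega> x)) = cint \<Omega> (\<lambda>\<omega>. wint \<mu> (h \<omega>))"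
  unfolding cint_def using h
  by (subst wint_sum[OF \<mu>]) (auto intro!: sum.cong wint_cmult[OF \<mu>])

text \<open>The parameters cover both forms of sequencing: \<open>g\<close> gives the new sampling
  substitution, \<open>d\<close> the new random exact substitution. By soundness of the second
  computation, its integral is an average over \<open>\<Omega>1\<close> of high-level integrals; by
  \<open>rel\<close> these depend on a point only through the initial point below it and the first
  value there. The average is thus again a \<open>post\<close>, to which soundness of the first
  computation applies.\<close>

lemma sound_let:
  fixes g :: "subst \<Rightarrow> 'v \<Rightarrow> subst" and d :: "fcps \<Rightarrow> (nat \<Rightarrow> subst) \<Rightarrow> (nat \<Rightarrow> nat) \<Rightarrow> 'v \<Rightarrow> nat \<Rightarrow> subst"
    and fib2 :: "fcps \<Rightarrow> (fcps \<times> (nat \<Rightarrow> nat) \<times> 'y) set"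
  assumes i1: "interp fib1 V1 rd1 T1" and s1: "sound \<Gamma> \<Delta> fib1 V1 rd1 T1 low1 high1"
    and i2: "interp fib2 V2 rd2 T2" and s2: "sound \<Gamma>' \<Delta>' fib2 V2 rd2 T2 low2 high2"
    and ctx: "(\<lambda>w. (fst (snd w), g (fst (snd (fst w))) (snd (snd (snd w))),
        d (fst (snd w)) (snd (snd (fst w))) (fst (snd (snd w))) (snd (snd (snd w)))))
      \<in> restrict_space (low_ctx \<Gamma> \<Delta> \<Otimes>\<^sub>M big V1) {w. snd w \<in> fib1 (fst (fst w))} \<rightarrow>\<^sub>M low_ctx \<Gamma>' \<Delta>'"
    and high1: "\<And>\<gamma> \<delta>. \<gamma> \<in> space (ctx_space \<Gamma>) \<Longrightarrow> \<delta> \<in> substs \<Delta> \<Longrightarrow> high1 \<gamma> \<delta> \<in> space (P_space T1)"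
    and k: "\<And>\<gamma> \<delta>. \<gamma> \<in> space (ctx_space \<Gamma>) \<Longrightarrow> \<delta> \<in> substs \<Delta> \<Longrightarrow> k \<gamma> \<delta> \<in> T1 \<rightarrow>\<^sub>M P_space T2"
    and rel: "\<And>\<Omega> \<gamma> D \<Omega>1 f1 v \<omega>. (\<Omega>, \<gamma>, D) \<in> space (low_ctx \<Gamma> \<Delta>) \<Longrightarrow> (\<Omega>1, f1, v) \<in> fib1 \<Omega> \<Longrightarrow>
      \<omega> \<in> fcps_carrier \<Omega>1 \<Longrightarrow> high2 (g \<gamma> v) (d \<Omega>1 D f1 v \<omega>) = k \<gamma> (D (f1 \<omega>)) (rd1 v \<omega>)"
  shows "sound \<Gamma> \<Delta> fib2 V2 rd2 T2
    (\<lambda>\<Omega> \<gamma> D. P_bind (low1 \<Omega> \<gamma> D) (\<lambda>p.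
      P_bind (low2 (fst p) (g \<gamma> (snd (snd p))) (d (fst p) D (fst (snd p)) (snd (snd p)))) (\<lambda>q.
      P_return (restrict_space (big V2) (fib2 \<Omega>)) (fst q, compose (fcps_carrier (fst q)) (fst (snd p)) (fst (snd q)), snd (snd q)))))
    (\<lambda>\<gamma> \<delta>. P_bind (high1 \<gamma> \<delta>) (k \<gamma> \<delta>))"
proof -
  let ?N = "low_ctx \<Gamma> \<Delta>"
  let ?R = "restrict_space (?N \<Otimes>\<^sub>M big V1) {w. snd w \<in> fib1 (fst (fst w))}"
  \<comment> \<open>The initial data and the first result form one parameter \<open>w\<close>, so
    that the second stage is a kernel over the graph of \<open>fib1\<close>.\<close>
  define \<kappa> where "\<kappa> w = low2 (fst (snd w)) (g (fst (snd (fst w))) (snd (snd (snd w))))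
      (d (fst (snd w)) (snd (snd (fst w))) (fst (snd (snd w))) (snd (snd (snd w))))"
    for w :: "(fcps \<times> subst \<times> (nat \<Rightarrow> subst)) \<times> (fcps \<times> (nat \<Rightarrow> nat) \<times> 'v)"
  define t where "t w q = (fst q, compose (fcps_carrier (fst q)) (fst (snd (snd w))) (fst (snd q)), snd (snd q))"
    for w :: "(fcps \<times> subst \<times> (nat \<Rightarrow> subst)) \<times> (fcps \<times> (nat \<Rightarrow> nat) \<times> 'v)" and q :: "fcps \<times> (nat \<Rightarrow> nat) \<times> 'y"
  define \<eta> where "\<eta> z p = P_bind (\<kappa> (z, p)) (\<lambda>q. P_return (restrict_space (big V2) (fib2 (fst z))) (t (z, p) q))" for z p
  have R1: "(\<lambda>w. f (fst (snd w))) \<in> ?R \<rightarrow>\<^sub>M M" if "f \<in> fcps_space \<rightarrow>\<^sub>M M" for f and M :: "'m measure"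
    by (intro measurable_restrict_space1 measurable_compose[OF measurable_snd] measurable_compose[OF big_measurable(1)] that)
  have \<kappa>: "dkernel ?R (\<lambda>w. fib2 (fst (snd w))) (big V2) \<kappa>"
    using dkernel_compose[OF sound_dkernel[OF s2] ctx] by (simp add: \<kappa>_def[abs_def])
  have P2: "Measurable.pred (?R \<Otimes>\<^sub>M big V2) (\<lambda>z. snd z \<in> fib2 (fst (snd (fst z))))"
    by (rule interpD(5)[OF i2 measurable_compose[OF measurable_fst R1[of "\<lambda>x. x"]] measurable_snd]) simp
  have t: "(\<lambda>z. t (fst z) (snd z)) \<in> ?R \<Otimes>\<^sub>M big V2 \<rightarrow>\<^sub>M big V2"
    unfolding t_def
  proof (rule big_measurableI)
    have "(\<lambda>w. fst (snd (snd w))) \<in> ?R \<rightarrow>\<^sub>M count_space (exts UNIV)"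
      by (intro measurable_restrict_space1 measurable_compose[OF measurable_snd big_measurable(2)])
    from discrete_compose3[OF measurable_compose[OF measurable_compose[OF measurable_snd big_measurable(1)] fcps_size_measurable] _
        measurable_compose[OF measurable_fst this] countable_exts_nat measurable_compose[OF measurable_snd big_measurable(2)],
        of "\<lambda>n f g. compose {..<n} f g"]
    show "(\<lambda>z. compose (fcps_carrier (fst (snd z))) (fst (snd (snd (fst z)))) (fst (snd (snd z)))) \<in> ?R \<Otimes>\<^sub>M big V2 \<rightarrow>\<^sub>M count_space UNIV"
      by (simp add: fcps_carrier_def)
    show "compose (fcps_carrier (fst (snd z))) (fst (snd (snd (fst z)))) (fst (snd (snd z))) \<in> exts UNIV" for z
      unfolding compose_def fcps_carrier_def by (rule restrict_exts) simp
  qed (intro measurable_compose[OF measurable_snd] big_measurable)+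
  have T: "t w q \<in> fib2 (fst (fst w))" if "w \<in> space ?R" "q \<in> fib2 (fst (snd w))" for w q
  proof -
    obtain z \<Omega>1 f1 v where w: "w = (z, \<Omega>1, f1, v)" by (metis prod.collapse)
    obtain \<Omega>2 f2 y where q: "q = (\<Omega>2, f2, y)" by (metis prod.collapse)
    show ?thesis
      using that interpD(2)[OF i1, of \<Omega>1 f1 v "fst z"] interpD(3)[OF i2, of \<Omega>2 f2 y \<Omega>1 f1 "fst z"]
      by (simp add: w q t_def space_restrict_space)
  qed
  have \<eta>: "dkernel ?R (\<lambda>w. fib2 (fst (fst w))) (big V2) (\<lambda>w. \<eta> (fst w) (snd w))"
    using dkernel_map(1)[OF \<kappa> P2 t, of "\<lambda>w. fib2 (fst (fst w))"] T by (simp add: \<eta>_def)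
  have wint_\<eta>: "wint (\<eta> z p) G = wint (\<kappa> (z, p)) (\<lambda>q. G (t (z, p) q))"
    if "(z, p) \<in> space ?R" "G \<in> borel_measurable (big V2)" for z p G
    using dkernel_map(2)[where T="\<lambda>w. fib2 (fst (fst w))", OF \<kappa> P2 t _ that] T by (simp add: \<eta>_def)
  have P1: "Measurable.pred (?N \<Otimes>\<^sub>M big V1) (\<lambda>z. snd z \<in> fib1 (fst (fst z)))"
    by (rule interpD(5)[OF i1 measurable_compose[OF measurable_fst low_ctx_measurable(1)] measurable_snd])
  have dk: "dkernel ?N (\<lambda>z. fib2 (fst z)) (big V2) (\<lambda>z. P_bind (low1 (fst z) (fst (snd z)) (snd (snd z))) (\<eta> z))"
    by (rule dkernel_bind[OF sound_dkernel[OF s1] P1 \<eta>])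
  have wint_low: "wint (P_bind (low1 \<Omega> \<gamma> D) (\<eta> (\<Omega>, \<gamma>, D))) G = wint (low1 \<Omega> \<gamma> D) (\<lambda>p. wint (\<kappa> ((\<Omega>, \<gamma>, D), p)) (\<lambda>q. G (t ((\<Omega>, \<gamma>, D), p) q)))"
    if z: "(\<Omega>, \<gamma>, D) \<in> space ?N" and G: "G \<in> borel_measurable (big V2)" for \<Omega> \<gamma> D G
  proof -
    have "wint (P_bind (low1 \<Omega> \<gamma> D) (\<eta> (\<Omega>, \<gamma>, D))) G = wint (low1 \<Omega> \<gamma> D) (\<lambda>p. wint (\<eta> (\<Omega>, \<gamma>, D) p) G)"
      using wint_dkernel_bind[OF sound_dkernel[OF s1] \<eta> z G] by simp
    also have "\<dots> = wint (low1 \<Omega> \<gamma> D) (\<lambda>p. wint (\<kappa> ((\<Omega>, \<gamma>, D), p)) (\<lambda>q. G (t ((\<Omega>, \<gamma>, D), p) q)))"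
      using z G by (intro wint_cong[OF sound_in_space[OF s1 z]] wint_\<eta>)
        (auto simp: space_restrict_space space_pair_measure)
    finally show ?thesis .
  qed
  have in_ctx: "(\<Omega>1, g \<gamma> v, d \<Omega>1 D f1 v) \<in> space (low_ctx \<Gamma>' \<Delta>')"
    if "(\<Omega>, \<gamma>, D) \<in> space ?N" "(\<Omega>1, f1, v) \<in> space (restrict_space (big V1) (fib1 \<Omega>))" for \<Omega> \<gamma> D \<Omega>1 f1 v
    using measurable_space[OF ctx, of "((\<Omega>, \<gamma>, D), \<Omega>1, f1, v)"] that
    by (simp add: space_restrict_space space_pair_measure)
  have "sound \<Gamma> \<Delta> fib2 V2 rd2 T2 (\<lambda>\<Omega> \<gamma> D. P_bind (low1 \<Omega> \<gamma> D) (\<eta> (\<Omega>, \<gamma>, D))) (\<lambda>\<gamma> \<delta>. P_bind (high1 \<gamma> \<delta>) (k \<gamma> \<delta>))"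
  proof (rule soundI)
    show "dkernel ?N (\<lambda>z. fib2 (fst z)) (big V2)
        (\<lambda>z. P_bind (low1 (fst z) (fst (snd z)) (snd (snd z))) (\<eta> (fst z, fst (snd z), snd (snd z))))"
      using dk by simp
  next
    fix \<Omega> \<gamma> D and h :: "nat \<Rightarrow> val \<Rightarrow> ennreal"
    assume z: "(\<Omega>, \<gamma>, D) \<in> space ?N" and h: "\<And>\<omega>. h \<omega> \<in> borel_measurable T2"
    have \<gamma>: "\<gamma> \<in> space (ctx_space \<Gamma>)" and D: "D \<in> fcps_carrier \<Omega> \<rightarrow>\<^sub>E substs \<Delta>"
      using z by (auto simp: in_space_low_ctx)
    \<comment> \<open>The high-level integral of the continuation, as a test function of the initial
      point and the first value. Outside the carrier \<open>D\<close> is undefined; the value 0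
      there keeps \<open>h'\<close> measurable at every point.\<close>
    define h' where "h' \<omega> x = (if \<omega> \<in> fcps_carrier \<Omega> then wint (k \<gamma> (D \<omega>) x) (h \<omega>) else 0)" for \<omega> x
    have h': "h' \<omega> \<in> borel_measurable T1" for \<omega>
    proof (cases "\<omega> \<in> fcps_carrier \<Omega>")
      case True
      have "(\<lambda>x. wint (k \<gamma> (D \<omega>) x) (h \<omega>)) \<in> borel_measurable T1"
        using True D h by (intro measurable_wint[OF k[OF \<gamma>]]) auto
      then show ?thesis using True by (simp add: h'_def[abs_def])
    qed (simp add: h'_def[abs_def])
    have inner: "wint (\<kappa> ((\<Omega>, \<gamma>, D), p)) (\<lambda>q. post rd2 h (t ((\<Omega>, \<gamma>, D), p) q)) = post rd1 h' p"
      if p: "p \<in> space (restrict_space (big V1) (fib1 \<Omega>))" for p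
    proof -
      obtain \<Omega>1 f1 v where p': "p = (\<Omega>1, f1, v)" by (metis prod.collapse)
      have fib: "(\<Omega>1, f1, v) \<in> fib1 \<Omega>" using p by (simp add: p' space_restrict_space)
      have f1: "f1 \<omega> \<in> fcps_carrier \<Omega>" if "\<omega> \<in> fcps_carrier \<Omega>1" for \<omega>
        using fcps_hom_PiE[OF interpD(2)[OF i1 fib]] that by auto
      note c = in_ctx[OF z p[unfolded p']]
      \<comment> \<open>The maps are composed in the final result, so testing over \<Omega> amounts
        to testing over \<open>\<Omega>1\<close> with \<open>h\<close> precomposed with
        \<open>f1\<close>.\<close>
      have *: "post rd2 h (t ((\<Omega>, \<gamma>, D), p) q) = post rd2 (\<lambda>\<omega>. h (f1 \<omega>)) q" for q
        by (auto simp: post_def t_def p' compose_def intro!: cint_cong)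
      have "wint (\<kappa> ((\<Omega>, \<gamma>, D), p)) (\<lambda>q. post rd2 h (t ((\<Omega>, \<gamma>, D), p) q))
          = wint (low2 \<Omega>1 (g \<gamma> v) (d \<Omega>1 D f1 v)) (\<lambda>q. post rd2 (\<lambda>\<omega>. h (f1 \<omega>)) q)"
        unfolding * by (simp add: p' \<kappa>_def)
      also have "\<dots> = cint \<Omega>1 (\<lambda>\<omega>. wint (high2 (g \<gamma> v) (d \<Omega>1 D f1 v \<omega>)) (h (f1 \<omega>)))"
        by (rule sound_post[OF s2 c h])
      also have "\<dots> = cint \<Omega>1 (\<lambda>\<omega>. h' (f1 \<omega>) (rd1 v \<omega>))"
        using f1 rel[OF z fib] by (intro cint_cong) (simp add: h'_def)
      finally show ?thesis by (simp add: post_def p')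
    qed
    have "wint (P_bind (low1 \<Omega> \<gamma> D) (\<eta> (\<Omega>, \<gamma>, D))) (post rd2 h) = wint (low1 \<Omega> \<gamma> D) (post rd1 h')"
      unfolding wint_low[OF z post_measurable[OF i2 h]] by (rule wint_cong[OF sound_in_space[OF s1 z] inner])
    also have "\<dots> = cint \<Omega> (\<lambda>\<omega>. wint (high1 \<gamma> (D \<omega>)) (h' \<omega>))"
      by (rule sound_post[OF s1 z h'])
    also have "\<dots> = cint \<Omega> (\<lambda>\<omega>. wint (P_bind (high1 \<gamma> (D \<omega>)) (k \<gamma> (D \<omega>))) (h \<omega>))"
    proof (rule cint_cong)
      fix \<omega> assume \<omega>: "\<omega> \<in> fcps_carrier \<Omega>"
      then have "D \<omega> \<in> substs \<Delta>" using D by auto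
      from wint_P_bind[OF high1[OF \<gamma> this] k[OF \<gamma> this] h] \<omega>
      show "wint (high1 \<gamma> (D \<omega>)) (h' \<omega>) = wint (P_bind (high1 \<gamma> (D \<omega>)) (k \<gamma> (D \<omega>))) (h \<omega>)"
        by (simp add: h'_def[abs_def])
    qed
    finally show "wint (P_bind (low1 \<Omega> \<gamma> D) (\<eta> (\<Omega>, \<gamma>, D))) (post rd2 h)
        = cint \<Omega> (\<lambda>\<omega>. wint (P_bind (high1 \<gamma> (D \<omega>)) (k \<gamma> (D \<omega>))) (h \<omega>))" .
  next
    fix \<Omega> \<gamma> D assume z: "(\<Omega>, \<gamma>, D) \<in> space ?N" and pos: "fcps_pos \<Omega>"
    \<comment> \<open>After a nondegenerate first result, the second stage yields degenerate results
      only with weight 0. After a degenerate one the bound is infinite, which is harmless: such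
      results carry no weight, and \<open>\<top> * 0 = 0\<close>.\<close>
    have "wint (\<kappa> ((\<Omega>, \<gamma>, D), p)) (\<lambda>q. degenerate (t ((\<Omega>, \<gamma>, D), p) q)) \<le> \<top> * degenerate p"
      if p: "p \<in> space (restrict_space (big V1) (fib1 \<Omega>))" for p
    proof -
      obtain \<Omega>1 f1 v where p': "p = (\<Omega>1, f1, v)" by (metis prod.collapse)
      have "wint (\<kappa> ((\<Omega>, \<gamma>, D), p)) (\<lambda>q. degenerate (t ((\<Omega>, \<gamma>, D), p) q)) = wint (low2 \<Omega>1 (g \<gamma> v) (d \<Omega>1 D f1 v)) degenerate"
        by (simp add: p' \<kappa>_def t_def degenerate_def[abs_def])
      then show ?thesis
        using sound_degenerate[OF s2 in_ctx[OF z p[unfolded p']]] by (simp add: p' degenerate_def)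
    qed
    then have "wint (P_bind (low1 \<Omega> \<gamma> D) (\<eta> (\<Omega>, \<gamma>, D))) degenerate \<le> wint (low1 \<Omega> \<gamma> D) (\<lambda>p. \<top> * degenerate p)"
      unfolding wint_low[OF z degenerate_measurable] by (rule wint_mono[OF sound_in_space[OF s1 z]])
    also have "\<dots> = \<top> * wint (low1 \<Omega> \<gamma> D) degenerate"
      by (rule wint_cmult[OF sound_in_space[OF s1 z] measurable_restrict_space1[OF degenerate_measurable]])
    also have "\<dots> = 0"
      by (simp add: sound_degenerate[OF s1 z pos])
    finally show "wint (P_bind (low1 \<Omega> \<gamma> D) (\<eta> (\<Omega>, \<gamma>, D))) degenerate = 0" by simp
  qed
  then show ?thesis by (simp add: \<eta>_def[abs_def] \<kappa>_def t_def)
qed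

text \<open>A deterministic score multiplies every weighted integral by \<open>w\<close>. The step
  may turn the event null only where \<open>w\<close> is 0, as with an observation of conditional
  probability 0.\<close>

lemma sound_score:
  assumes i: "interp fib V rd T"
    and w: "(\<lambda>z. w (fst z) (fst (snd z)) (snd (snd z))) \<in> borel_measurable (low_ctx \<Gamma> \<Delta>)"
    and nonneg: "\<And>\<Omega> \<gamma> D. 0 \<le> w \<Omega> \<gamma> D"
    and t: "(\<lambda>z. t (fst z) (fst (snd z)) (snd (snd z))) \<in> low_ctx \<Gamma> \<Delta> \<rightarrow>\<^sub>M big V"
    and fib: "\<And>\<Omega> \<gamma> D. (\<Omega>, \<gamma>, D) \<in> space (low_ctx \<Gamma> \<Delta>) \<Longrightarrow> t \<Omega> \<gamma> D \<in> fib \<Omega>"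
    and post: "\<And>\<Omega> \<gamma> D h. (\<Omega>, \<gamma>, D) \<in> space (low_ctx \<Gamma> \<Delta>) \<Longrightarrow> (\<And>\<omega>. h \<omega> \<in> borel_measurable T) \<Longrightarrow>
      ennreal (w \<Omega> \<gamma> D) * post rd h (t \<Omega> \<gamma> D) = cint \<Omega> (\<lambda>\<omega>. wint (high \<gamma> (D \<omega>)) (h \<omega>))"
    and pos: "\<And>\<Omega> \<gamma> D. (\<Omega>, \<gamma>, D) \<in> space (low_ctx \<Gamma> \<Delta>) \<Longrightarrow> fcps_pos \<Omega> \<Longrightarrow> w \<Omega> \<gamma> D = 0 \<or> fcps_pos (fst (t \<Omega> \<gamma> D))"
  shows "sound \<Gamma> \<Delta> fib V rd T
    (\<lambda>\<Omega> \<gamma> D. P_bind (score (w \<Omega> \<gamma> D)) (\<lambda>_. P_return (restrict_space (big V) (fib \<Omega>)) (t \<Omega> \<gamma> D))) high"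
proof -
  let ?N = "low_ctx \<Gamma> \<Delta>"
  let ?w = "\<lambda>z. w (fst z) (fst (snd z)) (snd (snd z))"
  let ?t = "\<lambda>z. t (fst z) (fst (snd z)) (snd (snd z))"
  have \<kappa>: "dkernel ?N (\<lambda>_. UNIV) (count_space {VUnit}) (\<lambda>z. score (?w z))"
    unfolding dkernel_UNIV using w nonneg by (rule score_measurable)
  have t': "(\<lambda>z. ?t (fst z)) \<in> ?N \<Otimes>\<^sub>M count_space {VUnit} \<rightarrow>\<^sub>M big V"
    by (rule measurable_compose[OF measurable_fst t])
  have T: "?t z \<in> fib (fst z)" if "z \<in> space ?N" for z
    using fib[of "fst z" "fst (snd z)" "snd (snd z)"] that by simp
  note map = dkernel_map[OF \<kappa> _ t', of "\<lambda>z. fib (fst z)"]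
  have wint: "wint (P_bind (score (w \<Omega> \<gamma> D)) (\<lambda>_. P_return (restrict_space (big V) (fib \<Omega>)) (t \<Omega> \<gamma> D))) G
      = ennreal (w \<Omega> \<gamma> D) * G (t \<Omega> \<gamma> D)"
    if "(\<Omega>, \<gamma>, D) \<in> space ?N" "G \<in> borel_measurable (big V)" for \<Omega> \<gamma> D G
    using map(2)[of "(\<Omega>, \<gamma>, D)" G] that T by (simp add: wint_score nonneg)
  show ?thesis
  proof (rule soundI)
    show "dkernel ?N (\<lambda>z. fib (fst z)) (big V) (\<lambda>z. P_bind (score (?w z)) (\<lambda>_. P_return (restrict_space (big V) (fib (fst z))) (?t z)))"
      using map(1) T by simp
  next
    fix \<Omega> \<gamma> D assume z: "(\<Omega>, \<gamma>, D) \<in> space ?N" "fcps_pos \<Omega>"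
    show "wint (P_bind (score (w \<Omega> \<gamma> D)) (\<lambda>_. P_return (restrict_space (big V) (fib \<Omega>)) (t \<Omega> \<gamma> D))) degenerate = 0"
      using wint[OF z(1) degenerate_measurable] pos[OF z] by (auto simp: degenerate_def)
  qed (simp add: wint post_measurable[OF i] post)
qed

section \<open>The two boundaries\<close>

lemma sound_exact_boundary:
  assumes s: "sample_sound \<Gamma> \<Delta> \<tau> low high"
    and conv: "convertible A \<tau>"
  shows "exact_sound \<Gamma> \<Delta> A
    (\<lambda>\<Omega> \<gamma> D. P_bind (low \<Omega> \<gamma> D) (\<lambda>p. P_return (exact_results A \<Omega>)
       (fst p, fst (snd p), \<lambda>_ \<in> fcps_carrier (fst p). snd (snd p)))) high"
proof -
  let ?N = "low_ctx \<Gamma> \<Delta>"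
  define t where "t p = (fst p, fst (snd p), \<lambda>_ \<in> fcps_carrier (fst p). snd (snd p))"
    for p :: "fcps \<times> (nat \<Rightarrow> nat) \<times> val"
  note sp = convertible_space[OF conv]
  have P: "Measurable.pred (?N \<Otimes>\<^sub>M big (sample_space \<tau>)) (\<lambda>z. snd z \<in> sample_fib \<tau> (fst (fst z)))"
    by (rule interpD(5)[OF interp_sample measurable_compose[OF measurable_fst low_ctx_measurable(1)] measurable_snd])
  have t: "t \<in> big (sample_space \<tau>) \<rightarrow>\<^sub>M big (exact_vals A)"
    unfolding t_def
  proof (rule big_measurableI[OF big_measurable(1) measurable_count_spaceD[OF big_measurable(2)]])
    have "(\<lambda>p. snd (snd p)) \<in> big (sample_space \<tau>) \<rightarrow>\<^sub>M exact_space A"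
      unfolding sp by (rule big_measurable)
    then have v: "(\<lambda>p. snd (snd p)) \<in> big (sample_space \<tau>) \<rightarrow>\<^sub>M count_space (space (exact_space A))"
      unfolding measurable_exact_space2 .
    from discrete_compose2[OF measurable_compose[OF big_measurable(1) fcps_size_measurable] _ v, of "\<lambda>n v. \<lambda>_ \<in> {..<n}. v"]
    have "(\<lambda>p. \<lambda>_ \<in> fcps_carrier (fst p). snd (snd p)) \<in> big (sample_space \<tau>) \<rightarrow>\<^sub>M count_space UNIV"
      by (simp add: fcps_carrier_def)
    then show "(\<lambda>p. \<lambda>_ \<in> fcps_carrier (fst p). snd (snd p)) \<in> big (sample_space \<tau>) \<rightarrow>\<^sub>M exact_vals A"
      unfolding exact_vals_def
      by (rule measurable_count_spaceI) (use measurable_space[OF v] in \<open>auto simp: fcps_carrier_def intro: restrict_exts\<close>)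
    show "fst (snd p) \<in> exts UNIV" if "p \<in> space (big (sample_space \<tau>))" for p
      using measurable_space[OF big_measurable(2) that] by simp
  qed
  have T: "t p \<in> exact_fib A \<Omega>" if "p \<in> sample_fib \<tau> \<Omega>" for \<Omega> p
    using that by (auto simp: t_def sample_fib_def exact_fib_def sp)
  note map = dkernel_map[OF sound_dkernel[OF s] P measurable_compose[OF measurable_snd t], of "\<lambda>z. exact_fib A (fst z)"]
  have wint: "wint (P_bind (low \<Omega> \<gamma> D) (\<lambda>p. P_return (exact_results A \<Omega>) (t p))) G
      = wint (low \<Omega> \<gamma> D) (\<lambda>p. G (t p))"
    if "(\<Omega>, \<gamma>, D) \<in> space ?N" "G \<in> borel_measurable (big (exact_vals A))" for \<Omega> \<gamma> D G
    using map(2)[of "(\<Omega>, \<gamma>, D)" G] that T by simp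
  \<comment> \<open>A constant random variable reads as the sampled value at every point, so the
    test of the result is unchanged.\<close>
  have post: "post exact_rd h (t p) = post sample_rd h p" for h p
    by (auto simp: post_def t_def intro!: cint_cong)
  have deg: "degenerate (t p) = degenerate p" for p
    by (simp add: degenerate_def t_def)
  have "exact_sound \<Gamma> \<Delta> A
      (\<lambda>\<Omega> \<gamma> D. P_bind (low \<Omega> \<gamma> D) (\<lambda>p. P_return (exact_results A \<Omega>) (t p))) high"
  proof (rule soundI)
    show "dkernel ?N (\<lambda>z. exact_fib A (fst z)) (big (exact_vals A)) (\<lambda>z. P_bind (low (fst z) (fst (snd z)) (snd (snd z)))
        (\<lambda>p. P_return (exact_results A (fst z)) (t p)))"
      using map(1) T by simp
  qed (simp_all add: wint post_measurable[OF interp_exact] degenerate_measurable post deg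
      sound_post[OF s] sound_degenerate[OF s] sp)
  then show ?thesis by (simp only: t_def)
qed

text \<open>The value is read off at a point drawn from the conditional distribution, and the event
  shrinks to the fibre of that value, which keeps later exact computations consistent with what has
  been revealed. Averaging over the fibre and then over the drawn points restores the original
  average, by \<open>cint_fibres\<close>.\<close>

lemma sound_sample_boundary:
  assumes s: "exact_sound \<Gamma> \<Delta> A low high"
    and conv: "convertible A \<tau>"
  shows "sample_sound \<Gamma> \<Delta> \<tau>
    (\<lambda>\<Omega> \<gamma> D. P_bind (low \<Omega> \<gamma> D) (\<lambda>p.
       P_bind (P_bind (fcps_cond (fst p)) (\<lambda>\<omega>'. P_return (exact_space A) (snd (snd p) \<omega>'))) (\<lambda>x.
       P_return (sample_results \<tau> \<Omega>)
         (fcps_restrict (fst p) {\<omega>' \<in> fcps_carrier (fst p). snd (snd p) \<omega>' = x}, fst (snd p), x)))) high"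
proof -
  let ?N = "low_ctx \<Gamma> \<Delta>" and ?V = "exact_vals A" and ?T = "exact_space A"
  let ?R = "restrict_space (?N \<Otimes>\<^sub>M big ?V) {w. snd w \<in> exact_fib A (fst (fst w))}"
  note sp = convertible_space[OF conv]
  define \<kappa> where "\<kappa> w = P_bind (fcps_cond (fst (snd w))) (\<lambda>\<omega>'. P_return ?T (snd (snd (snd w)) \<omega>'))"
    for w :: "(fcps \<times> subst \<times> (nat \<Rightarrow> subst)) \<times> (fcps \<times> (nat \<Rightarrow> nat) \<times> (nat \<Rightarrow> val))"
  define t where "t w x = (fcps_restrict (fst (snd w)) {\<omega>' \<in> fcps_carrier (fst (snd w)). snd (snd (snd w)) \<omega>' = x}, fst (snd (snd w)), x)"
    for w :: "(fcps \<times> subst \<times> (nat \<Rightarrow> subst)) \<times> (fcps \<times> (nat \<Rightarrow> nat) \<times> (nat \<Rightarrow> val))" and x :: val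
  define \<eta> where "\<eta> z p = P_bind (\<kappa> (z, p)) (\<lambda>x. P_return (restrict_space (big ?T) (sample_fib \<tau> (fst z))) (t (z, p) x))" for z p
  have R: "(\<lambda>w. f (snd w)) \<in> ?R \<rightarrow>\<^sub>M M" if "f \<in> big ?V \<rightarrow>\<^sub>M M" for f and M :: "'m measure"
    by (intro measurable_restrict_space1 measurable_compose[OF measurable_snd] that)
  note R_X = exact_vals_measurableD[OF R[OF big_measurable(3)]]
  have X: "snd (snd (snd w)) \<in> fcps_carrier (fst (snd w)) \<rightarrow>\<^sub>E space ?T" if "w \<in> space ?R" for w
    using that by (auto simp: space_restrict_space exact_fib_def)
  have \<kappa>: "dkernel ?R (\<lambda>_. UNIV) ?T \<kappa>"
    unfolding dkernel_UNIV \<kappa>_def by (rule cond_value_measurable[OF R[OF big_measurable(1)] R_X X])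
  have wint_\<kappa>: "wint (\<kappa> w) g = cint (fst (snd w)) (\<lambda>\<omega>. g (snd (snd (snd w)) \<omega>))"
    if "w \<in> space ?R" for w g
    unfolding \<kappa>_def
    by (rule wint_cond_value[OF R[OF big_measurable(1)] R_X X that]) (auto simp: measurable_exact_space1)
  have t: "(\<lambda>z. t (fst z) (snd z)) \<in> ?R \<Otimes>\<^sub>M ?T \<rightarrow>\<^sub>M big ?T"
    unfolding t_def
  proof (rule big_measurableI[OF fcps_restrict_measurable])
    note f = measurable_compose[OF measurable_fst]
    have snd: "snd \<in> ?R \<Otimes>\<^sub>M ?T \<rightarrow>\<^sub>M count_space (space ?T)"
      unfolding measurable_exact_space2[symmetric] by simp
    show "(\<lambda>z. fst (snd (fst z))) \<in> ?R \<Otimes>\<^sub>M ?T \<rightarrow>\<^sub>M fcps_space"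
      by (rule f[OF R[OF big_measurable(1)]])
    from discrete_compose3[OF f[OF measurable_compose[OF R[OF big_measurable(1)] fcps_size_measurable]] _
        f[OF R_X] countable_exts_exact snd, of "\<lambda>n X x. {\<omega>' \<in> {..<n}. X \<omega>' = x}"]
    show "(\<lambda>z. {\<omega>' \<in> fcps_carrier (fst (snd (fst z))). snd (snd (snd (fst z))) \<omega>' = snd z}) \<in> ?R \<Otimes>\<^sub>M ?T \<rightarrow>\<^sub>M count_space UNIV"
      by (simp add: fcps_carrier_def)
    show "(\<lambda>z. fst (snd (snd (fst z)))) \<in> ?R \<Otimes>\<^sub>M ?T \<rightarrow>\<^sub>M count_space UNIV"
      by (rule measurable_count_spaceD[OF f[OF R[OF big_measurable(2)]]])
    show "fst (snd (snd (fst z))) \<in> exts UNIV" if "z \<in> space (?R \<Otimes>\<^sub>M ?T)" for z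
      using measurable_space[OF f[OF R[OF big_measurable(2)]] that] by simp
  qed simp
  have T: "t w x \<in> sample_fib \<tau> (fst (fst w))" if "w \<in> space ?R" "x \<in> space ?T" for w x
    using that by (auto simp: t_def exact_fib_def sample_fib_def sp space_restrict_space is_fcps_restrict fcps_hom_restrict)
  note map = dkernel_map[OF \<kappa> _ t, of "\<lambda>w. sample_fib \<tau> (fst (fst w))"]
  have \<eta>: "dkernel ?R (\<lambda>w. sample_fib \<tau> (fst (fst w))) (big ?T) (\<lambda>w. \<eta> (fst w) (snd w))"
    using map(1) T by (simp add: \<eta>_def)
  have wint_\<eta>: "wint (\<eta> z p) G = wint (\<kappa> (z, p)) (\<lambda>x. G (t (z, p) x))"
    if "(z, p) \<in> space ?R" "G \<in> borel_measurable (big ?T)" for z p G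
    using map(2)[OF _ _ that] T by (simp add: \<eta>_def)
  have P: "Measurable.pred (?N \<Otimes>\<^sub>M big ?V) (\<lambda>z. snd z \<in> exact_fib A (fst (fst z)))"
    by (rule interpD(5)[OF interp_exact measurable_compose[OF measurable_fst low_ctx_measurable(1)] measurable_snd])
  have dk: "dkernel ?N (\<lambda>z. sample_fib \<tau> (fst z)) (big ?T) (\<lambda>z. P_bind (low (fst z) (fst (snd z)) (snd (snd z))) (\<eta> z))"
    by (rule dkernel_bind[OF sound_dkernel[OF s] P \<eta>])
  \<comment> \<open>One reduction serves both invariants: \<open>G\<close> will be the test of the
    result or its degeneracy, and \<open>G'\<close> is the average of \<open>G\<close> over the
    drawn points.\<close>
  have wint: "wint (P_bind (low \<Omega> \<gamma> D) (\<eta> (\<Omega>, \<gamma>, D))) G = wint (low \<Omega> \<gamma> D) G'"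
    if z: "(\<Omega>, \<gamma>, D) \<in> space ?N" and G: "G \<in> borel_measurable (big ?T)"
      and G': "\<And>\<Omega>' f X. is_fcps \<Omega>' \<Longrightarrow> cint \<Omega>' (\<lambda>\<omega>. G (fcps_restrict \<Omega>' {\<omega>' \<in> fcps_carrier \<Omega>'. X \<omega>' = X \<omega>}, f, X \<omega>)) = G' (\<Omega>', f, X)"
    for \<Omega> \<gamma> D G G'
  proof -
    have "wint (P_bind (low \<Omega> \<gamma> D) (\<eta> (\<Omega>, \<gamma>, D))) G = wint (low \<Omega> \<gamma> D) (\<lambda>p. wint (\<eta> (\<Omega>, \<gamma>, D) p) G)"
      using wint_dkernel_bind[OF sound_dkernel[OF s] \<eta> z G] by simp
    also have "\<dots> = wint (low \<Omega> \<gamma> D) G'"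
    proof (rule wint_cong[OF sound_in_space[OF s z]])
      fix p assume p: "p \<in> space (restrict_space (big ?V) (exact_fib A \<Omega>))"
      then have R: "((\<Omega>, \<gamma>, D), p) \<in> space ?R"
        using z by (auto simp: space_restrict_space space_pair_measure)
      obtain \<Omega>' f X where p': "p = (\<Omega>', f, X)" by (metis prod.collapse)
      have "is_fcps \<Omega>'" using p by (auto simp: p' space_restrict_space exact_fib_def)
      from G'[OF this] show "wint (\<eta> (\<Omega>, \<gamma>, D) p) G = G' p"
        unfolding wint_\<eta>[OF R G] wint_\<kappa>[OF R] by (simp add: p' t_def)
    qed
    finally show ?thesis .
  qed
  have "sample_sound \<Gamma> \<Delta> \<tau> (\<lambda>\<Omega> \<gamma> D. P_bind (low \<Omega> \<gamma> D) (\<eta> (\<Omega>, \<gamma>, D))) high"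
  proof (rule soundI)
    show "dkernel ?N (\<lambda>z. sample_fib \<tau> (fst z)) (big (sample_space \<tau>))
        (\<lambda>z. P_bind (low (fst z) (fst (snd z)) (snd (snd z))) (\<eta> (fst z, fst (snd z), snd (snd z))))"
      using dk by (simp add: sp)
  next
    fix \<Omega> \<gamma> D and h :: "nat \<Rightarrow> val \<Rightarrow> ennreal"
    assume z: "(\<Omega>, \<gamma>, D) \<in> space ?N" and h: "\<And>\<omega>. h \<omega> \<in> borel_measurable (sample_space \<tau>)"
    have "wint (P_bind (low \<Omega> \<gamma> D) (\<eta> (\<Omega>, \<gamma>, D))) (post sample_rd h) = wint (low \<Omega> \<gamma> D) (post exact_rd h)"
    proof (rule wint[OF z])
      show "post sample_rd h \<in> borel_measurable (big ?T)"
        unfolding sp by (rule post_measurable[OF interp_sample h])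
      show "cint \<Omega>' (\<lambda>\<omega>. post sample_rd h (fcps_restrict \<Omega>' {\<omega>' \<in> fcps_carrier \<Omega>'. X \<omega>' = X \<omega>}, f, X \<omega>)) = post exact_rd h (\<Omega>', f, X)"
        for \<Omega>' f X
        using cint_fibres[of \<Omega>' X "\<lambda>x \<omega>. h (f \<omega>) x"] by (simp add: post_def)
    qed
    also have "\<dots> = cint \<Omega> (\<lambda>\<omega>. wint (high \<gamma> (D \<omega>)) (h \<omega>))"
      using h by (intro sound_post[OF s z]) (simp add: sp)
    finally show "wint (P_bind (low \<Omega> \<gamma> D) (\<eta> (\<Omega>, \<gamma>, D))) (post sample_rd h) = cint \<Omega> (\<lambda>\<omega>. wint (high \<gamma> (D \<omega>)) (h \<omega>))" .
  next
    fix \<Omega> \<gamma> D assume z: "(\<Omega>, \<gamma>, D) \<in> space ?N"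
    have "wint (P_bind (low \<Omega> \<gamma> D) (\<eta> (\<Omega>, \<gamma>, D))) degenerate = wint (low \<Omega> \<gamma> D) (\<lambda>_. 0)"
    proof (rule wint[OF z degenerate_measurable])
      fix \<Omega>' f and X :: "nat \<Rightarrow> val" assume "is_fcps \<Omega>'"
      \<comment> \<open>A point of positive conditional probability lies in the fibre of its own
        value, so the shrunken event is not null. All other points contribute nothing to the
        average.\<close>
      have "ennreal (fcps_cond_prob \<Omega>' {\<omega>}) * degenerate (fcps_restrict \<Omega>' {\<omega>' \<in> fcps_carrier \<Omega>'. X \<omega>' = X \<omega>}, f, X \<omega>) = 0"
        if \<omega>: "\<omega> \<in> fcps_carrier \<Omega>'" for \<omega>
      proof (cases "fcps_cond_prob \<Omega>' {\<omega>} = 0")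
        case False
        then have pos: "fcps_pos \<Omega>'" by (auto simp: fcps_cond_prob_def fcps_pos_def split: if_splits)
        have "fcps_cond_prob \<Omega>' {\<omega>} \<le> fcps_cond_prob \<Omega>' {\<omega>' \<in> fcps_carrier \<Omega>'. X \<omega>' = X \<omega>}"
          unfolding fcps_cond_prob_def fcps_prob_def using \<omega>
          by (auto intro!: divide_right_mono measure_pmf.finite_measure_mono)
        moreover have "0 < fcps_cond_prob \<Omega>' {\<omega>}"
          using False fcps_cond_prob_nonneg[of \<Omega>' "{\<omega>}"] by simp
        ultimately show ?thesis
          using fcps_pos_restrict[OF pos] by (simp add: degenerate_def)
      qed simp
      then show "cint \<Omega>' (\<lambda>\<omega>. degenerate (fcps_restrict \<Omega>' {\<omega>' \<in> fcps_carrier \<Omega>'. X \<omega>' = X \<omega>}, f, X \<omega>)) = 0"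
        unfolding cint_def by (intro sum.neutral ballI)
    qed
    then show "wint (P_bind (low \<Omega> \<gamma> D) (\<eta> (\<Omega>, \<gamma>, D))) degenerate = 0" by simp
  qed
  then show ?thesis by (simp add: \<eta>_def[abs_def] \<kappa>_def t_def sp)
qed

section \<open>Primitive terms of both languages\<close>

lemma fcps_id_measurable:
  "t \<in> N \<rightarrow>\<^sub>M fcps_space \<Longrightarrow> (\<lambda>x. fcps_id (t x)) \<in> N \<rightarrow>\<^sub>M count_space UNIV"
  unfolding fcps_id_def fcps_carrier_def
  by (rule discrete_compose1[OF measurable_compose[OF _ fcps_size_measurable]])

lemma fcps_id_exts: "fcps_id \<Omega> \<in> exts UNIV"
  unfolding fcps_id_def fcps_carrier_def by (rule restrict_exts) simp

text \<open>The drawn value does not depend on the point of \<Omega>, so averaging over points and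
  integrating over values can be exchanged.\<close>

lemma sound_dist:
  assumes d: "dist_typed \<Gamma> d \<tau>"
  shows "sample_sound \<Gamma> \<Delta> \<tau>
    (\<lambda>\<Omega> \<gamma> D. P_bind (P_lift (dist_sem d \<gamma>)) (\<lambda>x.
       P_return (sample_results \<tau> \<Omega>) (\<Omega>, fcps_id \<Omega>, x)))
    (\<lambda>\<gamma> \<delta>. P_lift (dist_sem d \<gamma>))"
proof -
  let ?N = "low_ctx \<Gamma> \<Delta>" and ?T = "sample_space \<tau>"
  note lift = P_lift_measurable[OF dist_sem_measurable[OF d]]
  have \<kappa>: "dkernel ?N (\<lambda>_. UNIV) ?T (\<lambda>z. P_lift (dist_sem d (fst (snd z))))"
    unfolding dkernel_UNIV by (rule measurable_compose[OF low_ctx_measurable(2) lift])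
  have t: "(\<lambda>z. (fst (fst z), fcps_id (fst (fst z)), snd z)) \<in> ?N \<Otimes>\<^sub>M ?T \<rightarrow>\<^sub>M big ?T"
    by (intro big_measurableI fcps_id_measurable measurable_compose[OF measurable_fst low_ctx_measurable(1)] fcps_id_exts) simp
  have T: "(fst z, fcps_id (fst z), x) \<in> sample_fib \<tau> (fst z)" if "z \<in> space ?N" "x \<in> space ?T" for z x
    using that in_space_low_ctx[of "fst z" "fst (snd z)" "snd (snd z)" \<Gamma> \<Delta>] by (simp add: sample_fib_def fcps_id_hom)
  note map = dkernel_map[OF \<kappa> _ t, of "\<lambda>z. sample_fib \<tau> (fst z)"]
  have wint: "wint (P_bind (P_lift (dist_sem d \<gamma>)) (\<lambda>x. P_return (restrict_space (big ?T) (sample_fib \<tau> \<Omega>)) (\<Omega>, fcps_id \<Omega>, x))) G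
      = wint (P_lift (dist_sem d \<gamma>)) (\<lambda>x. G (\<Omega>, fcps_id \<Omega>, x))"
    if "(\<Omega>, \<gamma>, D) \<in> space ?N" "G \<in> borel_measurable (big ?T)" for \<Omega> \<gamma> D G
    using map(2)[of "(\<Omega>, \<gamma>, D)" G] that T by simp
  show ?thesis
  proof (rule soundI)
    show "dkernel ?N (\<lambda>z. sample_fib \<tau> (fst z)) (big ?T) (\<lambda>z. P_bind (P_lift (dist_sem d (fst (snd z)))) (\<lambda>x.
       P_return (restrict_space (big ?T) (sample_fib \<tau> (fst z))) (fst z, fcps_id (fst z), x)))"
      using map(1) T by simp
  next
    fix \<Omega> \<gamma> D and h :: "nat \<Rightarrow> val \<Rightarrow> ennreal"
    assume z: "(\<Omega>, \<gamma>, D) \<in> space ?N" and h: "\<And>\<omega>. h \<omega> \<in> borel_measurable ?T"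
    have \<mu>: "P_lift (dist_sem d \<gamma>) \<in> space (P_space ?T)"
      using z by (intro measurable_space[OF lift]) (simp add: in_space_low_ctx)
    have "post sample_rd h (\<Omega>, fcps_id \<Omega>, x) = cint \<Omega> (\<lambda>\<omega>. h \<omega> x)" for x
      unfolding post_def by (auto simp: fcps_id_def intro!: cint_cong)
    then show "wint (P_bind (P_lift (dist_sem d \<gamma>)) (\<lambda>x. P_return (restrict_space (big ?T) (sample_fib \<tau> \<Omega>)) (\<Omega>, fcps_id \<Omega>, x))) (post sample_rd h)
        = cint \<Omega> (\<lambda>\<omega>. wint (P_lift (dist_sem d \<gamma>)) (h \<omega>))"
      using wint_cint[OF \<mu> h] by (simp add: wint[OF z post_measurable[OF interp_sample h]])
  next
    fix \<Omega> \<gamma> D assume "(\<Omega>, \<gamma>, D) \<in> space ?N" "fcps_pos \<Omega>"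
    then show "wint (P_bind (P_lift (dist_sem d \<gamma>)) (\<lambda>x. P_return (restrict_space (big ?T) (sample_fib \<tau> \<Omega>)) (\<Omega>, fcps_id \<Omega>, x))) degenerate = 0"
      by (simp add: wint degenerate_measurable degenerate_def)
  qed
qed

lemma low_ctx_D:
  assumes "(\<Omega>, \<gamma>, D) \<in> space (low_ctx \<Gamma> \<Delta>)"
  shows "is_fcps \<Omega>" "\<gamma> \<in> space (ctx_space \<Gamma>)" "\<And>\<omega>. \<omega> \<in> fcps_carrier \<Omega> \<Longrightarrow> D \<omega> \<in> substs \<Delta>"
  using assms by (auto simp: in_space_low_ctx)

lemma low_ctx_discrete:
  "(\<lambda>z. h (fcps_size (fst z)) (snd (snd z))) \<in> low_ctx \<Gamma> \<Delta> \<rightarrow>\<^sub>M count_space UNIV"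
  by (rule discrete_compose2[OF measurable_compose[OF low_ctx_measurable(1) fcps_size_measurable] _ low_ctx_measurable(3)]) simp

text \<open>The set is a function of the size and of the random substitution, both from countable
  sets, so \<open>P\<close> may be any predicate.\<close>

lemma event_set_measurable:
  "(\<lambda>z. {\<omega> \<in> fcps_carrier (fst z). P (snd (snd z) \<omega>)}) \<in> low_ctx \<Gamma> \<Delta> \<rightarrow>\<^sub>M count_space UNIV"
  unfolding fcps_carrier_def using low_ctx_discrete[of "\<lambda>n D. {\<omega> \<in> {..<n}. P (D \<omega>)}"] by simp

lemma restricted_vals_measurable:
  assumes "\<And>z \<omega>. z \<in> space (low_ctx \<Gamma> \<Delta>) \<Longrightarrow> \<omega> \<in> fcps_carrier (fst z) \<Longrightarrow> h (snd (snd z)) \<omega> \<in> space (exact_space A)"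
  shows "(\<lambda>z. \<lambda>\<omega> \<in> fcps_carrier (fst z). h (snd (snd z)) \<omega>) \<in> low_ctx \<Gamma> \<Delta> \<rightarrow>\<^sub>M exact_vals A"
  unfolding exact_vals_def
proof (rule measurable_count_spaceI)
  show "(\<lambda>z. \<lambda>\<omega> \<in> fcps_carrier (fst z). h (snd (snd z)) \<omega>) \<in> low_ctx \<Gamma> \<Delta> \<rightarrow>\<^sub>M count_space UNIV"
    unfolding fcps_carrier_def using low_ctx_discrete[of "\<lambda>n D. \<lambda>\<omega> \<in> {..<n}. h D \<omega>"] by simp
qed (use assms in \<open>auto simp: fcps_carrier_def intro: restrict_exts\<close>)

lemma sound_exact_return:
  assumes M: "exact_pure_typed \<Delta> M A"
  shows "exact_sound \<Gamma> \<Delta> A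
    (exact_low (EReturn M) \<Gamma> \<Delta>) (exact_high (EReturn M) \<Gamma> \<Delta>)"
proof -
  have sem: "exact_pure_sem M (D \<omega>) \<in> space (exact_space A)"
    if "(\<Omega>, \<gamma>, D) \<in> space (low_ctx \<Gamma> \<Delta>)" "\<omega> \<in> fcps_carrier \<Omega>" for \<Omega> \<gamma> D \<omega>
    using exact_pure_sem_in[OF M low_ctx_D(3)[OF that]] .
  have "exact_sound \<Gamma> \<Delta> A
    (\<lambda>\<Omega> \<gamma> D. P_return (exact_results A \<Omega>) (\<Omega>, fcps_id \<Omega>, \<lambda>\<omega> \<in> fcps_carrier \<Omega>. exact_pure_sem M (D \<omega>)))
    (\<lambda>\<gamma> \<delta>. P_return (exact_space A) (exact_pure_sem M \<delta>))"
  proof (rule sound_return[OF interp_exact])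
    show "(\<lambda>z. (fst z, fcps_id (fst z), \<lambda>\<omega> \<in> fcps_carrier (fst z). exact_pure_sem M (snd (snd z) \<omega>))) \<in> low_ctx \<Gamma> \<Delta> \<rightarrow>\<^sub>M big (exact_vals A)"
    proof (rule big_measurableI[OF low_ctx_measurable(1) fcps_id_measurable[OF low_ctx_measurable(1)] restricted_vals_measurable fcps_id_exts])
      show "exact_pure_sem M (snd (snd z) \<omega>) \<in> space (exact_space A)"
        if "z \<in> space (low_ctx \<Gamma> \<Delta>)" "\<omega> \<in> fcps_carrier (fst z)" for z \<omega>
        using sem[of "fst z" "fst (snd z)" "snd (snd z)"] that by simp
    qed
    fix \<Omega> \<gamma> D assume z: "(\<Omega>, \<gamma>, D) \<in> space (low_ctx \<Gamma> \<Delta>)"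
    show "(\<Omega>, fcps_id \<Omega>, \<lambda>\<omega> \<in> fcps_carrier \<Omega>. exact_pure_sem M (D \<omega>)) \<in> exact_fib A \<Omega>"
      using low_ctx_D(1)[OF z] sem[OF z] by (auto simp: exact_fib_def fcps_id_hom)
    show "post exact_rd h (\<Omega>, fcps_id \<Omega>, \<lambda>\<omega> \<in> fcps_carrier \<Omega>. exact_pure_sem M (D \<omega>))
        = cint \<Omega> (\<lambda>\<omega>. wint (P_return (exact_space A) (exact_pure_sem M (D \<omega>))) (h \<omega>))"
      if "\<And>\<omega>. h \<omega> \<in> borel_measurable (exact_space A)" for h
      unfolding post_def using that sem[OF z] by (auto simp: fcps_id_def wint_P_return intro!: cint_cong)
  qed simp
  then show ?thesis
    by (rule sound_cong) (simp_all add: P_return_exact_low exact_pure_ty_eq[OF M])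
qed

lemma sound_sample_return:
  assumes e: "sample_pure_typed \<Gamma> e \<tau>"
  shows "sample_sound \<Gamma> \<Delta> \<tau>
    (sample_low (SReturn e) \<Gamma> \<Delta>) (sample_high (SReturn e) \<Gamma> \<Delta>)"
proof -
  note sem = measurable_space[OF sample_pure_sem_measurable[OF e]]
  have "sample_sound \<Gamma> \<Delta> \<tau>
    (\<lambda>\<Omega> \<gamma> D. P_return (sample_results \<tau> \<Omega>) (\<Omega>, fcps_id \<Omega>, sample_pure_sem e \<gamma>))
    (\<lambda>\<gamma> \<delta>. P_return (sample_space \<tau>) (sample_pure_sem e \<gamma>))"
  proof (rule sound_return[OF interp_sample])
    show "(\<lambda>z. (fst z, fcps_id (fst z), sample_pure_sem e (fst (snd z)))) \<in> low_ctx \<Gamma> \<Delta> \<rightarrow>\<^sub>M big (sample_space \<tau>)"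
      by (rule big_measurableI[OF low_ctx_measurable(1) fcps_id_measurable[OF low_ctx_measurable(1)]
            measurable_compose[OF low_ctx_measurable(2) sample_pure_sem_measurable[OF e]] fcps_id_exts])
    fix \<Omega> \<gamma> D assume z: "(\<Omega>, \<gamma>, D) \<in> space (low_ctx \<Gamma> \<Delta>)"
    show "(\<Omega>, fcps_id \<Omega>, sample_pure_sem e \<gamma>) \<in> sample_fib \<tau> \<Omega>"
      using low_ctx_D[OF z] sem by (simp add: sample_fib_def fcps_id_hom)
    show "post sample_rd h (\<Omega>, fcps_id \<Omega>, sample_pure_sem e \<gamma>)
        = cint \<Omega> (\<lambda>\<omega>. wint (P_return (sample_space \<tau>) (sample_pure_sem e \<gamma>)) (h \<omega>))"
      if "\<And>\<omega>. h \<omega> \<in> borel_measurable (sample_space \<tau>)" for h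
      unfolding post_def using that low_ctx_D(2)[OF z] sem by (auto simp: fcps_id_def wint_P_return intro!: cint_cong)
  qed simp
  then show ?thesis
    by (rule sound_cong) (simp_all add: P_return_sample_low sample_pure_ty_eq[OF e])
qed

text \<open>An exact flip draws nothing: it moves the coin into the finite space.
  \<open>cint_tensor_flip\<close> matches the average over the enlarged space with the high-level
  coin.\<close>

lemma sound_flip:
  assumes e: "sample_pure_typed \<Gamma> e SRealT"
  shows "exact_sound \<Gamma> \<Delta> EBoolT
    (exact_low (EFlip e) \<Gamma> \<Delta>) (exact_high (EFlip e) \<Gamma> \<Delta>)"
proof -
  let ?N = "low_ctx \<Gamma> \<Delta>"
  define t where "t \<Omega> \<gamma> = (let \<Omega>f = fcps_flip (real_sem e \<gamma>); \<Omega>' = fcps_tensor \<Omega> \<Omega>f in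
      (\<Omega>', fcps_proj1 \<Omega> \<Omega>f, \<lambda>\<omega>' \<in> fcps_carrier \<Omega>'. VBool (fcps_proj2 \<Omega> \<Omega>f \<omega>' = 1)))" for \<Omega> \<gamma>
  have proj1: "fcps_proj1 \<Omega> (fcps_flip p) = (\<lambda>\<omega> \<in> {..<fcps_size \<Omega> * 2}. \<omega> div 2)" for \<Omega> p
    by (simp add: fcps_proj1_def fcps_carrier_def size_tensor_flip)
  \<comment> \<open>In this form the map and the random variable depend on the size alone and not on
    the real parameter, so their measurability is discrete.\<close>
  have t_eq: "t \<Omega> \<gamma> = (fcps_tensor \<Omega> (fcps_flip (real_sem e \<gamma>)), \<lambda>\<omega> \<in> {..<fcps_size \<Omega> * 2}. \<omega> div 2,
      \<lambda>\<omega> \<in> {..<fcps_size \<Omega> * 2}. VBool (\<omega> mod 2 = 1))" for \<Omega> \<gamma>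
    by (auto simp: t_def Let_def proj1 fcps_proj2_def fcps_carrier_def size_tensor_flip)
  have "exact_sound \<Gamma> \<Delta> EBoolT
    (\<lambda>\<Omega> \<gamma> D. P_return (exact_results EBoolT \<Omega>) (t \<Omega> \<gamma>))
    (\<lambda>\<gamma> \<delta>. P_lift (distr (measure_pmf (flip_pmf (real_sem e \<gamma>))) (exact_space EBoolT) VBool))"
  proof (rule sound_return[OF interp_exact])
    show "(\<lambda>z. t (fst z) (fst (snd z))) \<in> ?N \<rightarrow>\<^sub>M big (exact_vals EBoolT)"
      unfolding t_eq
    proof (rule big_measurableI)
      note size = measurable_compose[OF low_ctx_measurable(1)[of \<Gamma> \<Delta>] fcps_size_measurable]
      show "(\<lambda>z. fcps_tensor (fst z) (fcps_flip (real_sem e (fst (snd z))))) \<in> ?N \<rightarrow>\<^sub>M fcps_space"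
        by (rule fcps_tensor_flip_measurable[OF low_ctx_measurable(1) measurable_compose[OF low_ctx_measurable(2) real_sem_measurable[OF e]]])
      show "(\<lambda>z. \<lambda>\<omega> \<in> {..<fcps_size (fst z) * 2}. \<omega> div 2) \<in> ?N \<rightarrow>\<^sub>M count_space UNIV"
        by (rule discrete_compose1[OF size])
      have "(\<lambda>z. \<lambda>\<omega> \<in> {..<fcps_size (fst z) * 2}. VBool (\<omega> mod 2 = 1)) \<in> ?N \<rightarrow>\<^sub>M count_space UNIV"
        by (rule discrete_compose1[OF size])
      then show "(\<lambda>z. \<lambda>\<omega> \<in> {..<fcps_size (fst z) * 2}. VBool (\<omega> mod 2 = 1)) \<in> ?N \<rightarrow>\<^sub>M exact_vals EBoolT"
        unfolding exact_vals_def by (rule measurable_count_spaceI) (auto intro: restrict_exts)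
    qed (auto intro: restrict_exts)
    fix \<Omega> \<gamma> D assume z: "(\<Omega>, \<gamma>, D) \<in> space ?N"
    let ?p = "real_sem e \<gamma>"
    show "t \<Omega> \<gamma> \<in> exact_fib EBoolT \<Omega>"
      using is_fcps_tensor_flip[OF low_ctx_D(1)[OF z], of ?p] fcps_proj1_hom[OF low_ctx_D(1)[OF z], of ?p]
      by (auto simp: t_def Let_def exact_fib_def)
    show "post exact_rd h (t \<Omega> \<gamma>) = cint \<Omega> (\<lambda>\<omega>. wint (P_lift (distr (measure_pmf (flip_pmf ?p)) (exact_space EBoolT) VBool)) (h \<omega>))" for h
    proof -
      have "post exact_rd h (t \<Omega> \<gamma>) = cint (fcps_tensor \<Omega> (fcps_flip ?p)) (\<lambda>i. h (i div 2) (VBool (i mod 2 = 1)))"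
        unfolding post_def t_eq by (auto simp: fcps_carrier_def size_tensor_flip intro!: cint_cong)
      also have "\<dots> = cint \<Omega> (\<lambda>\<omega>. wint (P_lift (distr (measure_pmf (flip_pmf ?p)) (exact_space EBoolT) VBool)) (h \<omega>))"
        unfolding cint_tensor_flip wint_P_lift_flip by simp
      finally show ?thesis .
    qed
    show "fcps_pos (fst (t \<Omega> \<gamma>))" if "fcps_pos \<Omega>"
      using that by (simp add: t_eq fcps_pos_tensor_flip)
  qed
  then show ?thesis
    by (rule sound_cong) (simp_all add: P_return_exact_low t_def Let_def)
qed

text \<open>The score is the factor by which conditioning on the smaller event renormalizes; by
  \<open>cint_restrict\<close> the product is the average of an indicator, which is the high-level
  score. From an event that is not null, a null one arises only with score 0.\<close>

lemma sound_observe: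
  assumes M: "exact_pure_typed \<Delta> M EBoolT"
  shows "exact_sound \<Gamma> \<Delta> EUnitT
    (exact_low (EObserve M) \<Gamma> \<Delta>) (exact_high (EObserve M) \<Gamma> \<Delta>)"
proof -
  let ?N = "low_ctx \<Gamma> \<Delta>"
  define F where "F \<Omega> D = {\<omega> \<in> fcps_carrier \<Omega>. exact_pure_sem M (D \<omega>) = VBool True}" for \<Omega> D
  have F: "(\<lambda>z. F (fst z) (snd (snd z))) \<in> ?N \<rightarrow>\<^sub>M count_space UNIV"
    unfolding F_def by (rule event_set_measurable)
  have F': "(\<lambda>z. F (fst z) (snd (snd z))) \<in> ?N \<rightarrow>\<^sub>M count_space {E. finite E}"
    by (rule measurable_count_spaceI[OF F]) (simp add: F_def)
  have "exact_sound \<Gamma> \<Delta> EUnitT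
    (\<lambda>\<Omega> \<gamma> D. P_bind (score (fcps_cond_prob \<Omega> (F \<Omega> D))) (\<lambda>_. P_return (exact_results EUnitT \<Omega>)
       (fcps_restrict \<Omega> (F \<Omega> D), fcps_id \<Omega>, \<lambda>_ \<in> fcps_carrier \<Omega>. VUnit)))
    (\<lambda>\<gamma> \<delta>. score (of_bool (exact_pure_sem M \<delta> = VBool True)))"
  proof (rule sound_score[OF interp_exact])
    show "(\<lambda>z. fcps_cond_prob (fst z) (F (fst z) (snd (snd z)))) \<in> borel_measurable ?N"
      by (rule fcps_cond_prob_measurable[OF low_ctx_measurable(1) F'])
    show "(\<lambda>z. (fcps_restrict (fst z) (F (fst z) (snd (snd z))), fcps_id (fst z), \<lambda>_ \<in> fcps_carrier (fst z). VUnit)) \<in> ?N \<rightarrow>\<^sub>M big (exact_vals EUnitT)"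
    proof (rule big_measurableI[OF fcps_restrict_measurable[OF low_ctx_measurable(1) F] fcps_id_measurable[OF low_ctx_measurable(1)] _ fcps_id_exts])
      show "(\<lambda>z. \<lambda>_ \<in> fcps_carrier (fst z). VUnit) \<in> ?N \<rightarrow>\<^sub>M exact_vals EUnitT"
        by (rule restricted_vals_measurable[where h="\<lambda>_ _. VUnit"]) simp
    qed
    fix \<Omega> \<gamma> D assume z: "(\<Omega>, \<gamma>, D) \<in> space ?N"
    show "(fcps_restrict \<Omega> (F \<Omega> D), fcps_id \<Omega>, \<lambda>_ \<in> fcps_carrier \<Omega>. VUnit) \<in> exact_fib EUnitT \<Omega>"
      using low_ctx_D(1)[OF z] by (auto simp: exact_fib_def is_fcps_restrict fcps_id_hom_restrict)
    show "ennreal (fcps_cond_prob \<Omega> (F \<Omega> D)) * post exact_rd h (fcps_restrict \<Omega> (F \<Omega> D), fcps_id \<Omega>, \<lambda>_ \<in> fcps_carrier \<Omega>. VUnit)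
        = cint \<Omega> (\<lambda>\<omega>. wint (score (of_bool (exact_pure_sem M (D \<omega>) = VBool True))) (h \<omega>))" for h
    proof -
      have "post exact_rd h (fcps_restrict \<Omega> (F \<Omega> D), fcps_id \<Omega>, \<lambda>_ \<in> fcps_carrier \<Omega>. VUnit) = cint (fcps_restrict \<Omega> (F \<Omega> D)) (\<lambda>\<omega>. h \<omega> VUnit)"
        unfolding post_def by (auto simp: fcps_id_def intro!: cint_cong)
      then show ?thesis
        by (auto simp: cint_restrict wint_score F_def intro!: cint_cong)
    qed
    show "fcps_cond_prob \<Omega> (F \<Omega> D) = 0 \<or> fcps_pos (fst (fcps_restrict \<Omega> (F \<Omega> D), fcps_id \<Omega>, \<lambda>_ \<in> fcps_carrier \<Omega>. VUnit))"
      if "fcps_pos \<Omega>"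
      using fcps_pos_restrict[OF that, of "F \<Omega> D"] fcps_cond_prob_nonneg[of \<Omega> "F \<Omega> D"] by auto
  qed (rule fcps_cond_prob_nonneg)
  then show ?thesis
    by (rule sound_cong) (simp_all add: P_return_exact_low F_def Let_def)
qed

text \<open>The density does not depend on the point of \<Omega> and comes out of the average as a
  factor.\<close>

lemma sound_obs:
  assumes e: "sample_pure_typed \<Gamma> eo \<tau>" and d: "dist_typed \<Gamma> d \<tau>"
  shows "sample_sound \<Gamma> \<Delta> SUnitT
    (sample_low (SObs eo d) \<Gamma> \<Delta>) (sample_high (SObs eo d) \<Gamma> \<Delta>)"
proof -
  let ?N = "low_ctx \<Gamma> \<Delta>"
  have "sample_sound \<Gamma> \<Delta> SUnitT
    (\<lambda>\<Omega> \<gamma> D. P_bind (score (dist_density d \<gamma> (sample_pure_sem eo \<gamma>))) (\<lambda>_.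
       P_return (sample_results SUnitT \<Omega>) (\<Omega>, fcps_id \<Omega>, VUnit)))
    (\<lambda>\<gamma> \<delta>. score (dist_density d \<gamma> (sample_pure_sem eo \<gamma>)))"
  proof (rule sound_score[OF interp_sample])
    show "(\<lambda>z. dist_density d (fst (snd z)) (sample_pure_sem eo (fst (snd z)))) \<in> borel_measurable ?N"
      by (rule measurable_compose[OF low_ctx_measurable(2) dist_density_measurable[OF d sample_pure_sem_measurable[OF e]]])
    show "(\<lambda>z. (fst z, fcps_id (fst z), VUnit)) \<in> ?N \<rightarrow>\<^sub>M big (sample_space SUnitT)"
      by (rule big_measurableI[OF low_ctx_measurable(1) fcps_id_measurable[OF low_ctx_measurable(1)] _ fcps_id_exts]) simp
    fix \<Omega> \<gamma> D assume z: "(\<Omega>, \<gamma>, D) \<in> space ?N"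
    show "(\<Omega>, fcps_id \<Omega>, VUnit) \<in> sample_fib SUnitT \<Omega>"
      using low_ctx_D(1)[OF z] by (simp add: sample_fib_def fcps_id_hom)
    let ?w = "dist_density d \<gamma> (sample_pure_sem eo \<gamma>)"
    show "ennreal ?w * post sample_rd h (\<Omega>, fcps_id \<Omega>, VUnit) = cint \<Omega> (\<lambda>\<omega>. wint (score ?w) (h \<omega>))" for h
    proof -
      have "post sample_rd h (\<Omega>, fcps_id \<Omega>, VUnit) = cint \<Omega> (\<lambda>\<omega>. h \<omega> VUnit)"
        unfolding post_def by (auto simp: fcps_id_def intro!: cint_cong)
      then show ?thesis
        by (simp add: wint_score dist_density_nonneg cint_def sum_distrib_left ac_simps)
    qed
  qed (simp_all add: dist_density_nonneg)
  then show ?thesis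
    by (rule sound_cong) (simp_all add: P_return_sample_low)
qed

section \<open>Sequencing in the two languages\<close>

lemma high_in_space:
  "exact_typed \<Gamma> \<Delta> M A \<Longrightarrow> \<gamma> \<in> space (ctx_space \<Gamma>) \<Longrightarrow> \<delta> \<in> substs \<Delta> \<Longrightarrow> exact_high M \<Gamma> \<Delta> \<gamma> \<delta> \<in> space (P_space (exact_space A))"
  "sample_typed \<Gamma> \<Delta> e \<tau> \<Longrightarrow> \<gamma> \<in> space (ctx_space \<Gamma>) \<Longrightarrow> \<delta> \<in> substs \<Delta> \<Longrightarrow> sample_high e \<Gamma> \<Delta> \<gamma> \<delta> \<in> space (P_space (sample_space \<tau>))"
  by (auto intro: measurable_space[OF high_measurable(1)] measurable_space[OF high_measurable(2)])

text \<open>In \<open>sound_let\<close>, the sampling substitution stays fixed and the random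
  substitution, pulled back along \<open>f1\<close>, gains the random variable \<open>V\<close>. The
  high-level continuation is measurable because exact values are discrete.\<close>

lemma sound_exact_let:
  assumes M: "exact_typed \<Gamma> \<Delta> M A" and N: "exact_typed \<Gamma> (fmupd X A \<Delta>) N B"
    and sM: "exact_sound \<Gamma> \<Delta> A (exact_low M \<Gamma> \<Delta>) (exact_high M \<Gamma> \<Delta>)"
    and sN: "exact_sound \<Gamma> (fmupd X A \<Delta>) B
      (exact_low N \<Gamma> (fmupd X A \<Delta>)) (exact_high N \<Gamma> (fmupd X A \<Delta>))"
  shows "exact_sound \<Gamma> \<Delta> B
    (exact_low (ELet X M N) \<Gamma> \<Delta>) (exact_high (ELet X M N) \<Gamma> \<Delta>)"
proof -
  let ?R = "restrict_space (low_ctx \<Gamma> \<Delta> \<Otimes>\<^sub>M big (exact_vals A)) {w. snd w \<in> exact_fib A (fst (fst w))}"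
  note f = measurable_restrict_space1[OF measurable_compose[OF measurable_fst]]
  note s = measurable_restrict_space1[OF measurable_compose[OF measurable_snd]]
  have "exact_sound \<Gamma> \<Delta> B
    (\<lambda>\<Omega> \<gamma> D. P_bind (exact_low M \<Gamma> \<Delta> \<Omega> \<gamma> D) (\<lambda>p.
      P_bind (exact_low N \<Gamma> (fmupd X A \<Delta>) (fst p) \<gamma> (\<lambda>\<omega> \<in> fcps_carrier (fst p). (D (fst (snd p) \<omega>))(X := snd (snd p) \<omega>))) (\<lambda>q.
      P_return (exact_results B \<Omega>) (fst q, compose (fcps_carrier (fst q)) (fst (snd p)) (fst (snd q)), snd (snd q)))))
    (\<lambda>\<gamma> \<delta>. P_bind (exact_high M \<Gamma> \<Delta> \<gamma> \<delta>) (\<lambda>x. exact_high N \<Gamma> (fmupd X A \<Delta>) \<gamma> (\<delta>(X := x))))"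
  proof (rule sound_let[OF interp_exact sM interp_exact sN])
    show "(\<lambda>w. (fst (snd w), fst (snd (fst w)), \<lambda>\<omega> \<in> fcps_carrier (fst (snd w)).
        (snd (snd (fst w)) (fst (snd (snd w)) \<omega>))(X := snd (snd (snd w)) \<omega>))) \<in> ?R \<rightarrow>\<^sub>M low_ctx \<Gamma> (fmupd X A \<Delta>)"
    proof (rule low_ctx_measurableI[OF s[OF big_measurable(1)] f[OF low_ctx_measurable(2)]])
      show "(\<lambda>w. \<lambda>\<omega> \<in> fcps_carrier (fst (snd w)). (snd (snd (fst w)) (fst (snd (snd w)) \<omega>))(X := snd (snd (snd w)) \<omega>)) \<in> ?R \<rightarrow>\<^sub>M count_space UNIV"
        unfolding fcps_carrier_def
        by (rule discrete_compose4[OF measurable_compose[OF s[OF big_measurable(1)] fcps_size_measurable] _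
            f[OF low_ctx_measurable(3)] countable_exts_substs s[OF big_measurable(2)] countable_exts_nat
            exact_vals_measurableD[OF s[OF big_measurable(3)]],
            where h="\<lambda>n D f V. \<lambda>\<omega> \<in> {..<n}. (D (f \<omega>))(X := V \<omega>)"]) simp
      fix w assume "w \<in> space ?R"
      then obtain \<Omega> \<gamma> D \<Omega>1 f1 V where w: "w = ((\<Omega>, \<gamma>, D), \<Omega>1, f1, V)"
        and z: "(\<Omega>, \<gamma>, D) \<in> space (low_ctx \<Gamma> \<Delta>)" and fib: "(\<Omega>1, f1, V) \<in> exact_fib A \<Omega>"
        by (cases w) (auto simp: space_restrict_space space_pair_measure)
      have "f1 \<in> fcps_carrier \<Omega>1 \<rightarrow>\<^sub>E fcps_carrier \<Omega>" "V \<in> fcps_carrier \<Omega>1 \<rightarrow>\<^sub>E space (exact_space A)"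
        using fib by (auto simp: exact_fib_def fcps_hom_def)
      then have "(\<lambda>\<omega> \<in> fcps_carrier \<Omega>1. (D (f1 \<omega>))(X := V \<omega>)) \<in> fcps_carrier \<Omega>1 \<rightarrow>\<^sub>E substs (fmupd X A \<Delta>)"
        by (intro restrict_PiE_iff[THEN iffD2] ballI substs_upd low_ctx_D(3)[OF z]) auto
      then show "(\<lambda>\<omega> \<in> fcps_carrier (fst (snd w)). (snd (snd (fst w)) (fst (snd (snd w)) \<omega>))(X := snd (snd (snd w)) \<omega>))
          \<in> fcps_carrier (fst (snd w)) \<rightarrow>\<^sub>E substs (fmupd X A \<Delta>)"
        unfolding w fst_conv snd_conv .
    qed
    show "(\<lambda>x. exact_high N \<Gamma> (fmupd X A \<Delta>) \<gamma> (\<delta>(X := x))) \<in> exact_space A \<rightarrow>\<^sub>M P_space (exact_space B)"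
      if "\<gamma> \<in> space (ctx_space \<Gamma>)" "\<delta> \<in> substs \<Delta>" for \<gamma> \<delta>
      using high_in_space(1)[OF N that(1) substs_upd[OF that(2)]] by (auto simp: measurable_exact_space1)
  qed (auto intro: high_in_space(1)[OF M] simp del: fun_upd_apply)
  then show ?thesis
    by (rule sound_cong) (simp_all add: split_def P_return_exact_low exact_ty_of_eq[OF M]
        exact_ty_of_eq[OF exact_typed_sample_typed.intros(2)[OF M N]] del: fun_upd_apply)
qed

text \<open>The first value is now a single sampled parameter: it extends \<open>\<gamma>\<close>,
  and \<open>D\<close> is only pulled back to the new space. Sample types may contain reals, so
  measurability of the continuation rests on \<open>high_measurable\<close>.\<close>

lemma sound_sample_let:
  assumes e1: "sample_typed \<Gamma> \<Delta> e1 \<sigma>" and e2: "sample_typed (fmupd x \<sigma> \<Gamma>) \<Delta> e2 \<tau>"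
    and s1: "sample_sound \<Gamma> \<Delta> \<sigma> (sample_low e1 \<Gamma> \<Delta>) (sample_high e1 \<Gamma> \<Delta>)"
    and s2: "sample_sound (fmupd x \<sigma> \<Gamma>) \<Delta> \<tau>
      (sample_low e2 (fmupd x \<sigma> \<Gamma>) \<Delta>) (sample_high e2 (fmupd x \<sigma> \<Gamma>) \<Delta>)"
  shows "sample_sound \<Gamma> \<Delta> \<tau>
    (sample_low (SLet x e1 e2) \<Gamma> \<Delta>) (sample_high (SLet x e1 e2) \<Gamma> \<Delta>)"
proof -
  let ?R = "restrict_space (low_ctx \<Gamma> \<Delta> \<Otimes>\<^sub>M big (sample_space \<sigma>)) {w. snd w \<in> sample_fib \<sigma> (fst (fst w))}"
  note f = measurable_restrict_space1[OF measurable_compose[OF measurable_fst]]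
  note s = measurable_restrict_space1[OF measurable_compose[OF measurable_snd]]
  have "sample_sound \<Gamma> \<Delta> \<tau>
    (\<lambda>\<Omega> \<gamma> D. P_bind (sample_low e1 \<Gamma> \<Delta> \<Omega> \<gamma> D) (\<lambda>p.
      P_bind (sample_low e2 (fmupd x \<sigma> \<Gamma>) \<Delta> (fst p) (\<gamma>(x := snd (snd p))) (compose (fcps_carrier (fst p)) D (fst (snd p)))) (\<lambda>q.
      P_return (sample_results \<tau> \<Omega>) (fst q, compose (fcps_carrier (fst q)) (fst (snd p)) (fst (snd q)), snd (snd q)))))
    (\<lambda>\<gamma> \<delta>. P_bind (sample_high e1 \<Gamma> \<Delta> \<gamma> \<delta>) (\<lambda>v. sample_high e2 (fmupd x \<sigma> \<Gamma>) \<Delta> (\<gamma>(x := v)) \<delta>))"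
  proof (rule sound_let[OF interp_sample s1 interp_sample s2])
    show "(\<lambda>w. (fst (snd w), (fst (snd (fst w)))(x := snd (snd (snd w))),
        compose (fcps_carrier (fst (snd w))) (snd (snd (fst w))) (fst (snd (snd w))))) \<in> ?R \<rightarrow>\<^sub>M low_ctx (fmupd x \<sigma> \<Gamma>) \<Delta>"
    proof (rule low_ctx_measurableI[OF s[OF big_measurable(1)] measurable_ctx_upd[OF f[OF low_ctx_measurable(2)] s[OF big_measurable(3)]]])
      show "(\<lambda>w. compose (fcps_carrier (fst (snd w))) (snd (snd (fst w))) (fst (snd (snd w)))) \<in> ?R \<rightarrow>\<^sub>M count_space UNIV"
        unfolding fcps_carrier_def
        by (rule discrete_compose3[OF measurable_compose[OF s[OF big_measurable(1)] fcps_size_measurable] _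
            f[OF low_ctx_measurable(3)] countable_exts_substs s[OF big_measurable(2)],
            where h="\<lambda>n D f. compose {..<n} D f"]) simp
      fix w assume "w \<in> space ?R"
      then obtain \<Omega> \<gamma> D \<Omega>1 f1 v where w: "w = ((\<Omega>, \<gamma>, D), \<Omega>1, f1, v)"
        and z: "(\<Omega>, \<gamma>, D) \<in> space (low_ctx \<Gamma> \<Delta>)" and fib: "(\<Omega>1, f1, v) \<in> sample_fib \<sigma> \<Omega>"
        by (cases w) (auto simp: space_restrict_space space_pair_measure)
      have "f1 \<in> fcps_carrier \<Omega>1 \<rightarrow>\<^sub>E fcps_carrier \<Omega>"
        using fib by (auto simp: sample_fib_def fcps_hom_def)
      then have "compose (fcps_carrier \<Omega>1) D f1 \<in> fcps_carrier \<Omega>1 \<rightarrow>\<^sub>E substs \<Delta>"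
        unfolding compose_def by (intro restrict_PiE_iff[THEN iffD2] ballI low_ctx_D(3)[OF z]) auto
      then show "compose (fcps_carrier (fst (snd w))) (snd (snd (fst w))) (fst (snd (snd w))) \<in> fcps_carrier (fst (snd w)) \<rightarrow>\<^sub>E substs \<Delta>"
        unfolding w fst_conv snd_conv .
    qed
    show "(\<lambda>v. sample_high e2 (fmupd x \<sigma> \<Gamma>) \<Delta> (\<gamma>(x := v)) \<delta>) \<in> sample_space \<sigma> \<rightarrow>\<^sub>M P_space (sample_space \<tau>)"
      if \<gamma>: "\<gamma> \<in> space (ctx_space \<Gamma>)" and \<delta>: "\<delta> \<in> substs \<Delta>" for \<gamma> \<delta>
    proof (rule measurable_compose[OF _ high_measurable(2)[OF e2 \<delta>]])
      show "(\<lambda>v. \<gamma>(x := v)) \<in> sample_space \<sigma> \<rightarrow>\<^sub>M ctx_space (fmupd x \<sigma> \<Gamma>)"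
        using \<gamma> by (intro measurable_ctx_upd) auto
    qed
  qed (auto intro: high_in_space(2)[OF e1] simp: compose_def simp del: fun_upd_apply)
  then show ?thesis
    by (rule sound_cong) (simp_all add: split_def P_return_sample_low sample_ty_of_eq[OF e1]
        sample_ty_of_eq[OF exact_typed_sample_typed.intros(8)[OF e1 e2]] del: fun_upd_apply)
qed

section \<open>The induction on typing derivations\<close>

lemma low_sound:
  "exact_typed \<Gamma> \<Delta> M A \<Longrightarrow>
    exact_sound \<Gamma> \<Delta> A (exact_low M \<Gamma> \<Delta>) (exact_high M \<Gamma> \<Delta>)"
  "sample_typed \<Gamma> \<Delta> e \<tau> \<Longrightarrow>
    sample_sound \<Gamma> \<Delta> \<tau> (sample_low e \<Gamma> \<Delta>) (sample_high e \<Gamma> \<Delta>)"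
proof (induction rule: exact_typed_sample_typed.inducts)
  case 1 then show ?case by (rule sound_exact_return)
next
  case 2 then show ?case by (intro sound_exact_let)
next
  case (3 \<Gamma> e \<Delta> M A N)
  from sound_if[OF 3(1,4,5)] show ?case
    by (rule sound_cong) simp_all
next
  case 4 then show ?case by (rule sound_flip)
next
  case 5 then show ?case by (rule sound_observe)
next
  case (6 \<Gamma> \<Delta> e \<tau> A)
  from sound_exact_boundary[OF 6(3,2)] show ?case
    by (rule sound_cong) (simp_all add: split_def P_return_exact_low exact_ty_of_eq[OF exact_typed_sample_typed.intros(6)[OF 6(1,2)]])
next
  case 7 then show ?case by (rule sound_sample_return)
next
  case 8 then show ?case by (intro sound_sample_let)
next
  case (9 \<Gamma> e1 \<Delta> e2 \<tau> e3)
  from sound_if[OF 9(1,4,5)] show ?case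
    by (rule sound_cong) simp_all
next
  case (10 \<Gamma> d \<tau> \<Delta>)
  from sound_dist[OF 10] show ?case
    by (rule sound_cong) (simp_all add: P_return_sample_low dist_ty_eq[OF 10])
next
  case 11 then show ?case by (rule sound_obs)
next
  case (12 \<Gamma> \<Delta> M A \<tau>)
  from sound_sample_boundary[OF 12(3,2)] show ?case
    by (rule sound_cong) (simp_all add: split_def P_return_sample_low exact_ty_of_eq[OF 12(1)]
        sample_ty_of_eq[OF exact_typed_sample_typed.intros(12)[OF 12(1,2)]])
qed

section \<open>From weighted integrals to importance samplers\<close>

lemma importance_eqI:
  assumes \<mu>: "\<mu> \<in> space (P_space A)" and \<nu>: "\<nu> \<in> space (P_space A)"
    and eq: "\<And>g. g \<in> borel_measurable A \<Longrightarrow> wint \<mu> g = wint \<nu> g"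
  shows "importance_eq A \<mu> \<nu>"
  unfolding importance_eq_def
proof (intro ballI impI)
  fix k :: "'a \<Rightarrow> real" assume k [measurable]: "k \<in> borel_measurable A"
  let ?f = "\<lambda>p. fst p * k (snd p)"
  have [measurable]: "fst \<in> borel_measurable (weight_space \<Otimes>\<^sub>M A)"
    by (rule measurable_weight_spaceD) simp
  have m: "?f \<in> borel_measurable \<rho>" if "\<rho> \<in> space (P_space A)" for \<rho>
    by (subst measurable_cong_sets[OF P_spaceD(2)[OF that] refl]) measurable
  \<comment> \<open>Truncation at 0 commutes with multiplication by a nonnegative weight. With
    \<open>r\<close> the identity or the negation, this yields the positive and the negative part of
    the weighted integrand.\<close>
  have w: "(\<integral>\<^sup>+p. ennreal (fst p * r (k (snd p))) \<partial>\<rho>) = wint \<rho> (\<lambda>x. ennreal (r (k x)))"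
    if "\<rho> \<in> space (P_space A)" for \<rho> r
    unfolding wint_def using P_spaceD(3)[OF that]
    by (intro nn_integral_cong) (auto simp: ennreal_mult')
  \<comment> \<open>Weights are nonnegative, so integrability is the finiteness of a single weighted
    integral.\<close>
  have norm: "(\<integral>\<^sup>+p. ennreal (norm (?f p)) \<partial>\<rho>) = wint \<rho> (\<lambda>x. ennreal \<bar>k x\<bar>)" if "\<rho> \<in> space (P_space A)" for \<rho>
    unfolding w[OF that, symmetric] using P_spaceD(3)[OF that]
    by (intro nn_integral_cong) (auto simp: abs_mult)
  have int: "integrable \<mu> ?f \<longleftrightarrow> integrable \<nu> ?f"
    using m[OF \<mu>] m[OF \<nu>] by (simp add: integrable_iff_bounded norm[OF \<mu>, simplified] norm[OF \<nu>, simplified] eq)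
  have "integral\<^sup>L \<mu> ?f = integral\<^sup>L \<nu> ?f" if "integrable \<mu> ?f"
  proof -
    have "integral\<^sup>L \<rho> ?f = enn2real (wint \<rho> (\<lambda>x. ennreal (k x))) - enn2real (wint \<rho> (\<lambda>x. ennreal (- k x)))"
      if "\<rho> \<in> space (P_space A)" "integrable \<rho> ?f" for \<rho>
      using real_lebesgue_integral_def[OF that(2)] w[OF that(1), of "\<lambda>x. x"] w[OF that(1), of uminus] by simp
    from this[OF \<mu> that] this[OF \<nu>] that int show ?thesis by (simp add: eq)
  qed
  with int show "(integrable \<mu> (\<lambda>(a, x). a * k x) \<longleftrightarrow> integrable \<nu> (\<lambda>(b, y). b * k y)) \<and>
      (integrable \<mu> (\<lambda>(a, x). a * k x) \<longrightarrow> (\<integral>(a, x). a * k x \<partial>\<mu>) = (\<integral>(b, y). b * k y \<partial>\<nu>))"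
    by (simp add: split_def)
qed

theorem theorem3p6:
  fixes e :: sample_term and \<tau> :: sample_ty
  assumes "sample_typed fmempty fmempty e \<tau>"
  shows "eval_low e \<in> space (P_space (sample_space \<tau>)) \<and>
         eval_high e \<in> space (P_space (sample_space \<tau>)) \<and>
         importance_eq (sample_space \<tau>) (eval_low e) (eval_high e)"
proof -
  let ?T = "sample_space \<tau>" and ?D = "\<lambda>\<omega> \<in> fcps_carrier fcps_one. empty_subst"
  let ?B = "restrict_space (big ?T) (sample_fib \<tau> fcps_one)"
  define L where "L = sample_low e fmempty fmempty fcps_one empty_subst ?D"
  note s = low_sound(2)[OF assms]
  have one: "is_fcps fcps_one" "fcps_pos fcps_one"
    by (simp_all add: fcps_one_def is_fcps_def fcps_carrier_def fcps_pos_def fcps_prob_def)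
  have z: "(fcps_one, empty_subst, ?D) \<in> space (low_ctx fmempty fmempty)"
    by (simp add: in_space_low_ctx one empty_subst_in)
  have L: "L \<in> space (P_space ?B)"
    unfolding L_def by (rule sound_in_space[OF s z])
  have v: "(\<lambda>p. snd (snd p)) \<in> ?B \<rightarrow>\<^sub>M ?T"
    by (rule measurable_restrict_space1[OF big_measurable(3)])
  have low: "eval_low e = P_bind L (\<lambda>p. P_return ?T (snd (snd p)))"
    by (simp add: eval_low_def L_def split_def sample_ty_of_eq[OF assms])
  have low_space: "eval_low e \<in> space (P_space ?T)"
    unfolding low by (rule P_bind_in_space[OF L P_return_measurable[OF v]])
  have high_space: "eval_high e \<in> space (P_space ?T)"
    unfolding eval_high_def by (rule high_in_space(2)[OF assms empty_subst_in])
  have "wint (eval_low e) g = wint (eval_high e) g" if g: "g \<in> borel_measurable ?T" for g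
  proof -
    note post = measurable_restrict_space1[OF post_measurable[OF interp_sample g]]
    note deg = measurable_restrict_space1[OF degenerate_measurable]
    have "wint (eval_low e) g = wint L (\<lambda>p. g (snd (snd p)))"
      unfolding low wint_P_bind[OF L P_return_measurable[OF v] g]
      using measurable_space[OF v] g by (intro wint_cong[OF L] wint_P_return) auto
    \<comment> \<open>Evaluation counts every value in full, \<open>post\<close> only the values of
      results whose event is not null. The initial event is not null, so by the second invariant the
      difference carries no weight.\<close>
    also have "\<dots> = wint L (post sample_rd (\<lambda>_. g))"
    proof (rule antisym)
      have eq: "post sample_rd (\<lambda>_. g) p = (if fcps_pos (fst p) then g (snd (snd p)) else 0)" if "p \<in> space ?B" for p
        using that by (auto simp: post_def cint_const space_restrict_space sample_fib_def)
      then show "wint L (post sample_rd (\<lambda>_. g)) \<le> wint L (\<lambda>p. g (snd (snd p)))"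
        by (intro wint_mono[OF L]) simp
      \<comment> \<open>The infinite coefficient dominates any value of \<open>g\<close> at a
        degenerate result.\<close>
      have "wint L (\<lambda>p. g (snd (snd p))) \<le> wint L (\<lambda>p. post sample_rd (\<lambda>_. g) p + \<top> * degenerate p)"
        using eq by (intro wint_mono[OF L]) (simp add: degenerate_def)
      also have "\<dots> = wint L (post sample_rd (\<lambda>_. g)) + \<top> * wint L degenerate"
        unfolding wint_cmult[OF L deg, symmetric] by (intro wint_add[OF L post] borel_measurable_times_ennreal borel_measurable_const deg)
      also have "\<dots> = wint L (post sample_rd (\<lambda>_. g))"
        using sound_degenerate[OF s z one(2)] by (simp add: L_def)
      finally show "wint L (\<lambda>p. g (snd (snd p))) \<le> wint L (post sample_rd (\<lambda>_. g))" .
    qed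
    also have "\<dots> = cint fcps_one (\<lambda>\<omega>. wint (sample_high e fmempty fmempty empty_subst (?D \<omega>)) g)"
      unfolding L_def by (rule sound_post[OF s z g])
    \<comment> \<open>The only point carries the empty substitution, so the average over the
      one-point space is that of a constant.\<close>
    also have "\<dots> = cint fcps_one (\<lambda>\<omega>. wint (eval_high e) g)"
      by (intro cint_cong) (simp add: eval_high_def)
    also have "\<dots> = wint (eval_high e) g"
      by (simp add: cint_const one)
    finally show ?thesis .
  qed
  then show ?thesis
    using low_space high_space by (blast intro: importance_eqI)
qed

end
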